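(* Let $E/\mathbb{Q}$ be an elliptic curve with conductor $N_E$, and let $K = \mathbb{Q}(\sqrt{d})$, with $d$ a square-free integer, be a quadratic number field such that $E_\mathrm{tors}(\mathbb{Q}) \neq E_\mathrm{tors}(K)$. If $2 \mid d$, then $2 \mid N_E$.
   Context: For a number field $F$, $E_\mathrm{tors}(F)$ denotes the torsion subgroup of $E(F)$. *)

theory Defs
  imports
    Complex_Main
    "HOL-Computational_Algebra.Computational_Algebra"
    "HOL-Number_Theory.Cong"
    "HOL-Algebra.Generated_Fields"
    "HOL-Algebra.Ideal_Product"
begin

section \<open>Weierstrass equations\<close>

text \<open>\<open>WCurve a1 a2 a3 a4 a6\<close> is the equation
  \<open>y^2 + a1 x y + a3 y = x^3 + a2 x^2 + a4 x + a6\<close>; base change along a map \<open>h\<close> of coefficient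
  rings is \<open>map_wcurve h\<close>.\<close>

datatype 'a wcurve = WCurve (a1: 'a) (a2: 'a) (a3: 'a) (a4: 'a) (a6: 'a)

definition b2 :: "'a::comm_ring_1 wcurve \<Rightarrow> 'a" where
  "b2 E = a1 E ^ 2 + 4 * a2 E"

definition b4 :: "'a::comm_ring_1 wcurve \<Rightarrow> 'a" where
  "b4 E = 2 * a4 E + a1 E * a3 E"

definition b6 :: "'a::comm_ring_1 wcurve \<Rightarrow> 'a" where
  "b6 E = a3 E ^ 2 + 4 * a6 E"

definition b8 :: "'a::comm_ring_1 wcurve \<Rightarrow> 'a" where
  "b8 E = a1 E ^ 2 * a6 E + 4 * a2 E * a6 E - a1 E * a3 E * a4 E + a2 E * a3 E ^ 2 - a4 E ^ 2"

definition disc :: "'a::comm_ring_1 wcurve \<Rightarrow> 'a" where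
  "disc E = - (b2 E ^ 2 * b8 E) - 8 * b4 E ^ 3 - 27 * b6 E ^ 2 + 9 * b2 E * b4 E * b6 E"

definition elliptic_curve :: "'a::field wcurve \<Rightarrow> bool" where
  "elliptic_curve E \<longleftrightarrow> disc E \<noteq> 0"

text \<open>The equation obtained from the admissible change of variables
  \<open>x = u^2 x' + r\<close>, \<open>y = u^3 y' + u^2 s x' + t\<close>.\<close>

definition change_vars :: "'a::field \<Rightarrow> 'a \<Rightarrow> 'a \<Rightarrow> 'a \<Rightarrow> 'a wcurve \<Rightarrow> 'a wcurve" where
  "change_vars u r s t E = WCurve
     ((a1 E + 2 * s) / u)
     ((a2 E - s * a1 E + 3 * r - s ^ 2) / u ^ 2)
     ((a3 E + r * a1 E + 2 * t) / u ^ 3)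
     ((a4 E - s * a3 E + 2 * r * a2 E - (t + r * s) * a1 E + 3 * r ^ 2 - 2 * s * t) / u ^ 4)
     ((a6 E + r * a4 E + r ^ 2 * a2 E + r ^ 3 - t * a3 E - t ^ 2 - r * t * a1 E) / u ^ 6)"


section \<open>Points and torsion\<close>

datatype 'a ecpoint = Infinity | Point 'a 'a

fun on_curve :: "'a::comm_ring_1 wcurve \<Rightarrow> 'a ecpoint \<Rightarrow> bool" where
  "on_curve E Infinity \<longleftrightarrow> True"
| "on_curve E (Point x y) \<longleftrightarrow>
     y ^ 2 + a1 E * x * y + a3 E * y = x ^ 3 + a2 E * x ^ 2 + a4 E * x + a6 E"

text \<open>Chord-tangent addition, where \<open>m\<close> is the slope of the chord or tangent line.\<close>

fun ec_add :: "'a::field wcurve \<Rightarrow> 'a ecpoint \<Rightarrow> 'a ecpoint \<Rightarrow> 'a ecpoint" where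
  "ec_add E Infinity Q = Q"
| "ec_add E P Infinity = P"
| "ec_add E (Point x1 y1) (Point x2 y2) =
    (if x1 = x2 \<and> y1 + y2 + a1 E * x2 + a3 E = 0 then Infinity
     else
       let m = (if x1 = x2
                then (3 * x1 ^ 2 + 2 * a2 E * x1 + a4 E - a1 E * y1) / (2 * y1 + a1 E * x1 + a3 E)
                else (y2 - y1) / (x2 - x1));
           x3 = m ^ 2 + a1 E * m - a2 E - x1 - x2
       in Point x3 (- (m + a1 E) * x3 - (y1 - m * x1) - a3 E))"

definition ec_mult :: "'a::field wcurve \<Rightarrow> nat \<Rightarrow> 'a ecpoint \<Rightarrow> 'a ecpoint" where
  "ec_mult E n P = (ec_add E P ^^ n) Infinity"

text \<open>All number fields are realised as subfields \<open>F\<close> of the complex numbers, so that \<open>E(F)\<close> is a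
  subset of \<open>E(\<complex>)\<close>.\<close>

definition rational_points :: "rat wcurve \<Rightarrow> complex set \<Rightarrow> complex ecpoint set" where
  "rational_points E F = {P. on_curve (map_wcurve of_rat E) P \<and> set_ecpoint P \<subseteq> F}"

definition E_tors :: "rat wcurve \<Rightarrow> complex set \<Rightarrow> complex ecpoint set" where
  "E_tors E F = {P \<in> rational_points E F. \<exists>n>0. ec_mult (map_wcurve of_rat E) n P = Infinity}"

definition n_torsion :: "rat wcurve \<Rightarrow> nat \<Rightarrow> complex ecpoint set" where
  "n_torsion E n = {P \<in> rational_points E UNIV. ec_mult (map_wcurve of_rat E) n P = Infinity}"


section \<open>Number fields\<close>

definition complex_subring :: "complex set \<Rightarrow> complex ring" where
  "complex_subring A = \<lparr>carrier = A, mult = (*), one = 1, zero = 0, add = (+)\<rparr>"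

definition adjoin :: "complex set \<Rightarrow> complex set" where
  "adjoin S = generate_field (complex_subring UNIV) S"

definition quadratic_field :: "int \<Rightarrow> complex set" where
  "quadratic_field d = adjoin {csqrt (of_int d)}"

definition ring_of_integers :: "complex set \<Rightarrow> complex ring" where
  "ring_of_integers L = complex_subring {x \<in> L. algebraic_int x}"

text \<open>Automorphisms are made \<open>undefined\<close> outside \<open>L\<close>, so that each of them is a single function;
  they fix the rational numbers automatically.\<close>

definition galois_group :: "complex set \<Rightarrow> (complex \<Rightarrow> complex) set" where
  "galois_group L = ring_iso (complex_subring L) (complex_subring L) \<inter> extensional L"

definition prime_above :: "complex set \<Rightarrow> nat \<Rightarrow> complex set \<Rightarrow> bool" where
  "prime_above L p I \<longleftrightarrow> primeideal I (ring_of_integers L) \<and> of_nat p \<in> I"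

text \<open>Ramification groups in the lower numbering; for \<open>i = 0\<close> this is the inertia group.  An
  automorphism satisfying the condition maps \<open>I\<close> to itself, so these are subgroups of the
  decomposition group and coincide with the ramification groups of the completion of \<open>L\<close> at \<open>I\<close>.\<close>

definition ramification_group ::
    "complex set \<Rightarrow> complex set \<Rightarrow> nat \<Rightarrow> (complex \<Rightarrow> complex) set" where
  "ramification_group L I i =
     {\<sigma> \<in> galois_group L. \<forall>x \<in> carrier (ring_of_integers L).
        \<sigma> x - x \<in> I [^]\<^bsub>ideals_set (ring_of_integers L)\<^esub> Suc i}"


section \<open>The conductor\<close>

text \<open>Clearing denominators by scaling with an integer prime to \<open>p\<close> does not affect the
  \<open>p\<close>-adic valuation of the discriminant.  Hence it makes no difference whether minimality at \<open>p\<close>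
  is tested on \<open>p\<close>-integral equations or, as here, on integral ones.\<close>

definition integral_model :: "rat wcurve \<Rightarrow> int wcurve \<Rightarrow> bool" where
  "integral_model E W \<longleftrightarrow> (\<exists>u r s t. u \<noteq> 0 \<and> map_wcurve of_int W = change_vars u r s t E)"

definition minimal_model_at :: "nat \<Rightarrow> rat wcurve \<Rightarrow> int wcurve \<Rightarrow> bool" where
  "minimal_model_at p E W \<longleftrightarrow>
     is_arg_min (\<lambda>V. multiplicity (int p) (disc V)) (integral_model E) W"

text \<open>The reduction of a minimal equation is again an elliptic curve.\<close>

definition good_reduction :: "nat \<Rightarrow> rat wcurve \<Rightarrow> bool" where
  "good_reduction p E \<longleftrightarrow> (\<exists>W. minimal_model_at p E W \<and> \<not> [disc W = 0] (mod int p))"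

text \<open>\<open>(x, y)\<close> reduces to a point of the reduced curve at which both partial derivatives vanish.\<close>

definition singular_mod :: "nat \<Rightarrow> int wcurve \<Rightarrow> int \<Rightarrow> int \<Rightarrow> bool" where
  "singular_mod p W x y \<longleftrightarrow>
     [y ^ 2 + a1 W * x * y + a3 W * y = x ^ 3 + a2 W * x ^ 2 + a4 W * x + a6 W] (mod int p) \<and>
     [a1 W * y = 3 * x ^ 2 + 2 * a2 W * x + a4 W] (mod int p) \<and>
     [2 * y + a1 W * x + a3 W = 0] (mod int p)"

text \<open>The singular point of the reduction is unique, hence rational over the prime field.
  It is a node iff its tangent cone \<open>Y^2 + a1 X Y - (3 x + a2) X^2\<close> consists of two distinct lines
  over the algebraic closure, that is, iff this form has nonzero discriminant.\<close>

definition multiplicative_reduction :: "nat \<Rightarrow> rat wcurve \<Rightarrow> bool" where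
  "multiplicative_reduction p E \<longleftrightarrow>
     (\<exists>W x y. minimal_model_at p E W \<and> singular_mod p W x y \<and>
        \<not> [a1 W ^ 2 + 4 * (3 * x + a2 W) = 0] (mod int p))"

definition division_field :: "rat wcurve \<Rightarrow> nat \<Rightarrow> complex set" where
  "division_field E l = adjoin (\<Union>P \<in> n_torsion E l. set_ecpoint P)"

definition fixed_torsion ::
    "rat wcurve \<Rightarrow> nat \<Rightarrow> (complex \<Rightarrow> complex) set \<Rightarrow> complex ecpoint set" where
  "fixed_torsion E l G = {P \<in> n_torsion E l. \<forall>\<sigma>\<in>G. map_ecpoint \<sigma> P = P}"

text \<open>The wild part of the conductor exponent,
  \<open>\<delta> = (\<Sum>i\<ge>1. g_i / g_0 * dim (E[l] / E[l]^{G_i}))\<close>, where \<open>G_i\<close> are the ramification groups at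
  a prime above \<open>p\<close> of the \<open>l\<close>-division field, \<open>g_i\<close> are their orders, and the dimension over the
  field with \<open>l\<close> elements is the logarithm to base \<open>l\<close> of the cardinality of the quotient.  All the
  primes above \<open>p\<close> are conjugate and give the same value.\<close>

definition wild_exponent :: "nat \<Rightarrow> nat \<Rightarrow> rat wcurve \<Rightarrow> real" where
  "wild_exponent l p E =
     (let L = division_field E l;
          I = (SOME I. prime_above L p I);
          G = ramification_group L I
      in \<Sum>i. real (card (G (Suc i))) / real (card (G 0)) *
            log (real l) (real (card (n_torsion E l)) / real (card (fixed_torsion E l (G (Suc i))))))"

text \<open>The wild exponent is a nonnegative integer, does not depend on the prime \<open>l \<noteq> p\<close>, and vanishes
  for \<open>p > 3\<close>.  We take \<open>l\<close> to be the least prime different from \<open>p\<close>.\<close>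

definition conductor_exponent :: "nat \<Rightarrow> rat wcurve \<Rightarrow> nat" where
  "conductor_exponent p E =
     (if good_reduction p E then 0
      else if multiplicative_reduction p E then 1
      else 2 + nat \<lfloor>wild_exponent (if p = 2 then 3 else 2) p E\<rfloor>)"

definition conductor :: "rat wcurve \<Rightarrow> nat" where
  "conductor E =
     (\<Prod>p \<in> {p. Factorial_Ring.prime p \<and> \<not> good_reduction p E}. p ^ conductor_exponent p E)"

end

theory Submission
  imports Defs
begin

text \<open>
  A prime of bad reduction divides the conductor, so let \<open>E\<close> have good reduction at 2, let \<open>d\<close> be
  even, and let \<open>\<sigma>\<close> be the conjugation of \<open>K = \<rat>(\<surd>d)\<close>.  For a torsion point \<open>P\<close> over \<open>K\<close> put
  \<open>Q = \<sigma>P - P\<close>, so that \<open>\<sigma>Q = -Q\<close>; on the model without terms in \<open>xy\<close> and \<open>y\<close> this says that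
  \<open>Q = (x, t\<surd>d)\<close> with \<open>x\<close> and \<open>t\<close> rational.  If \<open>t \<noteq> 0\<close>, then the cubic takes a value of odd
  2-adic valuation at \<open>x\<close>, and by the duplication formula the valuations of the abscissae of
  \<open>2Q, 4Q, 8Q, \<dots>\<close> decrease strictly, so \<open>Q\<close> is not torsion.  Hence \<open>Q\<close> is zero or a rational
  point \<open>(q, 0)\<close> of order 2.  In the second case the slope of the line through \<open>P\<close> and \<open>Q\<close> is
  anti-invariant under \<open>\<sigma>\<close>, hence of the form \<open>r\<surd>d\<close>, and comparing the discriminant of the
  quadratic equation for the abscissa of \<open>P\<close> with the discriminant of \<open>E\<close>, a 2-adic unit, gives a
  contradiction modulo 4.

  Associativity of the addition comes down to functions on the curve: a function whose zeros
  are \<open>S\<close> and \<open>T\<close> and which has at most a double pole at infinity exists only if \<open>T = -S\<close>.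
\<close>

section \<open>Functions on a cubic curve\<close>

text \<open>The 2-adic part lives on parity: an even squarefree \<open>d\<close> has valuation
  exactly 1, so \<open>t^2 * d\<close> has odd valuation for every rational
  \<open>t \<noteq> 0\<close>. Good reduction enters through three facts: \<open>b2\<close>,
  \<open>b4\<close>, \<open>b6\<close>, \<open>b8\<close> of some equation are integers, its
  discriminant is odd, and \<open>b2 = a1^2 + 4 a2\<close> is 0 or 1 modulo 4. Completing the square
  introduces denominators at 2, the very prime of interest; the last fact is the trace of
  \<open>a1\<close> that survives, and it decides the borderline cases. For an abscissa with a pole
  of odd order \<open>n\<close>, the duplication formula has a numerator of valuation
  \<open>- 4 n\<close> and a denominator of valuation \<open>2 - 3 n\<close>, the 2 stemming from
  the leading coefficient 4; this is the step from \<open>- n\<close> to \<open>- (n + 2)\<close>.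
  The discriminant, a resultant of numerator and denominator, forces the first pole. A rational
  point of order 2 has abscissa \<open>c / 4\<close> with an integer \<open>c\<close>. Even
  \<open>c\<close> turns out to mean an integral abscissa, and then parity alone suffices; odd
  \<open>c\<close> means a point reducing to infinity, and there the contradiction modulo 4
  arises.\<close>

fun ec_neg :: "'a::comm_ring_1 wcurve \<Rightarrow> 'a ecpoint \<Rightarrow> 'a ecpoint" where
  "ec_neg E Infinity = Infinity"
| "ec_neg E (Point x y) = Point x (- y - a1 E * x - a3 E)"

text \<open>\<open>separable\<close> excludes double roots of the cubic, that is, singular points
  \<open>(x, 0)\<close>. Points with \<open>y \<noteq> 0\<close> are nonsingular anyway, as 2 is
  invertible.\<close>

locale cubic_curve =
  fixes A B C :: "'a::field_char_0"
  assumes separable: "\<And>x. x ^ 3 + A * x ^ 2 + B * x + C = 0 \<Longrightarrow> 3 * x ^ 2 + 2 * A * x + B \<noteq> 0"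
begin

abbreviation E :: "'a wcurve" where "E \<equiv> WCurve 0 A 0 B C"

text \<open>The expansions of the coordinate functions in a local parameter at infinity; the pole order of
  a function is minus the subdegree of its expansion.\<close>

definition X :: "'a fls" where "X = fls_X_inv ^ 2"

definition Y :: "'a fls" where
  "Y = fls_X_inv ^ 3 * fps_to_fls (fps_radical (\<lambda>_ _. 1) 2
     (1 + fps_const A * fps_X ^ 2 + fps_const B * fps_X ^ 4 + fps_const C * fps_X ^ 6))"

lemma subdegree_X [simp]: "fls_subdegree X = -2"
  by (simp add: X_def)

lemma X_nz [simp]: "X \<noteq> 0"
  by (simp add: X_def)

text \<open>The radicand is the cubic in \<open>X\<close> divided by \<open>fls_X_inv ^ 6\<close>.
  Its constant coefficient is 1, so the constant function 1 is a legitimate choice of roots for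
  \<open>fps_radical\<close>.\<close>

lemma Y_sq: "Y ^ 2 = X ^ 3 + fls_const A * X ^ 2 + fls_const B * X + fls_const C"
proof -
  let ?w = "1 + fps_const A * fps_X ^ 2 + fps_const B * fps_X ^ 4 + fps_const C * fps_X ^ 6"
  have sq: "fps_radical (\<lambda>_ _. 1) 2 ?w ^ 2 = ?w"
    using power_radical[of ?w "\<lambda>_ _. 1" 1] by (simp add: numeral_2_eq_2)
  have inv: "fls_X_inv * (fls_X :: 'a fls) = 1"
    by (simp add: fls_X_inv_times_conv_shift)
  have p: "fls_X_inv ^ 6 * (fls_X :: 'a fls) ^ 6 = 1" "fls_X_inv ^ 6 * (fls_X :: 'a fls) ^ 4 = fls_X_inv ^ 2"
    "fls_X_inv ^ 6 * (fls_X :: 'a fls) ^ 2 = fls_X_inv ^ 4"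
  proof -
    have "fls_X_inv ^ 6 = fls_X_inv ^ 2 * fls_X_inv ^ 4" "fls_X_inv ^ 6 = fls_X_inv ^ 4 * fls_X_inv ^ 2"
      for fls_X_inv :: "'a fls" by (simp_all flip: power_add)
    moreover have "fls_X_inv ^ n * (fls_X :: 'a fls) ^ n = 1" for n
      unfolding power_mult_distrib[symmetric] inv by simp
    ultimately show "fls_X_inv ^ 6 * (fls_X :: 'a fls) ^ 6 = 1"
      "fls_X_inv ^ 6 * (fls_X :: 'a fls) ^ 4 = fls_X_inv ^ 2"
      "fls_X_inv ^ 6 * (fls_X :: 'a fls) ^ 2 = fls_X_inv ^ 4"
      by (metis mult.assoc mult_1_right)+
  qed
  have "Y ^ 2 = (fls_X_inv ^ 3) ^ 2 * fps_to_fls (fps_radical (\<lambda>_ _. 1) 2 ?w ^ 2)"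
    by (simp add: Y_def power_mult_distrib fps_to_fls_power)
  also have "\<dots> = fls_X_inv ^ 6 * (1 + fls_const A * fls_X ^ 2 + fls_const B * fls_X ^ 4 + fls_const C * fls_X ^ 6)"
    unfolding sq by (simp add: fls_times_fps_to_fls fps_to_fls_power)
  also have "\<dots> = fls_X_inv ^ 6 + fls_const A * (fls_X_inv ^ 6 * fls_X ^ 2)
      + fls_const B * (fls_X_inv ^ 6 * fls_X ^ 4) + fls_const C * (fls_X_inv ^ 6 * fls_X ^ 6)"
    by (simp only: distrib_left mult_1_right mult.left_commute)
  also have "\<dots> = X ^ 3 + fls_const A * X ^ 2 + fls_const B * X + fls_const C"
    unfolding X_def p by (simp add: power_mult[symmetric])
  finally show ?thesis .
qed

lemma Y_nz [simp]: "Y \<noteq> 0"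
proof -
  have "fps_radical (\<lambda>_ _. 1) 2 (1 + fps_const A * fps_X ^ 2 + fps_const B * fps_X ^ 4
    + fps_const C * fps_X ^ 6) $ 0 \<noteq> 0"
    by (simp add: fps_radical_nth_0)
  hence "fps_radical (\<lambda>_ _. 1) 2 (1 + fps_const A * fps_X ^ 2 + fps_const B * fps_X ^ 4
    + fps_const C * fps_X ^ 6) \<noteq> 0" by fastforce
  thus ?thesis unfolding Y_def by simp
qed

lemma subdegree_Y [simp]: "fls_subdegree Y = -3"
proof -
  have "fps_radical (\<lambda>_ _. 1) 2 (1 + fps_const A * fps_X ^ 2 + fps_const B * fps_X ^ 4
    + fps_const C * fps_X ^ 6) $ 0 \<noteq> 0"
    by (simp add: fps_radical_nth_0)
  hence "subdegree (fps_radical (\<lambda>_ _. 1) 2 (1 + fps_const A * fps_X ^ 2 + fps_const B * fps_X ^ 4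
    + fps_const C * fps_X ^ 6)) = 0" by (rule subdegree_eq_0)
  thus ?thesis using Y_nz unfolding Y_def by (simp add: fls_subdegree_fls_to_fps)
qed

section \<open>The affine coordinate ring and pole orders at infinity\<close>

definition emb :: "'a poly \<Rightarrow> 'a fls" where
  "emb p = poly (map_poly fls_const p) X"

lemma emb_0 [simp]: "emb 0 = 0"
  by (simp add: emb_def)

lemma emb_pCons [simp]: "emb (pCons c p) = fls_const c + X * emb p"
  by (cases "c = 0 \<and> p = 0") (auto simp: emb_def map_poly_pCons)

lemma emb_add: "emb (p + q) = emb p + emb q"
  by (induction p q rule: poly_induct2) (auto simp: fls_plus_const[symmetric] algebra_simps)

lemma emb_smult: "emb (Polynomial.smult c p) = fls_const c * emb p"
  by (induction p) (auto simp: algebra_simps simp flip: fls_const_mult_const)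

lemma emb_mult: "emb (p * q) = emb p * emb q"
  by (induction p) (auto simp: emb_add emb_smult algebra_simps)

lemma emb_diff: "emb (p - q) = emb p - emb q"
  using emb_add[of "p - q" q] by simp

lemma emb_subdegree: "p \<noteq> 0 \<Longrightarrow> emb p \<noteq> 0 \<and> fls_subdegree (emb p) = - 2 * int (degree p)"
proof (induction p)
  case (pCons c p)
  show ?case
  proof (cases "p = 0")
    case False
    hence IH: "X * emb p \<noteq> 0" "fls_subdegree (X * emb p) = -2 - 2 * int (degree p)"
      using pCons by auto
    hence "fls_subdegree (X * emb p + fls_const c) = -2 - 2 * int (degree p)"
      by (subst fls_subdegree_add_eq1) auto
    thus ?thesis using False by (auto simp: add.commute)
  qed (use pCons in auto)
qed auto

lemma emb_eq_0 [simp]: "emb p = 0 \<longleftrightarrow> p = 0"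
  using emb_subdegree[of p] by auto

definition R :: "'a fls set" where "R = {emb p + emb q * Y | p q. True}"

lemma R_add: "f \<in> R \<Longrightarrow> g \<in> R \<Longrightarrow> f + g \<in> R"
proof -
  have "emb p + emb q * Y + (emb r + emb s * Y) = emb (p + r) + emb (q + s) * Y" for p q r s
    by (simp add: emb_add algebra_simps)
  thus "f \<in> R \<Longrightarrow> g \<in> R \<Longrightarrow> f + g \<in> R" unfolding R_def by blast
qed

lemma emb_cubic: "emb [:C, B, A, 1:] = Y ^ 2"
  unfolding Y_sq by (simp add: algebra_simps power2_eq_square power3_eq_cube)

lemma R_mult: "f \<in> R \<Longrightarrow> g \<in> R \<Longrightarrow> f * g \<in> R"
proof -
  have "(emb p + emb q * Y) * (emb r + emb s * Y) =
      emb (p * r + q * s * [:C, B, A, 1:]) + emb (p * s + q * r) * Y" for p q r s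
    unfolding emb_add emb_mult emb_cubic by (simp add: algebra_simps power2_eq_square)
  thus "f \<in> R \<Longrightarrow> g \<in> R \<Longrightarrow> f * g \<in> R" unfolding R_def by blast
qed

lemma emb_R [simp]: "emb p \<in> R"
proof -
  have "emb p = emb p + emb 0 * Y" by simp
  thus ?thesis unfolding R_def by blast
qed

lemma R_const [simp]: "fls_const c \<in> R"
  using emb_R[of "[:c:]"] by simp

lemma R_X [simp]: "X \<in> R"
  using emb_R[of "[:0, 1:]"] by simp

lemma R_Y [simp]: "Y \<in> R"
proof -
  have "Y = emb 0 + emb 1 * Y" by (simp add: one_pCons)
  thus ?thesis unfolding R_def by blast
qed

lemma R_minus: "f \<in> R \<Longrightarrow> - f \<in> R"
  using R_mult[of "fls_const (-1)" f] R_const[of "-1"] by simp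

lemma R_diff: "f \<in> R \<Longrightarrow> g \<in> R \<Longrightarrow> f - g \<in> R"
  using R_add[of f "-g"] R_minus by simp

text \<open>The pole order of \<open>emb p\<close> is even and that of \<open>emb q * Y\<close> is
  odd, so leading terms never cancel.\<close>

lemma R_repr:
  assumes "p \<noteq> 0 \<or> q \<noteq> 0"
  shows "emb p + emb q * Y \<noteq> 0 \<and> fls_subdegree (emb p + emb q * Y) =
    (if q = 0 then - 2 * int (degree p) else if p = 0 then - 2 * int (degree q) - 3
     else min (- 2 * int (degree p)) (- 2 * int (degree q) - 3))"
proof -
  consider "q = 0" | "p = 0" "q \<noteq> 0" | "p \<noteq> 0" "q \<noteq> 0" by blast
  thus ?thesis
  proof cases
    case 3
    have sp: "emb p \<noteq> 0" "fls_subdegree (emb p) = - 2 * int (degree p)"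
      using emb_subdegree[OF 3(1)] by auto
    have sq: "emb q * Y \<noteq> 0" "fls_subdegree (emb q * Y) = - 2 * int (degree q) - 3"
      using emb_subdegree[OF 3(2)] by auto
    have "- 2 * int (degree p) \<noteq> - 2 * int (degree q) - 3" by presburger
    hence "fls_subdegree (emb p + emb q * Y) = min (- 2 * int (degree p)) (- 2 * int (degree q) - 3)"
      using fls_subdegree_add_eq1[of "emb p" "emb q * Y"] fls_subdegree_add_eq2[of "emb q * Y" "emb p"]
        sp sq by linarith
    moreover have "min (- 2 * int (degree p)) (- 2 * int (degree q) - 3) < 0" by linarith
    ultimately show ?thesis using 3 by auto
  qed (use assms emb_subdegree[of p] emb_subdegree[of q] in auto)
qed

lemma R_unique:
  assumes "emb p + emb q * Y = emb r + emb s * Y"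
  shows "p = r \<and> q = s"
proof -
  have "emb (p - r) + emb (q - s) * Y = 0"
    using assms by (simp add: emb_diff algebra_simps)
  thus ?thesis using R_repr[of "p - r" "q - s"] by auto
qed

text \<open>A term with \<open>Y\<close> has a pole of order at least 3. In particular no function
  has a simple pole, which is how genus one enters \<open>principal_pair\<close>.\<close>

lemma R_low_degree:
  assumes "f \<in> R" "f \<noteq> 0" "fls_subdegree f \<ge> -2"
  obtains c0 c1 where "f = emb [:c0, c1:]"
proof -
  obtain p q where f: "f = emb p + emb q * Y" using assms(1) unfolding R_def by blast
  have pq: "p \<noteq> 0 \<or> q \<noteq> 0" using assms(2) f by auto
  have q: "q = 0" using R_repr[OF pq] assms(3) unfolding f[symmetric] by (auto split: if_splits)
  hence "degree p \<le> 1" using R_repr[OF pq] assms(3) unfolding f[symmetric] by auto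
  hence "p = [:Polynomial.coeff p 0, Polynomial.coeff p 1:]"
    by (intro poly_eqI) (auto simp: coeff_pCons coeff_eq_0 split: nat.splits)
  thus ?thesis using that[of "Polynomial.coeff p 0" "Polynomial.coeff p 1"] f q by simp
qed

text \<open>\<open>pt_ideal P J\<close> is the product of \<open>J\<close> with the maximal ideal of \<open>P\<close>, given by its two generators.
  Ideal products keep track of zeros with multiplicity, so coinciding points need no separate
  treatment.\<close>

fun pt_ideal :: "'a ecpoint \<Rightarrow> 'a fls set \<Rightarrow> 'a fls set" where
  "pt_ideal Infinity J = J"
| "pt_ideal (Point x y) J =
    {(X - fls_const x) * g + (Y - fls_const y) * h | g h. g \<in> J \<and> h \<in> J}"

text \<open>Expanding over products of generators, the two orders differ only by exchanging the
  mixed cofactors. Commutativity makes the fold over a multiset meaningful.\<close>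

lemma pt_ideal_commute: "pt_ideal P (pt_ideal Q J) = pt_ideal Q (pt_ideal P J)"
proof -
  have "f \<in> pt_ideal Q (pt_ideal P J)" if f: "f \<in> pt_ideal P (pt_ideal Q J)" for P Q f
  proof (cases P; cases Q)
    fix x y x' y' assume PQ: "P = Point x y" "Q = Point x' y'"
    from f[unfolded PQ pt_ideal.simps, simplified] obtain g1 h1 g2 h2 where
      J: "g1 \<in> J" "h1 \<in> J" "g2 \<in> J" "h2 \<in> J" and
      f: "f = (X - fls_const x) * ((X - fls_const x') * g1 + (Y - fls_const y') * h1)
        + (Y - fls_const y) * ((X - fls_const x') * g2 + (Y - fls_const y') * h2)"
      by blast
    have "f = (X - fls_const x') * ((X - fls_const x) * g1 + (Y - fls_const y) * g2)
        + (Y - fls_const y') * ((X - fls_const x) * h1 + (Y - fls_const y) * h2)"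
      unfolding f by (simp add: algebra_simps)
    thus ?thesis unfolding PQ pt_ideal.simps using J by blast
  qed (use f in auto)
  thus ?thesis by blast
qed

interpretation comp_fun_commute pt_ideal
  by unfold_locales (auto simp: pt_ideal_commute fun_eq_iff)

definition ideal_prod :: "'a ecpoint multiset \<Rightarrow> 'a fls set" where
  "ideal_prod M = fold_mset pt_ideal R M"

lemma ideal_prod_empty [simp]: "ideal_prod {#} = R"
  by (simp add: ideal_prod_def)

lemma ideal_prod_add_mset [simp]: "ideal_prod (add_mset P M) = pt_ideal P (ideal_prod M)"
  by (simp add: ideal_prod_def)

lemma ideal_prod_closed:
  "f \<in> ideal_prod M \<Longrightarrow> g \<in> ideal_prod M \<Longrightarrow> f + g \<in> ideal_prod M"
  "r \<in> R \<Longrightarrow> f \<in> ideal_prod M \<Longrightarrow> r * f \<in> ideal_prod M"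
proof (induction M arbitrary: f g)
  case (add P M)
  {
    case 1
    show ?case
    proof (cases P)
      case (Point x y)
      from 1 obtain g1 h1 g2 h2 where
        J: "g1 \<in> ideal_prod M" "h1 \<in> ideal_prod M" "g2 \<in> ideal_prod M" "h2 \<in> ideal_prod M" and
        f: "f = (X - fls_const x) * g1 + (Y - fls_const y) * h1"
           "g = (X - fls_const x) * g2 + (Y - fls_const y) * h2"
        unfolding Point by auto
      have "f + g = (X - fls_const x) * (g1 + g2) + (Y - fls_const y) * (h1 + h2)"
        unfolding f by (simp add: algebra_simps)
      thus ?thesis using add J unfolding Point by auto
    qed (use 1 add in auto)
  next
    case 2
    show ?case
    proof (cases P)
      case (Point x y)
      from 2 obtain g1 h1 where
        J: "g1 \<in> ideal_prod M" "h1 \<in> ideal_prod M" and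
        f: "f = (X - fls_const x) * g1 + (Y - fls_const y) * h1"
        unfolding Point by auto
      have "r * f = (X - fls_const x) * (r * g1) + (Y - fls_const y) * (r * h1)"
        unfolding f by (simp add: algebra_simps)
      moreover have "r * g1 \<in> ideal_prod M" "r * h1 \<in> ideal_prod M"
        using add.IH(2)[OF 2(1)] J by auto
      ultimately show ?thesis unfolding Point by auto
    qed (use 2 add in auto)
  }
qed (auto intro: R_add R_mult)

lemma pt_ideal_subset: "pt_ideal P (ideal_prod M) \<subseteq> ideal_prod M"
  by (cases P) (auto intro!: ideal_prod_closed R_diff)

lemma ideal_prod_subset: "ideal_prod M \<subseteq> R"
  by (induction M) (use pt_ideal_subset in auto)

lemma ideal_prod_mult:
  "f \<in> ideal_prod M \<Longrightarrow> g \<in> ideal_prod N \<Longrightarrow> f * g \<in> ideal_prod (M + N)"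
proof (induction M arbitrary: f)
  case empty
  thus ?case by (auto intro: ideal_prod_closed)
next
  case (add P M)
  show ?case
  proof (cases P)
    case (Point x y)
    from add.prems obtain g1 h1 where
      J: "g1 \<in> ideal_prod M" "h1 \<in> ideal_prod M" and
      f: "f = (X - fls_const x) * g1 + (Y - fls_const y) * h1"
      unfolding Point by auto
    have "f * g = (X - fls_const x) * (g1 * g) + (Y - fls_const y) * (h1 * g)"
      unfolding f by (simp add: algebra_simps)
    thus ?thesis using add J unfolding Point by auto
  qed (use add in auto)
qed

section \<open>Divisors of functions\<close>

fun pt_deg :: "'a ecpoint \<Rightarrow> nat" where
  "pt_deg Infinity = 0"
| "pt_deg (Point x y) = 1"

text \<open>A function that is regular on the affine curve has as many zeros as the order of its
  pole at infinity. Equality of that order with the number of finite points in \<open>M\<close> thus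
  says that \<open>M\<close> is the whole zero divisor. \<open>Infinity\<close> has weight 0 and may
  be inserted freely.\<close>

definition principal :: "'a ecpoint multiset \<Rightarrow> bool" where
  "principal M \<longleftrightarrow> (\<exists>f \<in> ideal_prod M. f \<noteq> 0 \<and>
     fls_subdegree f = - int (\<Sum>P \<in># M. pt_deg P))"

lemma principal_add: "principal M \<Longrightarrow> principal N \<Longrightarrow> principal (M + N)"
  unfolding principal_def
proof (elim bexE conjE)
  fix f g assume "f \<in> ideal_prod M" "g \<in> ideal_prod N" "f \<noteq> 0" "g \<noteq> 0"
    "fls_subdegree f = - int (\<Sum>P \<in># M. pt_deg P)" "fls_subdegree g = - int (\<Sum>P \<in># N. pt_deg P)"
  thus "\<exists>f \<in> ideal_prod (M + N). f \<noteq> 0 \<and>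
     fls_subdegree f = - int (\<Sum>P \<in># M + N. pt_deg P)"
    by (intro bexI[of _ "f * g"]) (auto intro: ideal_prod_mult)
qed

lemma cubic_diff:
  assumes "on_curve E (Point x y)"
  shows "Y ^ 2 - fls_const y ^ 2 = (X - fls_const x) *
    (X ^ 2 + fls_const (x + A) * X + fls_const (x ^ 2 + A * x + B))"
proof -
  have "fls_const y ^ 2 = fls_const x ^ 3 + fls_const A * fls_const x ^ 2 +
      fls_const B * fls_const x + fls_const C"
    using arg_cong[OF assms[unfolded on_curve.simps], of fls_const]
    by (simp add: fls_const_power fls_plus_const[symmetric] flip: fls_const_mult_const)
  thus ?thesis
    unfolding Y_sq fls_plus_const[symmetric] fls_const_mult_const[symmetric] fls_const_power
    by (simp add: algebra_simps power2_eq_square power3_eq_cube)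
qed

lemma R_power: "f \<in> R \<Longrightarrow> f ^ n \<in> R"
  using R_const[of 1] by (induction n) (auto intro: R_mult)

text \<open>Every product of a generator for \<open>P\<close> with one for its negative is divisible
  by \<open>X - x\<close>; for the product of the two generators in \<open>Y\<close> this is
  \<open>cubic_diff\<close>. Dividing by \<open>X - x\<close> removes a double pole, exactly the
  weight of the pair.\<close>

lemma principal_cancel:
  assumes P: "on_curve E P" and M: "principal (add_mset P (add_mset (ec_neg E P) M))"
  shows "principal M"
proof (cases P)
  case (Point x y)
  let ?x = "fls_const x" and ?y = "fls_const y"
  let ?H = "X ^ 2 + fls_const (x + A) * X + fls_const (x ^ 2 + A * x + B)"
  obtain f where f: "f \<in> ideal_prod (add_mset P (add_mset (ec_neg E P) M))" "f \<noteq> 0"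
    "fls_subdegree f = - int (\<Sum>P \<in># M. pt_deg P) - 2"
    using M Point unfolding principal_def by force
  from f(1) obtain g1 h1 g2 h2 where
    J: "g1 \<in> ideal_prod M" "h1 \<in> ideal_prod M" "g2 \<in> ideal_prod M" "h2 \<in> ideal_prod M" and
    f': "f = (X - ?x) * ((X - ?x) * g1 + (Y - fls_const (- y)) * h1) +
      (Y - ?y) * ((X - ?x) * g2 + (Y - fls_const (- y)) * h2)"
    unfolding Point by auto
  define g where "g = (X - ?x) * g1 + (Y + ?y) * h1 + (Y - ?y) * g2 + ?H * h2"
  have fg: "f = (X - ?x) * g"
  proof -
    have "f = (X - ?x) * ((X - ?x) * g1 + (Y + ?y) * h1 + (Y - ?y) * g2) + (Y ^ 2 - ?y ^ 2) * h2"
      unfolding f' by (simp add: algebra_simps power2_eq_square)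
    thus ?thesis
      unfolding g_def cubic_diff[OF P[unfolded Point]] by (simp add: algebra_simps)
  qed
  have "g \<in> ideal_prod M" unfolding g_def
    by (intro ideal_prod_closed J R_add R_diff R_mult R_power R_X R_Y R_const)
  moreover have "fls_subdegree (X - ?x) = -2"
    by (subst fls_subdegree_diff_eq1) auto
  ultimately show ?thesis using f fg unfolding principal_def by (intro bexI[of _ g]) auto
qed (use M in \<open>simp add: principal_def\<close>)

lemma fls_const_diff: "fls_const (a - b) = fls_const a - fls_const b"
  by (intro fls_eqI) simp

lemma emb_linear: "emb [:- x, 1:] = X - fls_const x"
  by simp

lemma pt_ideal_repr:
  assumes "emb p + emb q * Y = (X - fls_const x) * (emb g1 + emb g2 * Y)
    + (Y - fls_const y) * (emb h1 + emb h2 * Y)"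
  shows "p = [:- x, 1:] * g1 + [:C, B, A, 1:] * h2 - Polynomial.smult y h1"
    and "q = [:- x, 1:] * g2 + h1 - Polynomial.smult y h2"
proof -
  have "emb p + emb q * Y = emb ([:- x, 1:] * g1 + [:C, B, A, 1:] * h2 - Polynomial.smult y h1)
    + emb ([:- x, 1:] * g2 + h1 - Polynomial.smult y h2) * Y"
    unfolding assms emb_add emb_diff emb_mult emb_cubic emb_linear emb_smult
    by (simp add: algebra_simps power2_eq_square)
  from R_unique[OF this] show
    "p = [:- x, 1:] * g1 + [:C, B, A, 1:] * h2 - Polynomial.smult y h1"
    "q = [:- x, 1:] * g2 + h1 - Polynomial.smult y h2"
    by auto
qed

lemma pt_ideal_vanish:
  assumes "on_curve E (Point x y)" "emb p + emb q * Y \<in> pt_ideal (Point x y) R"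
  shows "poly p x + y * poly q x = 0"
proof -
  obtain g1 g2 h1 h2 where "emb p + emb q * Y = (X - fls_const x) * (emb g1 + emb g2 * Y)
    + (Y - fls_const y) * (emb h1 + emb h2 * Y)"
    using assms(2) unfolding R_def by auto
  note r = pt_ideal_repr[OF this]
  have "poly p x + y * poly q x = (x ^ 3 + A * x ^ 2 + B * x + C - y ^ 2) * poly h2 x"
    unfolding r by (simp add: algebra_simps power2_eq_square power3_eq_cube)
  thus ?thesis using assms(1) by simp
qed

text \<open>Along the curve \<open>dy/dx = (3 x^2 + 2 A x + B) / (2 y)\<close>, so the expression is
  \<open>2 y\<close> times the tangential derivative of \<open>p + q y\<close>, which vanishes on
  the square of the maximal ideal.\<close>

lemma pt_ideal_sq_derivative:
  assumes "on_curve E (Point x y)"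
    and "emb p + emb q * Y \<in> pt_ideal (Point x y) (pt_ideal (Point x y) R)"
  shows "2 * y * (poly (pderiv p) x + y * poly (pderiv q) x)
    + (3 * x ^ 2 + 2 * A * x + B) * poly q x = 0"
proof -
  obtain g h where gh: "g \<in> pt_ideal (Point x y) R" "h \<in> pt_ideal (Point x y) R"
    and f: "emb p + emb q * Y = (X - fls_const x) * g + (Y - fls_const y) * h"
    using assms(2) pt_ideal.simps(2) by blast
  have "pt_ideal (Point x y) R \<subseteq> R"
    using pt_ideal_subset[of "Point x y" "{#}"] by simp
  with gh obtain g1 g2 h1 h2 where gh': "g = emb g1 + emb g2 * Y" "h = emb h1 + emb h2 * Y"
    unfolding R_def by blast
  note r = pt_ideal_repr[OF f[unfolded gh']]
  have v: "poly g1 x = - y * poly g2 x" "poly h1 x = - y * poly h2 x"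
    using pt_ideal_vanish[OF assms(1)] gh unfolding gh' by (simp_all add: eq_neg_iff_add_eq_0)
  have c: "C = y ^ 2 - x ^ 3 - A * x ^ 2 - B * x"
    using assms(1) by simp
  show ?thesis
    unfolding r by (simp add: pderiv_mult pderiv_add pderiv_diff pderiv_smult pderiv_pCons v c)
      (simp add: algebra_simps power2_eq_square power3_eq_cube)
qed

text \<open>With a pole of order at most 2 the function is linear in \<open>X\<close>, so its zeros
  share one abscissa. Parity of the pole order excludes a single point at infinity, and the
  derivative criterion excludes a double zero at a point with \<open>y \<noteq> 0\<close>.\<close>

lemma principal_pair:
  assumes P: "on_curve E P" and Q: "on_curve E Q" and PQ: "principal {#P, Q#}"
  shows "Q = ec_neg E P"
proof -
  obtain f where f: "f \<in> ideal_prod {#P, Q#}" "f \<noteq> 0"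
    "fls_subdegree f = - int (pt_deg P + pt_deg Q)"
    using PQ unfolding principal_def by (auto simp: add.commute)
  have "pt_deg P \<le> 1" "pt_deg Q \<le> 1"
    by (cases P; simp) (cases Q; simp)
  moreover have "f \<in> R" using f(1) ideal_prod_subset by blast
  ultimately obtain c0 c1 where fc: "f = emb [:c0, c1:]"
    using R_low_degree f by (metis (no_types, opaque_lifting) le_imp_neg_le
      add_mono_thms_linordered_semiring(1) of_nat_le_iff of_nat_numeral one_add_one)
  have c: "[:c0, c1:] \<noteq> 0" using f(2) fc by (metis emb_0)
  have s: "fls_subdegree f = - 2 * int (degree [:c0, c1:])"
    unfolding fc using emb_subdegree[OF c] by blast
  have par: "even (pt_deg P + pt_deg Q)" using s f(3) by presburger
  show ?thesis
  proof (cases P; cases Q)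
    fix x y x' y' assume pts: "P = Point x y" "Q = Point x' y'"
    have c1: "c1 \<noteq> 0" using s f(3) pts by auto
    have "f \<in> pt_ideal P R" "f \<in> pt_ideal Q R"
      using f(1) pt_ideal_subset[of P "{#Q#}"] pt_ideal_subset[of Q "{#P#}"]
        pt_ideal_commute[of P Q R] pt_ideal_subset[of Q "{#}"] pt_ideal_subset[of P "{#}"]
        by (auto simp del: pt_ideal.simps)
    hence "c0 + x * c1 = 0" "c0 + x' * c1 = 0"
      using pt_ideal_vanish[of x y "[:c0, c1:]" 0] pt_ideal_vanish[of x' y' "[:c0, c1:]" 0] P Q
      unfolding pts fc by (simp_all del: pt_ideal.simps on_curve.simps)
    moreover have "c1 * (x - x') = (c0 + x * c1) - (c0 + x' * c1)" by (simp add: algebra_simps)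
    ultimately have "c1 * (x - x') = 0" by simp
    hence x: "x' = x" using c1 by simp
    hence "y' ^ 2 = y ^ 2" using P Q pts by simp
    hence y: "y' = y \<or> y' = - y" by (simp add: power2_eq_iff)
    have "y' = - y"
    proof (rule ccontr)
      assume "y' \<noteq> - y"
      with y have "y' = y" "y \<noteq> 0" by auto
      with pts x have "f \<in> pt_ideal (Point x y) (pt_ideal (Point x y) R)"
        using f(1) by (simp del: pt_ideal.simps)
      hence "2 * y * c1 = 0"
        using pt_ideal_sq_derivative[of x y "[:c0, c1:]" 0] P unfolding pts fc
        by (auto simp del: pt_ideal.simps on_curve.simps simp add: pderiv_pCons)
      thus False using c1 \<open>y \<noteq> 0\<close> by simp
    qed
    thus ?thesis using pts x by simp
  qed (use par in simp_all)
qed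

lemma ideal_prod_0 [simp]: "0 \<in> ideal_prod M"
proof (induction M)
  case empty
  show ?case using R_const[of 0] by simp
next
  case (add P M)
  thus ?case by (cases P) (auto intro!: exI[of _ 0])
qed

lemma ideal_prod_gen:
  assumes "g \<in> ideal_prod M"
  shows "(X - fls_const x) * g \<in> ideal_prod (add_mset (Point x y) M)"
    and "(Y - fls_const y) * g \<in> ideal_prod (add_mset (Point x y) M)"
proof -
  have "(X - fls_const x) * g = (X - fls_const x) * g + (Y - fls_const y) * 0"
    "(Y - fls_const y) * g = (X - fls_const x) * 0 + (Y - fls_const y) * g" by simp_all
  with assms show "(X - fls_const x) * g \<in> ideal_prod (add_mset (Point x y) M)"
    "(Y - fls_const y) * g \<in> ideal_prod (add_mset (Point x y) M)"
    by (simp_all only: ideal_prod_add_mset pt_ideal.simps) (use ideal_prod_0 in blast)+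
qed

lemma ideal_prod_const_cancel:
  assumes "c \<noteq> 0" "fls_const c * f \<in> ideal_prod M"
  shows "f \<in> ideal_prod M"
proof -
  have "fls_const (1 / c) * (fls_const c * f) \<in> ideal_prod M"
    using assms(2) by (rule ideal_prod_closed(2)[OF R_const])
  moreover have "fls_const (1 / c) * (fls_const c * f) = fls_const (1 / c * c) * f"
    by (simp only: fls_const_mult_const[symmetric] mult.assoc)
  moreover have "fls_const (1 / c * c) * f = f" using assms(1) by simp
  ultimately show ?thesis by metis
qed

lemma ideal_prod_diff: "f \<in> ideal_prod M \<Longrightarrow> g \<in> ideal_prod M \<Longrightarrow> f - g \<in> ideal_prod M"
  using ideal_prod_closed(1)[of f M "- g"] ideal_prod_closed(2)[of "- 1" g M] R_const[of "-1"]
  by simp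

lemma one_R: "1 \<in> R"
  using R_const[of 1] by simp

text \<open>The function is the vertical line \<open>X - x\<close>; the work is to extract it from
  the product of the two ideals, whose generators are quadratic.\<close>

lemma principal_vertical:
  assumes "on_curve E P"
  shows "principal {#P, ec_neg E P#}"
proof (cases P)
  case Infinity
  thus ?thesis unfolding principal_def by (auto intro!: bexI[of _ 1] one_R)
next
  case (Point x y)
  let ?x = "fls_const x" and ?y = "fls_const y"
  let ?M = "{#Point x y, Point x (- y)#}"
  let ?H = "X ^ 2 + fls_const (x + A) * X + fls_const (x ^ 2 + A * x + B)"
  have M: "(X - ?x) * ((X - ?x) * 1) \<in> ideal_prod ?M"
    "(X - ?x) * ((Y - fls_const (- y)) * 1) \<in> ideal_prod ?M"
    "(Y - ?y) * ((X - ?x) * 1) \<in> ideal_prod ?M" "(Y - ?y) * ((Y - fls_const (- y)) * 1) \<in> ideal_prod ?M"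
    by (intro ideal_prod_gen; simp add: one_R del: pt_ideal.simps ideal_prod_add_mset)+
  have "X - ?x \<in> ideal_prod ?M"
  proof (cases "y = 0")
    case False
    have "fls_const (2 * y) * (X - ?x) =
      (X - ?x) * ((Y - fls_const (- y)) * 1) - (Y - ?y) * ((X - ?x) * 1)"
      by (simp add: algebra_simps flip: fls_const_mult_const)
    thus ?thesis using ideal_prod_diff[OF M(2,3)] False
      by (metis ideal_prod_const_cancel mult_eq_0_iff zero_neq_numeral)
  next
    case True
    \<comment> \<open>\<open>?k\<close> is the value of \<open>?H\<close> at \<open>X = x\<close>
      and the derivative of the cubic there. Hence \<open>(X - ?x) * ?H\<close> is \<open>?k\<close>
      times \<open>X - ?x\<close> up to a multiple of the square of \<open>X - ?x\<close>.\<close>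
    let ?k = "3 * x ^ 2 + 2 * A * x + B"
    have k: "?k \<noteq> 0" using separable[of x] assms Point True by simp
    have "fls_const ?k * (X - ?x) =
      (X - ?x) * ?H - (X + fls_const (2 * x + A)) * ((X - ?x) * ((X - ?x) * 1))"
      unfolding fls_plus_const[symmetric] fls_const_mult_const[symmetric] fls_const_power
      by (simp add: algebra_simps power2_eq_square del: fls_const_mult_const)
    also have "(X - ?x) * ?H = (Y - ?y) * ((Y - fls_const (- y)) * 1)"
      using cubic_diff[of x y] assms Point True by (simp add: power2_eq_square)
    also have "\<dots> - (X + fls_const (2 * x + A)) * ((X - ?x) * ((X - ?x) * 1)) \<in> ideal_prod ?M"
      by (intro ideal_prod_diff M ideal_prod_closed(2) R_add R_X R_const)
    finally show ?thesis using ideal_prod_const_cancel k by blast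
  qed
  moreover have "fls_subdegree (X - ?x) = -2"
    by (subst fls_subdegree_diff_eq1) auto
  ultimately show ?thesis unfolding principal_def Point
    by (intro bexI[of _ "X - ?x"]) (auto simp del: pt_ideal.simps ideal_prod_add_mset)
qed

text \<open>The equations for \<open>A\<close>, \<open>B\<close>, \<open>C\<close> are Vieta's
  formulas for the intersection with \<open>y = m x + n\<close>, so they count multiplicities. The
  product of three ideals visibly contains only cubic expressions in \<open>f = Y - m X - n\<close>
  and the \<open>L x\<close>; the proof lowers their degree until \<open>f\<close> itself remains.
  The pattern \<open>x1 = x2 \<noteq> x3\<close> is left to a reordering of the points.\<close>

lemma principal_line:
  fixes m n x1 x2 x3 :: 'a
  assumes e1: "A = m ^ 2 - (x1 + x2 + x3)" and e2: "B = 2 * m * n + x1 * x2 + x1 * x3 + x2 * x3"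
    and e3: "C = n ^ 2 - x1 * x2 * x3" and distinct: "x1 \<noteq> x2 \<or> x1 = x2 \<and> x2 = x3"
  shows "principal {#Point x1 (m * x1 + n), Point x2 (m * x2 + n), Point x3 (m * x3 + n)#}"
proof -
  define L where "L x = X - fls_const x" for x
  define h where "h = fls_const m * X + fls_const n"
  define f where "f = Y - h"
  let ?P = "\<lambda>x. Point x (m * x + n)"
  let ?M = "{#?P x1, ?P x2, ?P x3#}"
  have fx: "f = (Y - fls_const (m * x + n)) - fls_const m * (X - fls_const x)" for x
    unfolding f_def h_def fls_plus_const[symmetric] fls_const_mult_const[symmetric]
    by (simp add: algebra_simps del: fls_const_mult_const)
  have genL: "L x * g \<in> ideal_prod (add_mset (?P x) N)" if "g \<in> ideal_prod N" for x g N
    unfolding L_def using that by (rule ideal_prod_gen)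
  have genf: "f * g \<in> ideal_prod (add_mset (?P x) N)" if "g \<in> ideal_prod N" for x g N
  proof -
    have "f * g = (Y - fls_const (m * x + n)) * g - fls_const m * ((X - fls_const x) * g)"
      unfolding fx[of x] by (simp only: left_diff_distrib mult.assoc)
    thus ?thesis
      by (simp only:) (intro ideal_prod_diff ideal_prod_closed(2) ideal_prod_gen that R_const)
  qed
  have gen3: "a * (b * (c * 1)) \<in> ideal_prod {#?P x, ?P y, ?P z#}"
    if "a = f \<or> a = L x" "b = f \<or> b = L y" "c = f \<or> c = L z" for a b c x y z
    using that genL genf one_R by (metis ideal_prod_empty)
  have perm: "{#?P x3, ?P x1, ?P x2#} = ?M" "{#?P x3, ?P x2, ?P x1#} = ?M" "{#?P x2, ?P x1, ?P x3#} = ?M"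
    by (simp_all add: add_mset_commute)
  define I where "I = ideal_prod ?M"
  have add: "a + b \<in> I" and diff: "a - b \<in> I" if "a \<in> I" "b \<in> I" for a b
    using that unfolding I_def by (fact ideal_prod_closed(1) ideal_prod_diff)+
  have mul: "r * a \<in> I" if "r \<in> R" "a \<in> I" for r a
    using that unfolding I_def by (fact ideal_prod_closed(2))
  have canc: "a \<in> I" if "c \<noteq> 0" "fls_const c * a \<in> I" for a c
    using that unfolding I_def by (rule ideal_prod_const_cancel)
  have R: "L x \<in> R" "h \<in> R" "f \<in> R" "fls_const c \<in> R" for x c
    unfolding L_def h_def f_def by (intro R_diff R_add R_mult R_X R_Y R_const)+
  have mem: "L x1 * L x2 * f \<in> I" "L x3 * L x1 * f \<in> I" "L x3 * L x2 * f \<in> I"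
    "L x1 * f * f \<in> I" "L x2 * f * f \<in> I" "f * f * f \<in> I" "L x1 * L x2 * L x3 \<in> I"
    using gen3[of "L x1" x1 "L x2" x2 f x3] gen3[of "L x3" x3 "L x1" x1 f x2]
      gen3[of "L x3" x3 "L x2" x2 f x1] gen3[of "L x1" x1 f x2 f x3] gen3[of "L x2" x2 f x1 f x3]
      gen3[of f x1 f x2 f x3] gen3[of "L x1" x1 "L x2" x2 "L x3" x3]
    unfolding I_def perm by (simp_all add: mult.assoc del: ideal_prod_add_mset pt_ideal.simps)
  \<comment> \<open>The norm of \<open>f\<close> down to polynomials in \<open>X\<close>: its
    conjugate \<open>- Y - h\<close> is \<open>- (f + 2 * h)\<close>.\<close>
  have norm: "f * (f + 2 * h) = L x1 * L x2 * L x3"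
  proof -
    have "f * (f + 2 * h) = Y ^ 2 - h ^ 2" by (simp add: f_def algebra_simps power2_eq_square)
    also have "\<dots> = X ^ 3 + fls_const (m ^ 2 - (x1 + x2 + x3)) * X ^ 2
        + fls_const (2 * m * n + x1 * x2 + x1 * x3 + x2 * x3) * X
        + fls_const (n ^ 2 - x1 * x2 * x3) - h ^ 2"
      unfolding Y_sq e1[symmetric] e2[symmetric] e3[symmetric] ..
    also have "\<dots> = L x1 * L x2 * L x3"
      unfolding h_def L_def
      by (simp add: algebra_simps power2_eq_square power3_eq_cube fls_plus_const[symmetric]
          fls_const_diff fls_const_mult_const[symmetric] del: fls_const_mult_const)
    finally show ?thesis .
  qed
  \<comment> \<open>The norm relation trades a factor \<open>f\<close> for a factor
    \<open>h\<close>.\<close>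
  have hL: "h * (L x * f) \<in> I" if "L x * f * f \<in> I" for x
  proof -
    have "fls_const 2 * (h * (L x * f)) = L x * (f * (f + 2 * h)) - L x * f * f"
      by (simp add: algebra_simps)
    also have "\<dots> \<in> I" unfolding norm by (rule diff[OF mul[OF R(1) mem(7)] that])
    finally show ?thesis by (rule canc[rotated]) simp
  qed
  \<comment> \<open>A point of order 2 counted twice on a non-vertical line would be singular: there
    both the cubic and its derivative vanish.\<close>
  have sep: "\<not> (m * x3 + n = 0 \<and> (x3 = x1 \<or> x3 = x2))"
  proof
    assume a: "m * x3 + n = 0 \<and> (x3 = x1 \<or> x3 = x2)"
    have "x3 ^ 3 + A * x3 ^ 2 + B * x3 + C = (m * x3 + n) ^ 2"
      unfolding e1 e2 e3 by (simp add: algebra_simps power2_eq_square power3_eq_cube)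
    moreover have "3 * x3 ^ 2 + 2 * A * x3 + B = 2 * m * (m * x3 + n) + (x3 - x1) * (x3 - x2)"
      unfolding e1 e2 by (simp add: algebra_simps power2_eq_square)
    ultimately show False using a separable[of x3] by auto
  qed
  have "f \<in> I"
  proof (cases "x1 = x2")
    case False
    \<comment> \<open>\<open>L x1 - L x2\<close> is the nonzero constant \<open>x2 - x1\<close>, so
      differences lower the degree by one.\<close>
    have "fls_const (x2 - x1) * (L x3 * f) = L x3 * L x1 * f - L x3 * L x2 * f"
      by (simp add: L_def algebra_simps fls_const_diff)
    hence "fls_const (x2 - x1) * (L x3 * f) \<in> I" using diff[OF mem(2,3)] by (simp only:)
    hence l3: "L x3 * f \<in> I" by (rule canc[rotated]) (use False in simp)
    have "fls_const (x2 - x1) * (h * f) = h * (L x1 * f) - h * (L x2 * f)"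
      by (simp add: L_def algebra_simps fls_const_diff)
    hence "fls_const (x2 - x1) * (h * f) \<in> I"
      using diff[OF hL[OF mem(4)] hL[OF mem(5)]] by (simp only:)
    hence hf: "h * f \<in> I" by (rule canc[rotated]) (use False in simp)
    have "fls_const (m * x3 + n) * f = h * f - fls_const m * (L x3 * f)"
      by (simp add: h_def L_def algebra_simps flip: fls_plus_const)
    hence y3: "fls_const (m * x3 + n) * f \<in> I" using diff[OF hf mul[OF R(4) l3]] by (simp only:)
    show ?thesis
    proof (cases "m * x3 + n = 0")
      case True
      hence "(x3 - x1) * (x3 - x2) \<noteq> 0" using sep by auto
      moreover have "fls_const ((x3 - x1) * (x3 - x2)) * f =
        L x1 * L x2 * f - (X + fls_const x3 - fls_const x1 - fls_const x2) * (L x3 * f)"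
        unfolding fls_const_mult_const[symmetric] fls_const_diff L_def
        by (simp add: algebra_simps del: fls_const_mult_const)
      moreover have "\<dots> \<in> I" 
        by (rule diff[OF mem(1) mul[OF _ l3]]) (intro R_diff R_add R_X R_const)
      ultimately have "fls_const ((x3 - x1) * (x3 - x2)) * f \<in> I" by simp
      thus ?thesis by (rule canc[rotated]) fact
    qed (rule canc[OF _ y3])
  next
    case True
    \<comment> \<open>At a flex all \<open>L x\<close> coincide and differences give nothing.
      Instead \<open>h\<close> is the nonzero constant \<open>?y\<close> modulo
      \<open>L x1\<close>.\<close>
    with distinct have eq: "x2 = x1" "x3 = x1" by auto
    let ?y = "m * x1 + n"
    have y: "?y \<noteq> 0" using sep eq by auto
    have hy: "h = fls_const ?y + fls_const m * L x1"
      by (simp add: h_def L_def algebra_simps flip: fls_plus_const)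
    have "fls_const ?y * (L x1 * f) = h * (L x1 * f) - fls_const m * (L x1 * L x2 * f)"
      unfolding hy eq by (simp add: algebra_simps)
    also have "\<dots> \<in> I" by (rule diff[OF hL[OF mem(4)] mul[OF R(4) mem(1)]])
    finally have l1: "L x1 * f \<in> I" by (rule canc[OF y])
    have "fls_const 4 * (h * (h * f)) = (f * (f + 2 * h)) * (2 * h - f) + f * f * f"
      by (simp add: algebra_simps)
    also have "\<dots> = (fls_const 2 * h - f) * (L x1 * L x2 * L x3) + f * f * f"
      unfolding norm by (simp add: algebra_simps)
    also have "\<dots> \<in> I" by (rule add[OF mul[OF _ mem(7)] mem(6)]) (intro R_diff R_mult R)
    finally have hh: "h * (h * f) \<in> I" by (rule canc[rotated]) simp
    have "fls_const (?y * ?y) * f = h * (h * f) - fls_const m * (h + fls_const ?y) * (L x1 * f)"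
      unfolding hy fls_const_mult_const[symmetric] by (simp add: algebra_simps del: fls_const_mult_const)
    also have "\<dots> \<in> I" by (rule diff[OF hh mul[OF _ l1]]) (intro R_mult R_add R)
    finally show ?thesis by (rule canc[rotated]) (use y in simp)
  qed
  moreover have "f \<noteq> 0 \<and> fls_subdegree f = -3"
  proof -
    have "f = emb [:- n, - m:] + emb 1 * Y"
      by (simp add: f_def h_def one_pCons algebra_simps)
    thus ?thesis using R_repr[of "[:- n, - m:]" 1] by auto
  qed
  ultimately show ?thesis unfolding principal_def I_def
    by (intro bexI[of _ f]) (auto simp del: pt_ideal.simps ideal_prod_add_mset)
qed

end

section \<open>The group law\<close>

context cubic_curve
begin

lemma ec_add_slope:
  assumes "\<not> (x1 = x2 \<and> y1 + y2 = 0)"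
    and "m = (if x1 = x2 then (3 * x1 ^ 2 + 2 * A * x1 + B) / (2 * y1) else (y2 - y1) / (x2 - x1))"
  shows "ec_add E (Point x1 y1) (Point x2 y2) =
    Point (m ^ 2 - A - x1 - x2) (- m * (m ^ 2 - A - x1 - x2) - (y1 - m * x1))"
proof (cases "x1 = x2")
  case True
  hence m: "m = (3 * x1 ^ 2 + 2 * A * x1 + B) / (2 * y1)" using assms(2) by simp
  have "y1 + y2 \<noteq> 0" using assms(1) True by simp
  thus ?thesis using True unfolding m by (simp add: Let_def)
next
  case False
  hence m: "m = (y2 - y1) / (x2 - x1)" using assms(2) by simp
  show ?thesis using False unfolding m by (simp add: Let_def)
qed

text \<open>Vieta's formulas put chord and tangent into one form. The formula for \<open>B\<close>
  comes from dividing the difference of the two curve equations by \<open>x2 - x1\<close> for a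
  chord, and from the definition of the slope for a tangent.\<close>

lemma ec_add_line:
  assumes P: "on_curve E (Point x1 y1)" and Q: "on_curve E (Point x2 y2)"
    and nopp: "\<not> (x1 = x2 \<and> y1 + y2 = 0)"
  obtains m n x3 where "y1 = m * x1 + n" "y2 = m * x2 + n"
    "ec_add E (Point x1 y1) (Point x2 y2) = Point x3 (- (m * x3 + n))"
    "A = m ^ 2 - (x1 + x2 + x3)" "B = 2 * m * n + x1 * x2 + x1 * x3 + x2 * x3"
    "C = n ^ 2 - x1 * x2 * x3"
proof -
  define m where "m = (if x1 = x2 then (3 * x1 ^ 2 + 2 * A * x1 + B) / (2 * y1)
    else (y2 - y1) / (x2 - x1))"
  define n where "n = y1 - m * x1"
  define x3 where "x3 = m ^ 2 - A - x1 - x2"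
  have s: "ec_add E (Point x1 y1) (Point x2 y2) = Point x3 (- (m * x3 + n))"
    using ec_add_slope[OF nopp m_def] unfolding n_def x3_def by simp
  have y1: "y1 = m * x1 + n" by (simp add: n_def)
  have y2: "y2 = m * x2 + n \<and> B = 2 * m * n + x1 * x2 + x1 * x3 + x2 * x3"
  proof (cases "x1 = x2")
    case True
    have "y1 ^ 2 = y2 ^ 2" using P Q True by simp
    hence y: "y2 = y1" using nopp True by (auto simp: power2_eq_iff)
    hence "y1 \<noteq> 0" using nopp True by auto
    hence "2 * m * y1 = 3 * x1 ^ 2 + 2 * A * x1 + B" using True by (simp add: m_def)
    hence B: "B = 2 * m * y1 - 3 * x1 ^ 2 - 2 * A * x1" by simp
    have "y2 = m * x2 + n" using True y by (simp add: n_def)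
    moreover have "B = 2 * m * n + x1 * x2 + x1 * x3 + x2 * x3"
      unfolding B n_def x3_def True[symmetric] by (simp add: algebra_simps power2_eq_square)
    ultimately show ?thesis ..
  next
    case False
    hence "m * (x2 - x1) = y2 - y1" by (simp add: m_def)
    hence y2: "y2 = m * x2 + n" by (simp add: n_def algebra_simps)
    have "(x2 - x1) * (x1 ^ 2 + x1 * x2 + x2 ^ 2 + A * (x1 + x2) + B) = y2 ^ 2 - y1 ^ 2"
      using P Q by (simp add: algebra_simps power2_eq_square power3_eq_cube)
    also have "\<dots> = (x2 - x1) * (m * (m * (x1 + x2) + 2 * n))"
      unfolding y1 y2 by (simp add: algebra_simps power2_eq_square)
    finally have "x1 ^ 2 + x1 * x2 + x2 ^ 2 + A * (x1 + x2) + B = m * (m * (x1 + x2) + 2 * n)"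
      using False by simp
    hence "B = m * (m * (x1 + x2) + 2 * n) - (x1 ^ 2 + x1 * x2 + x2 ^ 2 + A * (x1 + x2))"
      by (simp add: algebra_simps)
    also have "\<dots> = 2 * m * n + x1 * x2 + x1 * x3 + x2 * x3"
      unfolding x3_def by (simp add: algebra_simps power2_eq_square)
    finally show ?thesis using y2 by blast
  qed
  have "C = y1 ^ 2 - x1 ^ 3 - A * x1 ^ 2 - B * x1" using P by simp
  also have "\<dots> = (m * x1 + n) ^ 2 - x1 ^ 3 - (m ^ 2 - (x1 + x2 + x3)) * x1 ^ 2
      - (2 * m * n + x1 * x2 + x1 * x3 + x2 * x3) * x1"
    using y1 conjunct2[OF y2] by (simp add: x3_def)
  also have "\<dots> = n ^ 2 - x1 * x2 * x3"
    by (simp add: algebra_simps power2_eq_square power3_eq_cube)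
  finally have C: "C = n ^ 2 - x1 * x2 * x3" .
  have A: "A = m ^ 2 - (x1 + x2 + x3)" by (simp add: x3_def)
  show ?thesis by (rule that[OF y1 conjunct1[OF y2] s A conjunct2[OF y2] C])
qed

lemma on_curve_neg [simp]: "on_curve E (ec_neg E P) \<longleftrightarrow> on_curve E P"
  by (cases P) auto

lemma neg_neg [simp]: "ec_neg E (ec_neg E P) = P"
  by (cases P) auto

lemma ec_add_0_right [simp]: "ec_add E P Infinity = P"
  by (cases P) auto

lemma on_line:
  assumes "A = m ^ 2 - (x1 + x2 + x3)" "B = 2 * m * n + x1 * x2 + x1 * x3 + x2 * x3"
    "C = n ^ 2 - x1 * x2 * x3"
  shows "on_curve E (Point x3 (m * x3 + n))"
  unfolding assms by (simp add: algebra_simps power2_eq_square power3_eq_cube)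

lemma ec_add_closed:
  assumes "on_curve E P" "on_curve E Q"
  shows "on_curve E (ec_add E P Q)"
proof (cases P; cases Q)
  fix x1 y1 x2 y2 assume pts: "P = Point x1 y1" "Q = Point x2 y2"
  show ?thesis
  proof (cases "x1 = x2 \<and> y1 + y2 = 0")
    case False
    from ec_add_line[OF assms[unfolded pts] this] obtain m n x3 where
      *: "ec_add E (Point x1 y1) (Point x2 y2) = Point x3 (- (m * x3 + n))"
      "A = m ^ 2 - (x1 + x2 + x3)" "B = 2 * m * n + x1 * x2 + x1 * x3 + x2 * x3"
      "C = n ^ 2 - x1 * x2 * x3" by metis
    have "ec_neg E (ec_add E P Q) = Point x3 (m * x3 + n)" unfolding pts *(1) by simp
    hence "on_curve E (ec_neg E (ec_add E P Q))" using on_line[OF *(2-4)] by (simp only:)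
    thus ?thesis by (simp only: on_curve_neg)
  qed (use pts in simp)
qed (use assms in auto)

lemma ec_add_comm:
  assumes "on_curve E P" "on_curve E Q"
  shows "ec_add E P Q = ec_add E Q P"
proof (cases P; cases Q)
  fix x1 y1 x2 y2 assume pts: "P = Point x1 y1" "Q = Point x2 y2"
  show ?thesis
  proof (cases "x1 = x2")
    case True
    hence "y2 ^ 2 = y1 ^ 2" using assms pts by simp
    thus ?thesis using True pts by (auto simp: power2_eq_iff)
  next
    case False
    define m where "m = (y2 - y1) / (x2 - x1)"
    have m: "m = (y1 - y2) / (x1 - x2)"
      using False by (simp add: m_def field_simps)
    have "m * (x2 - x1) = y2 - y1" using False by (simp add: m_def)
    hence "y1 - m * x1 = y2 - m * x2" by (simp add: algebra_simps)
    moreover have "ec_add E P Q = Point (m ^ 2 - A - x1 - x2) (- m * (m ^ 2 - A - x1 - x2) - (y1 - m * x1))"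
      unfolding pts using False by (intro ec_add_slope) (auto simp: m_def)
    moreover have "ec_add E Q P = Point (m ^ 2 - A - x2 - x1) (- m * (m ^ 2 - A - x2 - x1) - (y2 - m * x2))"
      unfolding pts using False by (intro ec_add_slope) (auto simp: m)
    moreover have "m ^ 2 - A - x2 - x1 = m ^ 2 - A - x1 - x2" by simp
    ultimately show ?thesis by simp
  qed
qed auto

lemma neg_ec_add:
  assumes "on_curve E P" "on_curve E Q"
  shows "ec_neg E (ec_add E P Q) = ec_add E (ec_neg E P) (ec_neg E Q)"
proof (cases P; cases Q)
  fix x1 y1 x2 y2 assume pts: "P = Point x1 y1" "Q = Point x2 y2"
  have e: "- y1 + - y2 = 0 \<longleftrightarrow> y1 + y2 = 0"
    by (metis add.inverse_distrib_swap neg_equal_0_iff_equal add.commute)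
  have m: "(- y2 - - y1) / (x2 - x1) = - ((y2 - y1) / (x2 - x1))"
    unfolding minus_divide_left by simp
  show ?thesis
  proof (cases "x1 = x2 \<and> y1 + y2 = 0")
    case False
    define m where "m = (if x1 = x2 then (3 * x1 ^ 2 + 2 * A * x1 + B) / (2 * y1)
      else (y2 - y1) / (x2 - x1))"
    have "(if x1 = x2 then (3 * x1 ^ 2 + 2 * A * x1 + B) / (2 * (- y1))
      else (- y2 - - y1) / (x2 - x1)) = - m" unfolding m_def m by simp
    note m' = this[symmetric]
    have "\<not> (x1 = x2 \<and> - y1 + - y2 = 0)" using False e by simp
    from ec_add_slope[OF this m'] ec_add_slope[OF False m_def] show ?thesis
      unfolding pts by simp
  qed (use pts e in auto)
qed auto

lemma ec_add_neg [simp]: "ec_add E P (ec_neg E P) = Infinity" "ec_add E (ec_neg E P) P = Infinity"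
  by (cases P; simp)+

lemma principal_sum:
  assumes P: "on_curve E P" and Q: "on_curve E Q"
  shows "principal {#P, Q, ec_neg E (ec_add E P Q)#}"
proof (cases "P = Infinity \<or> Q = Infinity \<or> Q = ec_neg E P")
  case True
  have inf: "principal (add_mset Infinity M) \<longleftrightarrow> principal M" for M
    unfolding principal_def by simp
  have perm: "{#P, Infinity, ec_neg E P#} = {#Infinity, P, ec_neg E P#}"
    "{#P, ec_neg E P, Infinity#} = {#Infinity, P, ec_neg E P#}" by (simp_all add: multiset_eq_iff)
  from True show ?thesis
  proof (elim disjE)
    assume "P = Infinity"
    thus ?thesis using principal_vertical[OF Q] inf by simp
  next
    assume "Q = Infinity"
    hence "{#P, Q, ec_neg E (ec_add E P Q)#} = {#Infinity, P, ec_neg E P#}" using perm by simp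
    thus ?thesis using principal_vertical[OF P] inf by metis
  next
    assume "Q = ec_neg E P"
    hence "{#P, Q, ec_neg E (ec_add E P Q)#} = {#Infinity, P, ec_neg E P#}" using perm by simp
    thus ?thesis using principal_vertical[OF P] inf by metis
  qed
next
  case False
  then obtain x1 y1 x2 y2 where pts: "P = Point x1 y1" "Q = Point x2 y2"
    by (cases P; cases Q) auto
  have nopp: "\<not> (x1 = x2 \<and> y1 + y2 = 0)"
  proof
    assume a: "x1 = x2 \<and> y1 + y2 = 0"
    hence "y2 = - y1" by (metis add_eq_0_iff)
    thus False using False pts a by simp
  qed
  from ec_add_line[OF P[unfolded pts(1)] Q[unfolded pts(2)] nopp] obtain m n x3 where
    y: "y1 = m * x1 + n" "y2 = m * x2 + n"
    and s: "ec_add E (Point x1 y1) (Point x2 y2) = Point x3 (- (m * x3 + n))"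
    and c: "A = m ^ 2 - (x1 + x2 + x3)" "B = 2 * m * n + x1 * x2 + x1 * x3 + x2 * x3"
      "C = n ^ 2 - x1 * x2 * x3" .
  have s': "ec_neg E (ec_add E P Q) = Point x3 (m * x3 + n)" unfolding pts s by simp
  show ?thesis
  proof (cases "x1 = x2 \<and> x2 \<noteq> x3")
    case True
    \<comment> \<open>Reordering puts two different abscissae first, as
      \<open>principal_line\<close> requires.\<close>
    have "principal {#Point x1 (m * x1 + n), Point x3 (m * x3 + n), Point x2 (m * x2 + n)#}"
      using c True by (intro principal_line) (auto simp: algebra_simps)
    thus ?thesis unfolding s' unfolding pts y by (simp add: add_mset_commute)
  next
    case False
    show ?thesis unfolding s' unfolding pts y using c False by (intro principal_line) auto
  qed
qed

text \<open>Four collinearity relations are added, two of them for negated points. All points but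
  the negative of \<open>(P + Q) + S\<close> and the point \<open>P + (Q + S)\<close> then occur
  together with their negatives and cancel.\<close>

theorem ec_add_assoc:
  assumes P: "on_curve E P" and Q: "on_curve E Q" and S: "on_curve E S"
  shows "ec_add E (ec_add E P Q) S = ec_add E P (ec_add E Q S)"
proof -
  let ?n = "ec_neg E"
  let ?u = "ec_add E P Q" and ?v = "ec_add E Q S"
  note cl = ec_add_closed
  have v: "?n (ec_add E (?n Q) (?n S)) = ?v" "?n (ec_add E (?n P) (?n ?v)) = ec_add E P ?v"
    using neg_ec_add[of "?n Q" "?n S"] neg_ec_add[of "?n P" "?n ?v"] P Q S cl by auto
  have "principal ({#P, Q, ?n ?u#} + {#?u, S, ?n (ec_add E ?u S)#} +
     ({#?n Q, ?n S, ?v#} + {#?n P, ?n ?v, ec_add E P ?v#}))"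
    using principal_sum[of P Q] principal_sum[of ?u S] principal_sum[of "?n Q" "?n S"]
      principal_sum[of "?n P" "?n ?v"] P Q S cl unfolding v
    by (intro principal_add) auto
  also have "\<dots> = add_mset P (add_mset (?n P) (add_mset Q (add_mset (?n Q) (add_mset S (add_mset (?n S)
     (add_mset ?u (add_mset (?n ?u) (add_mset ?v (add_mset (?n ?v)
      {#?n (ec_add E ?u S), ec_add E P ?v#})))))))))"
    by (simp add: add_mset_commute)
  finally have "principal {#?n (ec_add E ?u S), ec_add E P ?v#}"
    by (rule principal_cancel[OF cl[OF Q S] principal_cancel[OF cl[OF P Q] principal_cancel[OF S
      principal_cancel[OF Q principal_cancel[OF P]]]]])
  from principal_pair[OF _ _ this] show ?thesis using P Q S cl by simp
qed

end

section \<open>Multiples and changes of variables\<close>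

context cubic_curve
begin

lemma ec_mult_0 [simp]: "ec_mult E 0 P = Infinity"
  by (simp add: ec_mult_def)

lemma ec_mult_Suc: "ec_mult E (Suc n) P = ec_add E P (ec_mult E n P)"
  by (simp add: ec_mult_def)

lemma ec_mult_closed:
  assumes "on_curve E P"
  shows "on_curve E (ec_mult E n P)"
  using assms by (induction n) (simp_all add: ec_mult_Suc ec_add_closed del: ec_add.simps)

lemma ec_mult_add:
  assumes "on_curve E P"
  shows "ec_mult E (m + n) P = ec_add E (ec_mult E m P) (ec_mult E n P)"
proof (induction m)
  case (Suc m)
  have "ec_mult E (Suc m + n) P = ec_add E P (ec_add E (ec_mult E m P) (ec_mult E n P))"
    using Suc by (simp add: ec_mult_Suc del: ec_add.simps)
  also have "\<dots> = ec_add E (ec_mult E (Suc m) P) (ec_mult E n P)"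
    unfolding ec_mult_Suc by (rule ec_add_assoc[symmetric]) (use assms ec_mult_closed in auto)
  finally show ?case .
qed simp

lemma ec_mult_neg:
  assumes "on_curve E P"
  shows "ec_mult E n (ec_neg E P) = ec_neg E (ec_mult E n P)"
proof (induction n)
  case (Suc n)
  show ?case
    unfolding ec_mult_Suc Suc neg_ec_add[OF assms ec_mult_closed[OF assms]] ..
qed simp

lemma ec_mult_sum:
  assumes P: "on_curve E P" and Q: "on_curve E Q"
  shows "ec_mult E n (ec_add E P Q) = ec_add E (ec_mult E n P) (ec_mult E n Q)"
proof (induction n)
  case (Suc n)
  let ?p = "ec_mult E n P" and ?q = "ec_mult E n Q"
  note cl = P Q ec_mult_closed[OF P] ec_mult_closed[OF Q] ec_add_closed
  have "ec_mult E (Suc n) (ec_add E P Q) = ec_add E (ec_add E P Q) (ec_add E ?p ?q)"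
    unfolding ec_mult_Suc Suc ..
  also have "\<dots> = ec_add E P (ec_add E Q (ec_add E ?p ?q))"
    by (rule ec_add_assoc) (intro cl)+
  also have "ec_add E Q (ec_add E ?p ?q) = ec_add E (ec_add E Q ?p) ?q"
    by (rule ec_add_assoc[symmetric]) (intro cl)+
  also have "ec_add E Q ?p = ec_add E ?p Q"
    by (rule ec_add_comm) (intro cl)+
  also have "ec_add E (ec_add E ?p Q) ?q = ec_add E ?p (ec_add E Q ?q)"
    by (rule ec_add_assoc) (intro cl)+
  also have "ec_add E P (ec_add E ?p (ec_add E Q ?q)) = ec_add E (ec_add E P ?p) (ec_add E Q ?q)"
    by (rule ec_add_assoc[symmetric]) (intro cl)+
  finally show ?case unfolding ec_mult_Suc .
qed simp

text \<open>Used in the contrapositive: infinitely many distinct multiples rule out torsion.\<close>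

lemma finite_multiples:
  assumes P: "on_curve E P" and n: "n > 0" "ec_mult E n P = Infinity"
  shows "finite (range (\<lambda>k. ec_mult E k P))"
proof -
  have mult: "ec_mult E (n * j) P = Infinity" for j
  proof (induction j)
    case (Suc j)
    thus ?case using ec_mult_add[OF P, of n "n * j"] n(2) by simp
  qed simp
  have "ec_mult E k P = ec_mult E (k mod n) P" for k
    using ec_mult_add[OF P, of "n * (k div n)" "k mod n"] mult by simp
  moreover have "k mod n < n" for k using n(1) by simp
  ultimately have "range (\<lambda>k. ec_mult E k P) \<subseteq> (\<lambda>k. ec_mult E k P) ` {..<n}" by blast
  thus ?thesis by (rule finite_subset) simp
qed

lemma ec_add_cancel:
  assumes "on_curve E P" "on_curve E Q"
  shows "ec_add E Q (ec_add E P (ec_neg E Q)) = P"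
proof -
  have "ec_add E Q (ec_add E P (ec_neg E Q)) = ec_add E (ec_add E P (ec_neg E Q)) Q"
    using assms by (intro ec_add_comm ec_add_closed) auto
  also have "\<dots> = ec_add E P (ec_add E (ec_neg E Q) Q)"
    using assms by (intro ec_add_assoc) auto
  finally show ?thesis by simp
qed

end

section \<open>Points and sums under changes of variables\<close>

fun change_point :: "'a::field \<Rightarrow> 'a \<Rightarrow> 'a \<Rightarrow> 'a \<Rightarrow> 'a ecpoint \<Rightarrow> 'a ecpoint" where
  "change_point u r s t Infinity = Infinity"
| "change_point u r s t (Point x y) = Point ((x - r) / u ^ 2) ((y - t - s * (x - r)) / u ^ 3)"

text \<open>In terms of \<open>i = inverse u\<close> all coefficients are polynomials, so the
  identities that follow are free of denominators.\<close>

lemma change_vars_inverse: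
  "change_vars u r s t E = (let i = inverse u in WCurve
     ((a1 E + 2 * s) * i)
     ((a2 E - s * a1 E + 3 * r - s ^ 2) * i ^ 2)
     ((a3 E + r * a1 E + 2 * t) * i ^ 3)
     ((a4 E - s * a3 E + 2 * r * a2 E - (t + r * s) * a1 E + 3 * r ^ 2 - 2 * s * t) * i ^ 4)
     ((a6 E + r * a4 E + r ^ 2 * a2 E + r ^ 3 - t * a3 E - t ^ 2 - r * t * a1 E) * i ^ 6))"
  by (simp add: change_vars_def divide_inverse power_inverse Let_def)

lemma change_point_inverse:
  "change_point u r s t (Point x y) =
    (let i = inverse u in Point ((x - r) * i ^ 2) ((y - t - s * (x - r)) * i ^ 3))"
  by (simp add: divide_inverse power_inverse Let_def)

lemma on_curve_change:
  assumes "u \<noteq> 0"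
  shows "on_curve (change_vars u r s t E) (change_point u r s t P) \<longleftrightarrow> on_curve E P"
proof (cases P)
  case (Point x y)
  define i where "i = inverse u"
  have i: "i \<noteq> 0" using assms by (simp add: i_def)
  define E' where "E' = change_vars u r s t E"
  have E': "a1 E' = (a1 E + 2 * s) * i" "a2 E' = (a2 E - s * a1 E + 3 * r - s ^ 2) * i ^ 2"
    "a3 E' = (a3 E + r * a1 E + 2 * t) * i ^ 3"
    "a4 E' = (a4 E - s * a3 E + 2 * r * a2 E - (t + r * s) * a1 E + 3 * r ^ 2 - 2 * s * t) * i ^ 4"
    "a6 E' = (a6 E + r * a4 E + r ^ 2 * a2 E + r ^ 3 - t * a3 E - t ^ 2 - r * t * a1 E) * i ^ 6"
    unfolding E'_def change_vars_inverse by (simp_all add: Let_def i_def)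
  define x' where "x' = (x - r) * i ^ 2"
  define y' where "y' = (y - t - s * (x - r)) * i ^ 3"
  have "(y' ^ 2 + a1 E' * x' * y' + a3 E' * y') - (x' ^ 3 + a2 E' * x' ^ 2 + a4 E' * x' + a6 E') =
    i ^ 6 * ((y ^ 2 + a1 E * x * y + a3 E * y) - (x ^ 3 + a2 E * x ^ 2 + a4 E * x + a6 E))"
    unfolding E' x'_def y'_def
    by (simp add: algebra_simps power2_eq_square power3_eq_cube power_mult_distrib eval_nat_numeral)
  hence "y' ^ 2 + a1 E' * x' * y' + a3 E' * y' = x' ^ 3 + a2 E' * x' ^ 2 + a4 E' * x' + a6 E' \<longleftrightarrow>
    y ^ 2 + a1 E * x * y + a3 E * y = x ^ 3 + a2 E * x ^ 2 + a4 E * x + a6 E"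
    using i by (metis (no_types) mult_eq_0_iff power_not_zero right_minus_eq)
  thus ?thesis unfolding Point change_point_inverse E'_def[symmetric] Let_def
      i_def[symmetric] x'_def[symmetric] y'_def[symmetric] by simp
qed simp

lemma ec_add_formula:
  assumes "\<not> (x1 = x2 \<and> y1 + y2 + a1 E * x2 + a3 E = 0)"
    and "m = (if x1 = x2
      then (3 * x1 ^ 2 + 2 * a2 E * x1 + a4 E - a1 E * y1) / (2 * y1 + a1 E * x1 + a3 E)
      else (y2 - y1) / (x2 - x1))"
    and "x3 = m ^ 2 + a1 E * m - a2 E - x1 - x2"
  shows "ec_add E (Point x1 y1) (Point x2 y2) = Point x3 (- (m + a1 E) * x3 - (y1 - m * x1) - a3 E)"
  unfolding ec_add.simps if_not_P[OF assms(1)] Let_def assms(2)[symmetric] assms(3)[symmetric] ..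

text \<open>Points over one abscissa are equal or opposite. The tangent branch of
  \<open>ec_add\<close> reads only \<open>y1\<close>; equality is what makes its denominator
  nonzero.\<close>

lemma on_curve_same_abscissa:
  fixes E :: "'a::field wcurve"
  assumes "on_curve E (Point x y1)" "on_curve E (Point x y2)" "y1 + y2 + a1 E * x + a3 E \<noteq> 0"
  shows "y1 = y2"
proof -
  have "(y1 - y2) * (y1 + y2 + a1 E * x + a3 E) =
    (y1 ^ 2 + a1 E * x * y1 + a3 E * y1) - (y2 ^ 2 + a1 E * x * y2 + a3 E * y2)"
    by (simp add: algebra_simps power2_eq_square)
  also have "\<dots> = 0" using assms(1,2) by simp
  finally show ?thesis using assms(3) by simp
qed

text \<open>The substitution takes lines to lines and a slope \<open>m\<close> to
  \<open>(m - s) / u\<close>; after that the formulas for the sum agree identically.\<close>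

lemma ec_add_change:
  assumes u: "u \<noteq> 0" and P: "on_curve E P" and Q: "on_curve E Q"
  shows "ec_add (change_vars u r s t E) (change_point u r s t P) (change_point u r s t Q) =
    change_point u r s t (ec_add E P Q)"
proof (cases P; cases Q)
  fix x1 y1 x2 y2 assume pts: "P = Point x1 y1" "Q = Point x2 y2"
  define i where "i = inverse u"
  have i: "i \<noteq> 0" using u by (simp add: i_def)
  define E' where "E' = change_vars u r s t E"
  have E': "a1 E' = (a1 E + 2 * s) * i" "a2 E' = (a2 E - s * a1 E + 3 * r - s ^ 2) * i ^ 2"
    "a3 E' = (a3 E + r * a1 E + 2 * t) * i ^ 3"
    "a4 E' = (a4 E - s * a3 E + 2 * r * a2 E - (t + r * s) * a1 E + 3 * r ^ 2 - 2 * s * t) * i ^ 4"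
    unfolding E'_def change_vars_inverse by (simp_all add: Let_def i_def)
  define cx where "cx x = (x - r) * i ^ 2" for x
  define cy where "cy x y = (y - t - s * (x - r)) * i ^ 3" for x y
  have cp: "change_point u r s t (Point x y) = Point (cx x) (cy x y)" for x y
    unfolding change_point_inverse Let_def i_def[symmetric] cx_def cy_def ..
  have cx: "cx x = cx x' \<longleftrightarrow> x = x'" for x x' using i by (simp add: cx_def)
  have opp: "cy x2 y1 + cy x2 y2 + a1 E' * cx x2 + a3 E' = i ^ 3 * (y1 + y2 + a1 E * x2 + a3 E)"
    unfolding E' cx_def cy_def by (simp add: algebra_simps eval_nat_numeral)
  show ?thesis
  proof (cases "x1 = x2 \<and> y1 + y2 + a1 E * x2 + a3 E = 0")
    case True
    hence "cy x2 y1 + cy x2 y2 + a1 E' * cx x2 + a3 E' = 0" using opp by simp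
    thus ?thesis using True unfolding pts cp E'_def[symmetric] by simp
  next
    case False
    define m where "m = (if x1 = x2
      then (3 * x1 ^ 2 + 2 * a2 E * x1 + a4 E - a1 E * y1) / (2 * y1 + a1 E * x1 + a3 E)
      else (y2 - y1) / (x2 - x1))"
    define x3 where "x3 = m ^ 2 + a1 E * m - a2 E - x1 - x2"
    note sum = ec_add_formula[OF False m_def x3_def]
    have False': "\<not> (cx x1 = cx x2 \<and> cy x1 y1 + cy x2 y2 + a1 E' * cx x2 + a3 E' = 0)"
      using False opp cx i by auto
    have m': "(m - s) * i = (if cx x1 = cx x2
      then (3 * cx x1 ^ 2 + 2 * a2 E' * cx x1 + a4 E' - a1 E' * cy x1 y1) /
        (2 * cy x1 y1 + a1 E' * cx x1 + a3 E')
      else (cy x2 y2 - cy x1 y1) / (cx x2 - cx x1))"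
    proof (cases "x1 = x2")
      case True
      with False have ne: "y1 + y2 + a1 E * x1 + a3 E \<noteq> 0" by simp
      with on_curve_same_abscissa[of E x1 y1 y2] P Q pts True have "y1 = y2" by simp
      with ne have den: "2 * y1 + a1 E * x1 + a3 E \<noteq> 0" by simp
      have den': "2 * cy x1 y1 + a1 E' * cx x1 + a3 E' = i ^ 3 * (2 * y1 + a1 E * x1 + a3 E)"
        unfolding E' cx_def cy_def by (simp add: algebra_simps eval_nat_numeral)
      have num: "3 * cx x1 ^ 2 + 2 * a2 E' * cx x1 + a4 E' - a1 E' * cy x1 y1 =
        i ^ 4 * ((3 * x1 ^ 2 + 2 * a2 E * x1 + a4 E - a1 E * y1) - s * (2 * y1 + a1 E * x1 + a3 E))"
        unfolding E' cx_def cy_def by (simp add: algebra_simps eval_nat_numeral)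
      have m: "m * (2 * y1 + a1 E * x1 + a3 E) = 3 * x1 ^ 2 + 2 * a2 E * x1 + a4 E - a1 E * y1"
        using True den by (simp add: m_def)
      have "i ^ 4 * ((3 * x1 ^ 2 + 2 * a2 E * x1 + a4 E - a1 E * y1)
          - s * (2 * y1 + a1 E * x1 + a3 E)) =
        (m - s) * i * (i ^ 3 * (2 * y1 + a1 E * x1 + a3 E))"
        unfolding m[symmetric] by (simp add: algebra_simps eval_nat_numeral)
      thus ?thesis using True den i unfolding den' num by simp
    next
      case F: False
      have den': "cx x2 - cx x1 = i ^ 2 * (x2 - x1)"
        unfolding cx_def by (simp add: algebra_simps)
      have num: "cy x2 y2 - cy x1 y1 = i ^ 3 * ((y2 - y1) - s * (x2 - x1))"
        unfolding cy_def by (simp add: algebra_simps)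
      have m: "m * (x2 - x1) = y2 - y1" using F by (simp add: m_def)
      have "i ^ 3 * ((y2 - y1) - s * (x2 - x1)) = (m - s) * i * (i ^ 2 * (x2 - x1))"
        unfolding m[symmetric] by (simp add: algebra_simps eval_nat_numeral)
      thus ?thesis using F i cx unfolding den' num by simp
    qed
    have x3: "cx x3 = ((m - s) * i) ^ 2 + a1 E' * ((m - s) * i) - a2 E' - cx x1 - cx x2"
      unfolding E' cx_def x3_def by (simp add: algebra_simps eval_nat_numeral)
    have y3: "cy x3 (- (m + a1 E) * x3 - (y1 - m * x1) - a3 E) =
      - ((m - s) * i + a1 E') * cx x3 - (cy x1 y1 - (m - s) * i * cx x1) - a3 E'"
      unfolding E' cx_def cy_def by (simp add: algebra_simps eval_nat_numeral)
    show ?thesis unfolding pts cp E'_def[symmetric] sum ec_add_formula[OF False' m' x3] y3 ..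
  qed
qed (simp_all add: change_vars_def)

lemma map_change_vars:
  fixes E :: "rat wcurve"
  shows "map_wcurve of_rat (change_vars u r s t E) =
    (change_vars (of_rat u) (of_rat r) (of_rat s) (of_rat t) (map_wcurve of_rat E)
      :: 'a::field_char_0 wcurve)"
  by (simp add: change_vars_def wcurve.map_sel of_rat_divide of_rat_add of_rat_diff of_rat_mult of_rat_power)

section \<open>The 2-adic valuation of rational numbers\<close>

text \<open>The localisation of the integers at 2.\<close>

definition odd_denom :: "rat set" where
  "odd_denom = {of_int a / of_int b | a b. odd b}"

text \<open>Two predicates replace a valuation function: 0 satisfies \<open>val_ge\<close> for every
  \<open>k\<close> and \<open>val_eq\<close> for none, so no value at 0 has to be chosen.\<close>

definition val_ge :: "rat \<Rightarrow> int \<Rightarrow> bool" where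
  "val_ge q k \<longleftrightarrow> (\<exists>z \<in> odd_denom. q = 2 powi k * z)"

definition val_eq :: "rat \<Rightarrow> int \<Rightarrow> bool" where
  "val_eq q k \<longleftrightarrow> (\<exists>a b. odd a \<and> odd b \<and> q = 2 powi k * (of_int a / of_int b))"

lemma odd_denomI: "odd b \<Longrightarrow> of_int a / of_int b \<in> odd_denom"
  unfolding odd_denom_def by blast

lemma odd_denom_add: "p \<in> odd_denom \<Longrightarrow> q \<in> odd_denom \<Longrightarrow> p + q \<in> odd_denom"
  unfolding odd_denom_def
proof safe
  fix a b a' b' :: int assume "odd b" "odd b'"
  hence "(of_int a / of_int b + of_int a' / of_int b' :: rat) = of_int (a * b' + a' * b) / of_int (b * b')"
    by (auto simp: divide_simps)
  thus "\<exists>c e. (of_int a / of_int b + of_int a' / of_int b' :: rat) = of_int c / of_int e \<and> odd e"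
    using \<open>odd b\<close> \<open>odd b'\<close> by (meson even_mult_iff)
qed

lemma odd_denom_mult: "p \<in> odd_denom \<Longrightarrow> q \<in> odd_denom \<Longrightarrow> p * q \<in> odd_denom"
  unfolding odd_denom_def
proof safe
  fix a b a' b' :: int assume "odd b" "odd b'"
  have "(of_int a / of_int b * (of_int a' / of_int b') :: rat) = of_int (a * a') / of_int (b * b')"
    by simp
  thus "\<exists>c e. (of_int a / of_int b * (of_int a' / of_int b') :: rat) = of_int c / of_int e \<and> odd e"
    using \<open>odd b\<close> \<open>odd b'\<close> by (meson even_mult_iff)
qed

lemma odd_denom_int [simp]: "of_int n \<in> odd_denom"
  using odd_denomI[of 1 n] by simp

lemma odd_denom_minus: "q \<in> odd_denom \<Longrightarrow> - q \<in> odd_denom"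
  using odd_denom_mult[of "-1" q] odd_denom_int[of "-1"] by simp

lemma val_ge_0_iff: "val_ge q 0 \<longleftrightarrow> q \<in> odd_denom"
  by (simp add: val_ge_def)

lemma val_ge_0 [simp]: "val_ge 0 k"
  unfolding val_ge_def using odd_denom_int[of 0] by auto

lemma val_ge_int [simp]: "val_ge (of_int n) 0"
  by (simp add: val_ge_0_iff)

lemma val_ge_mult: "val_ge p k \<Longrightarrow> val_ge q l \<Longrightarrow> val_ge (p * q) (k + l)"
  unfolding val_ge_def
proof (elim bexE)
  fix x y assume "x \<in> odd_denom" "y \<in> odd_denom" "p = 2 powi k * x" "q = 2 powi l * y"
  thus "\<exists>z \<in> odd_denom. p * q = 2 powi (k + l) * z"
    by (intro bexI[of _ "x * y"]) (auto simp: power_int_add odd_denom_mult)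
qed

lemma val_ge_mono: "val_ge q k \<Longrightarrow> j \<le> k \<Longrightarrow> val_ge q j"
  unfolding val_ge_def
proof (elim bexE)
  fix z assume z: "z \<in> odd_denom" "q = 2 powi k * z" and "j \<le> k"
  then obtain n where n: "k = j + int n" using zle_iff_zadd by blast
  have "(2 :: rat) powi (j + int n) = 2 powi j * 2 ^ n" by (subst power_int_add) auto
  hence "q = 2 powi j * (of_int (2 ^ n) * z)" using z(2) unfolding n by (simp only: of_int_power of_int_numeral mult.assoc)
  thus "\<exists>z \<in> odd_denom. q = 2 powi j * z"
    using odd_denom_mult[OF odd_denom_int z(1)] by blast
qed

lemma val_ge_add: "val_ge p k \<Longrightarrow> val_ge q k \<Longrightarrow> val_ge (p + q) k"
  unfolding val_ge_def by (metis distrib_left odd_denom_add)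

lemma val_ge_minus: "val_ge q k \<Longrightarrow> val_ge (- q) k"
  unfolding val_ge_def by (metis mult_minus_right odd_denom_minus)

lemma val_ge_diff: "val_ge p k \<Longrightarrow> val_ge q k \<Longrightarrow> val_ge (p - q) k"
  using val_ge_add[of p k "- q"] val_ge_minus by simp

lemma val_eq_imp_ge: "val_eq q k \<Longrightarrow> val_ge q k"
  unfolding val_eq_def val_ge_def using odd_denomI by blast

lemma val_eq_nonzero: "val_eq q k \<Longrightarrow> q \<noteq> 0"
  unfolding val_eq_def by auto

lemma val_eq_mult: "val_eq p k \<Longrightarrow> val_eq q l \<Longrightarrow> val_eq (p * q) (k + l)"
  unfolding val_eq_def
proof (elim exE conjE)
  fix a b a' b' :: int
  assume "odd a" "odd b" "odd a'" "odd b'" "p = 2 powi k * (of_int a / of_int b)"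
    "q = 2 powi l * (of_int a' / of_int b')"
  thus "\<exists>a b. odd a \<and> odd b \<and> p * q = 2 powi (k + l) * (of_int a / of_int b)"
    by (intro exI[of _ "a * a'"] exI[of _ "b * b'"]) (auto simp: power_int_add)
qed

lemma val_eq_inverse: "val_eq q k \<Longrightarrow> val_eq (inverse q) (- k)"
  unfolding val_eq_def
proof (elim exE conjE)
  fix a b :: int
  assume "odd a" "odd b" "q = 2 powi k * (of_int a / of_int b)"
  thus "\<exists>a b. odd a \<and> odd b \<and> inverse q = 2 powi (- k) * (of_int a / of_int b)"
    by (intro exI[of _ "b"] exI[of _ "a"]) (auto simp: power_int_minus field_simps)
qed

lemma val_eq_divide: "val_eq p k \<Longrightarrow> val_eq q l \<Longrightarrow> val_eq (p / q) (k - l)"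
  using val_eq_mult[of p k "inverse q" "- l"] val_eq_inverse by (simp add: divide_inverse)

lemma val_eq_odd: "odd n \<Longrightarrow> val_eq (of_int n) 0"
  unfolding val_eq_def by (intro exI[of _ n] exI[of _ 1]) auto

lemma val_eq_two_power: "val_eq (2 ^ n) (int n)"
  unfolding val_eq_def by (intro exI[of _ 1]) auto

lemma val_eq_2: "val_eq 2 1" and val_eq_4: "val_eq 4 2" and val_eq_16: "val_eq 16 4"
  and val_eq_64: "val_eq 64 6"
  using val_eq_two_power[of 1] val_eq_two_power[of 2] val_eq_two_power[of 4] val_eq_two_power[of 6]
  by simp_all

lemma val_eq_power: "val_eq q k \<Longrightarrow> val_eq (q ^ n) (int n * k)"
proof (induction n)
  case 0
  show ?case using val_eq_odd[of 1] by simp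
next
  case (Suc n)
  hence "val_eq (q * q ^ n) (k + int n * k)" by (intro val_eq_mult)
  moreover have "k + int n * k = int (Suc n) * k" by (simp add: algebra_simps)
  ultimately show ?case by simp
qed

lemma val_ge_power: "val_ge q k \<Longrightarrow> val_ge (q ^ n) (int n * k)"
proof (induction n)
  case 0
  show ?case using val_ge_int[of 1] by simp
next
  case (Suc n)
  hence "val_ge (q * q ^ n) (k + int n * k)" by (intro val_ge_mult)
  moreover have "k + int n * k = int (Suc n) * k" by (simp add: algebra_simps)
  ultimately show ?case by simp
qed

lemma val_eq_minus: "val_eq q k \<Longrightarrow> val_eq (- q) k"
  using val_eq_mult[of "-1" 0 q k] val_eq_odd[of "-1"] by simp

lemma val_eq_exists: 
  assumes "q \<noteq> 0"
  obtains k where "val_eq q k"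
proof -
  have int: "\<exists>k. val_eq (of_int n) k" if "n \<noteq> 0" for n
  proof -
    obtain m where m: "n = 2 ^ multiplicity 2 n * m" "odd m"
      by (rule multiplicity_decompose'[of n 2]) (use \<open>n \<noteq> 0\<close> in auto)
    have "val_eq (2 ^ multiplicity 2 n * of_int m) (int (multiplicity 2 n) + 0)"
      by (intro val_eq_mult val_eq_two_power val_eq_odd m)
    also have "2 ^ multiplicity 2 n * of_int m = (of_int n :: rat)"
      by (subst (2) m(1)) simp
    finally have "val_eq (of_int n) (int (multiplicity 2 n) + 0)" .
    thus ?thesis ..
  qed
  obtain a b where ab: "b \<noteq> 0" "q = of_int a / of_int b"
    by (metis Fract_of_int_quotient Rat_cases less_irrefl)
  with assms have "a \<noteq> 0" by auto
  with int ab obtain k l where "val_eq (of_int a) k" "val_eq (of_int b) l" by blast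
  thus ?thesis using that val_eq_divide ab(2) by blast
qed

lemma val_geE:
  assumes "val_ge q k"
  obtains a b where "odd b" "q = 2 powi k * (of_int a / of_int b)"
  using assms unfolding val_ge_def odd_denom_def by blast

lemma val_eqE:
  assumes "val_eq q k"
  obtains a b where "odd a" "odd b" "q = 2 powi k * (of_int a / of_int b)"
  using assms unfolding val_eq_def by blast

lemma val_eq_ge_le:
  assumes "val_eq q k" "val_ge q j"
  shows "j \<le> k"
proof (rule ccontr)
  assume "\<not> j \<le> k"
  hence "val_ge q (k + 1)" using val_ge_mono[OF assms(2)] by simp
  then obtain a' b' where o': "odd b'" "q = 2 powi (k + 1) * (of_int a' / of_int b')"
    by (rule val_geE)
  obtain a b where o: "odd a" "odd b" "q = 2 powi k * (of_int a / of_int b)"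
    using assms(1) by (rule val_eqE)
  have e: "2 powi k * (of_int a / of_int b) = (2 powi (k + 1) * (of_int a' / of_int b') :: rat)"
    using o(3) o'(2) by simp
  have "of_int a / of_int b = (2 * (of_int a' / of_int b') :: rat)"
  proof -
    have "(2 :: rat) powi k * (of_int a / of_int b) = 2 powi k * (2 * (of_int a' / of_int b'))"
      using e by (simp add: power_int_add)
    moreover have "(2 :: rat) powi k \<noteq> 0" by simp
    ultimately show ?thesis by (metis mult_left_cancel)
  qed
  hence "(of_int (a * b') :: rat) = of_int (2 * a' * b)"
  proof -
    have "of_int b \<noteq> (0 :: rat)" "of_int b' \<noteq> (0 :: rat)" using o(2) o'(1) by auto
    with \<open>of_int a / of_int b = 2 * (of_int a' / of_int b')\<close> show ?thesis
      by (simp add: divide_simps mult_ac)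
  qed
  hence "a * b' = 2 * a' * b" by (simp only: of_int_eq_iff)
  hence "even (a * b')" by simp
  thus False using o(1) o'(1) by simp
qed

lemma val_eq_unique: "val_eq q k \<Longrightarrow> val_eq q l \<Longrightarrow> k = l"
  using val_eq_ge_le val_eq_imp_ge by (metis order_antisym)

lemma val_eq_add:
  assumes "val_eq p k" "val_ge q l" "k < l"
  shows "val_eq (p + q) k"
proof -
  have "val_ge q (k + 1)" using val_ge_mono[OF assms(2)] assms(3) by simp
  then obtain a' b' where o': "odd b'" "q = 2 powi (k + 1) * (of_int a' / of_int b')"
    by (rule val_geE)
  obtain a b where o: "odd a" "odd b" "p = 2 powi k * (of_int a / of_int b)"
    using assms(1) by (rule val_eqE)
  have "p + q = 2 powi k * (of_int (a * b' + 2 * a' * b) / of_int (b * b'))"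
  proof -
    have "of_int b \<noteq> (0 :: rat)" "of_int b' \<noteq> (0 :: rat)" using o(2) o'(1) by auto
    thus ?thesis unfolding o(3) o'(2) by (simp add: power_int_add divide_simps) (simp add: algebra_simps)
  qed
  moreover have "odd (a * b' + 2 * a' * b)" "odd (b * b')" using o o' by auto
  ultimately show ?thesis unfolding val_eq_def by blast
qed

lemma val_eq_add': "val_ge p l \<Longrightarrow> val_eq q k \<Longrightarrow> k < l \<Longrightarrow> val_eq (p + q) k"
  using val_eq_add[of q k p l] by (simp add: add.commute)

lemma val_eq_unit:
  assumes "val_eq q 0"
  obtains z where "z \<in> odd_denom" "q = 1 + 2 * z"
proof -
  obtain a b where ab: "odd a" "odd b" "q = of_int a / of_int b"
    using assms unfolding val_eq_def by auto
  hence "even (a - b)" by simp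
  then obtain c where "a - b = 2 * c" by (rule dvdE)
  hence "a = b + 2 * c" by simp
  moreover have "of_int b \<noteq> (0 :: rat)" using ab by auto
  ultimately have "q = 1 + 2 * (of_int c / of_int b)" unfolding ab(3) by (simp add: add_divide_distrib)
  thus ?thesis by (rule that[OF odd_denomI[OF ab(2)]])
qed

lemma val_eq_unit_square:
  assumes "val_eq q 0"
  obtains z where "z \<in> odd_denom" "q ^ 2 = 1 + 4 * z"
proof -
  obtain y where y: "y \<in> odd_denom" "q = 1 + 2 * y" using assms by (rule val_eq_unit)
  have "q ^ 2 = 1 + 4 * (y + y * y)" unfolding y(2) by (simp add: power2_eq_square algebra_simps)
  thus ?thesis by (rule that[OF odd_denom_add[OF y(1) odd_denom_mult[OF y(1) y(1)]]])
qed

lemma not_val_ge: "val_eq q k \<Longrightarrow> k < l \<Longrightarrow> \<not> val_ge q l"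
  using val_eq_ge_le by fastforce

lemma val_eq_half_double: "even d \<Longrightarrow> odd (d div 2) \<Longrightarrow> val_eq (of_int d) 1"
proof -
  assume d: "even d" "odd (d div 2)"
  have "val_eq (2 * of_int (d div 2)) (1 + 0)" by (intro val_eq_mult val_eq_2 val_eq_odd d)
  also have "2 * of_int (d div 2) = (of_int (2 * (d div 2)) :: rat)" by (simp only: of_int_mult of_int_numeral)
  also have "2 * (d div 2) = d" using d by simp
  finally show ?thesis by simp
qed

text \<open>The equation arises from a point of order 2 in the kernel of reduction.\<close>

lemma no_solution_kernel:
  fixes r v :: rat and \<alpha> h d :: int
  assumes \<alpha>: "\<alpha> mod 4 = 3" and h: "odd h" and d: "val_eq (of_int d) 1"
    and eq: "(of_int d * r ^ 2) ^ 2 - of_int \<alpha> * (of_int d * r ^ 2) + 16 * of_int h = 4 * of_int d * v ^ 2"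
  shows False
proof -
  define X where "X = of_int d * r ^ 2"
  have \<alpha>': "odd \<alpha>" using \<alpha> by presburger
  \<comment> \<open>The right hand side has valuation \<open>3 + 2 k\<close>, so an even valuation
    on the left is absurd.\<close>
  have rhs: "\<exists>j. odd j \<and> val_eq (4 * of_int d * v ^ 2) j" if "v \<noteq> 0"
  proof -
    from val_eq_exists[OF that] obtain k where "val_eq v k" .
    hence "val_eq (4 * of_int d * v ^ 2) (2 + 1 + int 2 * k)"
      by (intro val_eq_mult val_eq_4 d val_eq_power)
    thus ?thesis by (intro exI[of _ "2 + 1 + int 2 * k"]) auto
  qed
  have par: False if "val_eq (X ^ 2 - of_int \<alpha> * X + 16 * of_int h) j" "even j" for j
  proof -
    have v: "val_eq (4 * of_int d * v ^ 2) j" using that(1) eq unfolding X_def by (simp only:)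
    hence "v \<noteq> 0" using val_eq_nonzero[OF v] by auto
    from rhs[OF this] obtain i where "odd i" "val_eq (4 * of_int d * v ^ 2) i" by blast
    with val_eq_unique[OF v] that(2) show False by blast
  qed
  have h16: "val_eq (16 * of_int h) 4" using val_eq_mult[OF val_eq_16 val_eq_odd[OF h]] by simp
  show False
  proof (cases "r = 0")
    case True
    thus False using par[of 4] h16 by (simp add: X_def)
  next
    case False
    from val_eq_exists[OF False] obtain k0 where "val_eq r k0" .
    hence "val_eq X (1 + int 2 * k0)" unfolding X_def by (intro val_eq_mult d val_eq_power)
    then obtain k where k: "val_eq X k" "odd k" by auto
    have X0: "X \<noteq> 0" using k val_eq_nonzero by blast
    have X2: "val_eq (X ^ 2) (2 * k)" using val_eq_power[OF k(1), of 2] by simp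
    have \<alpha>X: "val_eq (- (of_int \<alpha> * X)) k"
      using val_eq_minus[OF val_eq_mult[OF val_eq_odd[OF \<alpha>'] k(1)]] by simp
    \<comment> \<open>For \<open>k \<ge> 5\<close> the constant term dominates with valuation 4, for
      \<open>k \<le> -1\<close> the square with \<open>2 * k\<close>; both are even. Only 1 and 3
      escape the parity argument.\<close>
    have "k \<ge> 5 \<or> k \<le> -1 \<or> k = 1 \<or> k = 3" using k(2) by presburger
    then consider "k \<ge> 5" | "k \<le> -1" | "k = 1 \<or> k = 3" by blast
    thus False
    proof cases
      case 1
      have "val_ge (X ^ 2 + - (of_int \<alpha> * X)) 5"
        by (intro val_ge_add val_ge_mono[OF val_eq_imp_ge[OF X2]] val_ge_mono[OF val_eq_imp_ge[OF \<alpha>X]])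
          (use 1 in auto)
      from val_eq_add'[OF this h16] show False using par[of 4] by simp
    next
      case 2
      have "val_ge (- (of_int \<alpha> * X) + 16 * of_int h) k"
        by (intro val_ge_add val_eq_imp_ge[OF \<alpha>X] val_ge_mono[OF val_eq_imp_ge[OF h16]]) (use 2 in auto)
      from val_eq_add[OF X2 this] show False using par[of "2 * k"] 2 by (simp add: algebra_simps)
    next
      case 3
      \<comment> \<open>Dividing by \<open>X = d r^2\<close> turns the right hand side
        \<open>4 d v^2\<close> into the square of \<open>2 v / r\<close>.\<close>
      define \<tau> where "\<tau> = 2 * v / r"
      define S where "S = X + 16 * of_int h / X"
      have "of_int d \<noteq> (0 :: rat)" using d val_eq_nonzero by blast
      hence "\<tau> ^ 2 = 4 * of_int d * v ^ 2 / X"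
        using False by (simp add: \<tau>_def X_def power_divide power_mult_distrib)
      also have "\<dots> = (X ^ 2 - of_int \<alpha> * X + 16 * of_int h) / X"
        using eq unfolding X_def by simp
      also have "\<dots> = S - of_int \<alpha>"
        using X0 by (simp add: S_def field_simps power2_eq_square)
      finally have \<tau>: "\<tau> ^ 2 = S - of_int \<alpha>" .
      have hX: "val_eq (16 * of_int h / X) (4 - k)" by (rule val_eq_divide[OF h16 k(1)])
      have S: "val_eq S 1"
      proof (cases "k = 1")
        case True
        thus ?thesis unfolding S_def
          using val_eq_add[OF k(1) val_eq_imp_ge[OF hX]] by simp
      next
        case False
        with 3 have "k = 3" by simp
        thus ?thesis unfolding S_def
          using val_eq_add'[OF val_eq_imp_ge[OF k(1)] hX] by simp
      qed
      have "val_eq (\<tau> ^ 2) 0"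
        using val_eq_add'[OF val_eq_imp_ge[OF S] val_eq_minus[OF val_eq_odd[OF \<alpha>']]] \<tau> by simp
      moreover from this have "\<tau> \<noteq> 0" using val_eq_nonzero by fastforce
      then obtain t where t: "val_eq \<tau> t" by (rule val_eq_exists)
      ultimately have "int 2 * t = 0" using val_eq_unique[OF val_eq_power[OF t, of 2]] by blast
      hence "val_eq \<tau> 0" using t by simp
      then obtain z where z: "z \<in> odd_denom" "\<tau> ^ 2 = 1 + 4 * z" by (rule val_eq_unit_square)
      have "val_eq (S / 2) 0" using val_eq_divide[OF S val_eq_2] by simp
      then obtain w where w: "w \<in> odd_denom" "S / 2 = 1 + 2 * w" by (rule val_eq_unit)
      define a where "a = \<alpha> div 4"
      have a: "\<alpha> = 4 * a + 3" unfolding a_def using \<alpha> by presburger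
      \<comment> \<open>Modulo 4 the square of the unit \<open>\<tau>\<close> is 1, while
        \<open>S - \<alpha>\<close> is \<open>2 - 3\<close>, that is, 3.\<close>
      have "1 + 4 * z = 2 * (1 + 2 * w) - (4 * of_int a + 3)"
        using \<tau> unfolding z(2) w(2)[symmetric] a by simp
      hence "2 = 4 * (w - z - of_int a)" by (simp add: algebra_simps)
      moreover have "w - z - of_int a \<in> odd_denom"
        using odd_denom_add[OF odd_denom_add[OF w(1) odd_denom_minus[OF z(1)]] odd_denom_minus[OF odd_denom_int]]
        by simp
      ultimately have "val_ge 2 2"
        using val_ge_mult[OF val_eq_imp_ge[OF val_eq_4]] by (metis add.right_neutral val_ge_0_iff)
      thus False using not_val_ge[OF val_eq_2] by simp
    qed
  qed
qed

section \<open>Diophantine obstructions and the duplication formula\<close>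

text \<open>\<open>\<alpha>\<close> is a unit and \<open>4 X\<close> is zero or of odd valuation, so
  they cannot cancel, and their difference has valuation at most 0. Its square dominates
  \<open>64 * \<beta>\<close>; thus the left valuation is even, the right one odd.\<close>

lemma no_solution_integral:
  fixes r v :: rat and \<alpha> \<beta> d :: int
  assumes \<alpha>: "odd \<alpha>" and d: "val_eq (of_int d) 1"
    and eq: "(of_int \<alpha> - 4 * (of_int d * r ^ 2)) ^ 2 - 64 * of_int \<beta> = 64 * of_int d * v ^ 2"
  shows False
proof -
  define X where "X = of_int d * r ^ 2"
  define Z where "Z = (of_int \<alpha> - 4 * X) ^ 2 - 64 * of_int \<beta>"
  have \<beta>: "val_ge (- (64 * of_int \<beta>)) 6"
    using val_ge_minus[OF val_ge_mult[OF val_eq_imp_ge[OF val_eq_64] val_ge_int[of \<beta>]]] by simp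
  have \<alpha>0: "val_eq (of_int \<alpha>) 0" using \<alpha> by (rule val_eq_odd)
  have "\<exists>j. even j \<and> val_eq Z j"
  proof (cases "val_ge (- (4 * X)) 1")
    case True
    have "val_eq (of_int \<alpha> - 4 * X) 0" using val_eq_add[OF \<alpha>0 True] by simp
    hence sq: "val_eq ((of_int \<alpha> - 4 * X) ^ 2) (int 2 * 0)" by (rule val_eq_power)
    have "val_eq Z 0" using val_eq_add[OF sq \<beta>] unfolding Z_def by simp
    thus ?thesis by (intro exI[of _ 0]) simp
  next
    case False
    hence "r \<noteq> 0" by (auto simp: X_def)
    then obtain k where "val_eq r k" by (rule val_eq_exists)
    hence "val_eq X (1 + int 2 * k)" unfolding X_def by (intro val_eq_mult d val_eq_power)
    hence X4: "val_eq (- (4 * X)) (2 + (1 + int 2 * k))"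
      by (intro val_eq_minus val_eq_mult val_eq_4)
    have "\<not> 1 \<le> 2 + (1 + int 2 * k)"
      using False val_ge_mono[OF val_eq_imp_ge[OF X4], of 1] by blast
    hence k': "3 + 2 * k < 0" by presburger
    have "val_eq (of_int \<alpha> - 4 * X) (3 + 2 * k)"
      using val_eq_add'[OF val_eq_imp_ge[OF \<alpha>0] X4] k' by simp
    hence "val_eq ((of_int \<alpha> - 4 * X) ^ 2) (int 2 * (3 + 2 * k))" by (rule val_eq_power)
    hence "val_eq Z (int 2 * (3 + 2 * k))"
      using val_eq_add[OF _ \<beta>, of "(of_int \<alpha> - 4 * X) ^ 2" "int 2 * (3 + 2 * k)"] k'
      unfolding Z_def by simp
    thus ?thesis by (intro exI[of _ "int 2 * (3 + 2 * k)"]) simp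
  qed
  then obtain j where j: "even j" "val_eq (64 * of_int d * v ^ 2) j"
    using eq unfolding Z_def X_def by auto
  hence "v \<noteq> 0" using val_eq_nonzero[OF j(2)] by auto
  then obtain k where "val_eq v k" by (rule val_eq_exists)
  hence "val_eq (64 * of_int d * v ^ 2) (6 + 1 + int 2 * k)"
    by (intro val_eq_mult val_eq_64 d val_eq_power)
  from val_eq_unique[OF j(2) this] j(1) show False by simp
qed

text \<open>With \<open>x = c / 4 + w\<close> the cubic \<open>4 x^3 + b2 x^2 + 2 b4 x + b6\<close> becomes
  \<open>w (4 w^2 + \<alpha> w + \<gamma> / 4)\<close>, where \<open>\<alpha> = b2 + 3 c\<close> and \<open>\<gamma> = 3 c^2 + 2 b2 c + 8 b4\<close>; intersecting with a
  line of slope \<open>r \<surd>d\<close> through \<open>w = 0\<close> leaves a quadratic equation whose discriminant is the left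
  hand side of \<open>eq\<close>.\<close>

lemma no_half_point:
  fixes b2 b4 b6 b8 c d :: int and r v :: rat
  assumes b8: "4 * b8 = b2 * b6 - b4 ^ 2"
    and disc: "odd (- (b2 ^ 2 * b8) - 8 * b4 ^ 3 - 27 * b6 ^ 2 + 9 * b2 * b4 * b6)"
    and b2: "b2 mod 4 = 0 \<or> b2 mod 4 = 1"
    and root: "c ^ 3 + b2 * c ^ 2 + 8 * b4 * c + 16 * b6 = 0"
    and d: "val_eq (of_int d) 1"
    and eq: "(of_int (b2 + 3 * c) - 4 * (of_int d * r ^ 2)) ^ 2
      - 4 * of_int (3 * c ^ 2 + 2 * b2 * c + 8 * b4) = 64 * of_int d * v ^ 2"
  shows False
proof -
  let ?D = "- (b2 ^ 2 * b8) - 8 * b4 ^ 3 - 27 * b6 ^ 2 + 9 * b2 * b4 * b6"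
  define \<alpha> where "\<alpha> = b2 + 3 * c"
  define \<gamma> where "\<gamma> = 3 * c ^ 2 + 2 * b2 * c + 8 * b4"
  \<comment> \<open>\<open>b6\<close> and \<open>b8\<close> are eliminated with the help of the
    root; the multiples 16 and 64 keep everything integral.\<close>
  define s where "s = - (c ^ 3 + b2 * c ^ 2 + 8 * b4 * c)"
  have s: "16 * b6 = s" using root by (simp add: s_def)
  have "64 * b8 = 16 * (4 * b8)" by simp
  also have "\<dots> = b2 * (16 * b6) - 16 * b4 ^ 2" unfolding b8 by (simp add: algebra_simps)
  finally have "64 * b8 = b2 * s - 16 * b4 ^ 2" unfolding s .
  moreover have "256 * ?D = - 4 * b2 ^ 2 * (64 * b8) - 2048 * b4 ^ 3 - 27 * (16 * b6) ^ 2
      + 144 * b2 * b4 * (16 * b6)"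
    by (simp add: algebra_simps power2_eq_square)
  ultimately have "256 * ?D = - 4 * b2 ^ 2 * (b2 * s - 16 * b4 ^ 2) - 2048 * b4 ^ 3 - 27 * s ^ 2
      + 144 * b2 * b4 * s" unfolding s by simp
  also have "\<dots> = \<gamma> ^ 2 * (\<alpha> ^ 2 - 4 * \<gamma>)"
    unfolding \<alpha>_def \<gamma>_def s_def by (simp add: algebra_simps power2_eq_square power3_eq_cube)
  \<comment> \<open>The discriminant of a cubic with root \<open>w = 0\<close>: the square of the
    value of the quadratic factor at 0 times the discriminant of that factor, with denominators
    cleared.\<close>
  finally have D: "256 * ?D = \<gamma> ^ 2 * (\<alpha> ^ 2 - 4 * \<gamma>)" .
  show False
  proof (cases "even c")
    case True
    then obtain e where e: "c = 2 * e" by (rule dvdE)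
    have e0: "2 * e ^ 3 + b2 * e ^ 2 + 4 * b4 * e + 4 * b6 = 0"
      using root unfolding e by (simp add: power_mult_distrib power3_eq_cube power2_eq_square)
    \<comment> \<open>Here \<open>b2\<close> modulo 4 rules out that 2 divides \<open>c\<close>
      exactly once, so \<open>c / 4\<close> is an integer.\<close>
    have "even e"
    proof (rule ccontr)
      assume e': "odd e"
      have "b2 * e ^ 2 = 2 * (- (e ^ 3) - 2 * b4 * e - 2 * b6)" using e0 by simp
      hence "even (b2 * e ^ 2)" by (rule dvdI)
      hence "even b2" using e' by simp
      hence "b2 mod 4 = 0" using b2 by presburger
      hence "b2 = 4 * (b2 div 4)" by presburger
      then obtain m where "b2 = 4 * m" by blast
      hence "e ^ 3 = 2 * (- m * e ^ 2 - b4 * e - b6)" using e0 by simp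
      hence "even (e ^ 3)" by (rule dvdI)
      thus False using e' by simp
    qed
    then obtain q where q: "e = 2 * q" by (rule dvdE)
    have root': "b6 = - (4 * q ^ 3 + b2 * q ^ 2 + 2 * b4 * q)"
      using e0 unfolding q by (simp add: power_mult_distrib power3_eq_cube power2_eq_square)
    \<comment> \<open>Half the derivative of \<open>4 x^3 + b2 x^2 + 2 b4 x + b6\<close> at the root
      \<open>q\<close>. It is even because of the relation defining \<open>b8\<close>.\<close>
    define \<beta>1 where "\<beta>1 = 6 * q ^ 2 + b2 * q + b4"
    have "\<beta>1 ^ 2 = - (4 * (3 * q ^ 4 + b2 * q ^ 3 + 3 * b4 * q ^ 2 + 3 * b6 * q)) - (b2 * b6 - b4 ^ 2)"
      unfolding root' \<beta>1_def
      by (simp add: algebra_simps power2_eq_square power3_eq_cube power4_eq_xxxx)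
    also have "\<dots> = 2 * (- 2 * (3 * q ^ 4 + b2 * q ^ 3 + 3 * b4 * q ^ 2 + 3 * b6 * q + b8))"
      unfolding b8[symmetric] by simp
    finally have "even (\<beta>1 ^ 2)" by (rule dvdI)
    hence "even \<beta>1" by simp
    then obtain \<beta> where \<beta>: "\<beta>1 = 2 * \<beta>" by (rule dvdE)
    have \<gamma>: "\<gamma> = 16 * \<beta>"
    proof -
      have "\<gamma> = 8 * \<beta>1" unfolding \<gamma>_def \<beta>1_def e q by (simp add: power2_eq_square)
      thus ?thesis using \<beta> by simp
    qed
    have "256 * ?D = 256 * (\<beta> ^ 2 * (\<alpha> ^ 2 - 64 * \<beta>))"
      unfolding D \<gamma> by (simp add: power2_eq_square)
    hence "?D = \<beta> ^ 2 * (\<alpha> ^ 2 - 64 * \<beta>)" by (simp only: mult_cancel_left) simp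
    hence "odd (\<beta> ^ 2 * (\<alpha> ^ 2 - 64 * \<beta>))" using disc by simp
    hence "odd \<alpha>" by simp
    moreover have "(of_int \<alpha> - 4 * (of_int d * r ^ 2)) ^ 2 - 64 * of_int \<beta> = 64 * of_int d * v ^ 2"
      using eq unfolding \<alpha>_def[symmetric] \<gamma>_def[symmetric] \<gamma> by simp
    ultimately show False using no_solution_integral[OF _ d] by blast
  next
    case False
    \<comment> \<open>The abscissa \<open>c / 4\<close> now has a pole at 2. Modulo 8 the root
      equation gives \<open>b2 = - c\<close>, so \<open>\<alpha>\<close> is even, and
      \<open>b2\<close> being 1 modulo 4 makes its half 3 modulo 4.\<close>
    have "c ^ 2 * (c + b2) = 8 * (- (b4 * c) - 2 * b6)"
      using root by (simp add: power2_eq_square power3_eq_cube algebra_simps)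
    hence "8 dvd c ^ 2 * (c + b2)" by (rule dvdI)
    moreover have "coprime (2 ^ 3) (c ^ 2)"
      using False by (simp only: coprime_power_left_iff coprime_power_right_iff) simp
    ultimately have "8 dvd c + b2" using coprime_dvd_mult_right_iff[of "2 ^ 3" "c ^ 2"] by simp
    then obtain m where m: "c + b2 = 8 * m" by (rule dvdE)
    hence b2': "b2 = 8 * m - c" by simp
    define \<alpha>' where "\<alpha>' = 4 * m + c"
    have "odd b2" using b2' False by simp
    hence "b2 mod 4 = 1" using b2 by presburger
    hence \<alpha>'3: "\<alpha>' mod 4 = 3" unfolding \<alpha>'_def b2' by presburger
    have \<alpha>: "\<alpha> = 2 * \<alpha>'" unfolding \<alpha>_def \<alpha>'_def b2' by simp
    have "odd \<gamma>" using False unfolding \<gamma>_def by simp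
    have "4 * (64 * ?D) = 4 * (\<gamma> ^ 2 * (\<alpha>' ^ 2 - \<gamma>))"
      using D unfolding \<alpha> by (simp add: power_mult_distrib algebra_simps)
    hence D': "64 * ?D = \<gamma> ^ 2 * (\<alpha>' ^ 2 - \<gamma>)" by (simp only: mult_cancel_left) simp
    have "64 dvd \<gamma> ^ 2 * (\<alpha>' ^ 2 - \<gamma>)" by (rule dvdI[OF D'[symmetric]])
    moreover have "coprime (2 ^ 6) (\<gamma> ^ 2)"
      using \<open>odd \<gamma>\<close> by (simp only: coprime_power_left_iff coprime_power_right_iff) simp
    ultimately have "64 dvd \<alpha>' ^ 2 - \<gamma>"
      using coprime_dvd_mult_right_iff[of "2 ^ 6" "\<gamma> ^ 2"] by simp
    then obtain h where h: "\<alpha>' ^ 2 - \<gamma> = 64 * h" by (rule dvdE)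
    have "64 * ?D = 64 * (\<gamma> ^ 2 * h)" unfolding D' h by simp
    hence "?D = \<gamma> ^ 2 * h" by (simp only: mult_cancel_left) simp
    hence "odd h" using disc by simp
    define X where "X = of_int d * r ^ 2"
    have \<gamma>': "\<gamma> = \<alpha>' ^ 2 - 64 * h" using h by simp
    have "16 * (X ^ 2 - of_int \<alpha>' * X + 16 * of_int h) = 16 * (4 * of_int d * v ^ 2)"
      using eq unfolding \<alpha>_def[symmetric] \<gamma>_def[symmetric] \<alpha> \<gamma>' X_def[symmetric]
      by (simp add: power2_eq_square algebra_simps)
    hence "X ^ 2 - of_int \<alpha>' * X + 16 * of_int h = 4 * of_int d * v ^ 2"
      by (simp only: mult_cancel_left) simp
    thus False using no_solution_kernel[OF \<alpha>'3 \<open>odd h\<close> d] unfolding X_def by blast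
  qed
qed

text \<open>The abscissa of \<open>2 (x, y)\<close> is \<open>dbl_num / dbl_den\<close>.\<close>

definition dbl_den :: "int \<Rightarrow> int \<Rightarrow> int \<Rightarrow> rat \<Rightarrow> rat" where
  "dbl_den B2 B4 B6 x = 4 * x ^ 3 + of_int B2 * x ^ 2 + 2 * of_int B4 * x + of_int B6"

definition dbl_num :: "int \<Rightarrow> int \<Rightarrow> int \<Rightarrow> rat \<Rightarrow> rat" where
  "dbl_num B4 B6 B8 x = x ^ 4 - of_int B4 * x ^ 2 - 2 * of_int B6 * x - of_int B8"

section \<open>Valuations under duplication\<close>

lemma dbl_num_val:
  assumes x: "val_eq x (- n)" and n: "n \<ge> 1"
  shows "val_eq (dbl_num B4 B6 B8 x) (- 4 * n)"
proof -
  have x4: "val_eq (x ^ 4) (- 4 * n)" using val_eq_power[OF x, of 4] by simp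
  have "val_ge (of_int B4 * x ^ 2) (0 + int 2 * (- n))"
    by (intro val_ge_mult val_ge_int val_ge_power val_eq_imp_ge x)
  moreover have "val_ge (of_int 2 * of_int B6 * x) (0 + 0 + - n)"
    by (intro val_ge_mult val_ge_int val_eq_imp_ge x)
  ultimately have "val_ge (- (of_int B4 * x ^ 2) - 2 * of_int B6 * x - of_int B8) (- 2 * n)"
    using n by (intro val_ge_diff val_ge_minus) (auto elim!: val_ge_mono intro: val_ge_mono[OF val_ge_int])
  from val_eq_add[OF x4 this] n show ?thesis unfolding dbl_num_def by (simp add: algebra_simps)
qed

lemma dbl_den_ge:
  assumes x: "val_eq x (- n)" and n: "n \<ge> 1"
  shows "val_ge (of_int B2 * x ^ 2 + 2 * of_int B4 * x + of_int B6) (- 2 * n)"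
proof -
  have "val_ge (of_int B2 * x ^ 2) (0 + int 2 * (- n))"
    by (intro val_ge_mult val_ge_int val_ge_power val_eq_imp_ge x)
  moreover have "val_ge (of_int 2 * of_int B4 * x) (0 + 0 + - n)"
    by (intro val_ge_mult val_ge_int val_eq_imp_ge x)
  ultimately show ?thesis
    using n by (intro val_ge_add) (auto elim!: val_ge_mono intro: val_ge_mono[OF val_ge_int])
qed

lemma dbl_den_cube:
  assumes x: "val_eq x (- n)"
  shows "val_eq (4 * x ^ 3) (2 - 3 * n)"
  using val_eq_mult[OF val_eq_4 val_eq_power[OF x, of 3]] by simp

text \<open>\<open>4 x^3\<close> dominates the denominator as soon as
  \<open>2 - 3 n < - 2 n\<close>, that is, for \<open>n \<ge> 3\<close>. For \<open>n = 1\<close> an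
  odd \<open>B2\<close> would produce the even valuation \<open>- 2\<close>, against
  \<open>G\<close>, and otherwise 4 divides \<open>B2\<close> and the cubic term still
  dominates.\<close>

lemma doubling_val_step:
  assumes x: "val_eq x (- n)" and n: "n \<ge> 1" "odd n"
    and b2: "B2 mod 4 = 0 \<or> B2 mod 4 = 1"
    and G: "\<And>g. val_eq (dbl_den B2 B4 B6 x) g \<Longrightarrow> odd g"
  shows "dbl_den B2 B4 B6 x \<noteq> 0"
    and "val_eq (dbl_num B4 B6 B8 x / dbl_den B2 B4 B6 x) (- (n + 2))"
proof -
  have den: "val_eq (dbl_den B2 B4 B6 x) (2 - 3 * n)"
  proof (cases "n = 1")
    case False
    hence "n \<ge> 3" using n by presburger
    thus ?thesis using val_eq_add[OF dbl_den_cube[OF x] dbl_den_ge[OF x n(1)], of B2 B4 B6]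
      unfolding dbl_den_def by (simp add: add.assoc)
  next
    case True
    have l1: "val_ge (2 * of_int B4 * x) 0"
      using val_ge_mult[OF val_ge_mult[OF val_eq_imp_ge[OF val_eq_2] val_ge_int] val_eq_imp_ge[OF x], of B4]
        True by simp
    have x2: "val_eq (x ^ 2) (- 2)" using val_eq_power[OF x, of 2] True by simp
    have x3: "val_eq (4 * x ^ 3) (- 1)" using dbl_den_cube[OF x] True by simp
    have l3: "val_ge (2 * of_int B4 * x + of_int B6) 0" by (intro val_ge_add l1 val_ge_int)
    from b2 show ?thesis
    proof
      assume "B2 mod 4 = 1"
      hence "odd B2" by presburger
      hence "val_eq (of_int B2 * x ^ 2) (0 + - 2)" by (intro val_eq_mult val_eq_odd x2)
      moreover have "val_ge (4 * x ^ 3 + (2 * of_int B4 * x + of_int B6)) (- 1)"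
        by (intro val_ge_add val_eq_imp_ge[OF x3] val_ge_mono[OF l3]) simp
      ultimately have "val_eq (of_int B2 * x ^ 2 + (4 * x ^ 3 + (2 * of_int B4 * x + of_int B6))) (0 + - 2)"
        by (rule val_eq_add) simp
      hence "val_eq (dbl_den B2 B4 B6 x) (- 2)" unfolding dbl_den_def by (simp add: algebra_simps)
      from G[OF this] show ?thesis by simp
    next
      assume "B2 mod 4 = 0"
      hence "B2 = 4 * (B2 div 4)" by presburger
      then obtain m where m: "B2 = 4 * m" by blast
      have "val_ge (4 * of_int m * x ^ 2) (2 + 0 + - 2)"
        by (intro val_ge_mult val_eq_imp_ge[OF val_eq_4] val_ge_int val_eq_imp_ge[OF x2])
      hence "val_ge (of_int B2 * x ^ 2 + (2 * of_int B4 * x + of_int B6)) 0"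
        unfolding m using val_ge_add[OF _ l3] by simp
      from val_eq_add[OF x3 this] show ?thesis unfolding dbl_den_def using True
        by (simp add: algebra_simps)
    qed
  qed
  show "dbl_den B2 B4 B6 x \<noteq> 0" using den by (rule val_eq_nonzero)
  show "val_eq (dbl_num B4 B6 B8 x / dbl_den B2 B4 B6 x) (- (n + 2))"
    using val_eq_divide[OF dbl_num_val[OF x n(1), of B4 B6 B8] den] by (simp add: algebra_simps)
qed

text \<open>A Bezout identity with integral cofactors: numerator and denominator of the duplication
  formula have no common zero modulo a prime not dividing the discriminant.\<close>

lemma doubling_resultant:
  fixes x B2 B4 B6 B8 :: rat
  assumes "4 * B8 = B2 * B6 - B4 ^ 2"
  shows "(12 * x ^ 3 - B2 * x ^ 2 - 10 * B4 * x + (B2 * B4 - 27 * B6)) *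
      (4 * x ^ 3 + B2 * x ^ 2 + 2 * B4 * x + B6)
    - (48 * x ^ 2 + 8 * B2 * x + (32 * B4 - B2 ^ 2)) * (x ^ 4 - B4 * x ^ 2 - 2 * B6 * x - B8) =
    - (B2 ^ 2 * B8) - 8 * B4 ^ 3 - 27 * B6 ^ 2 + 9 * B2 * B4 * B6"
proof -
  have b8: "B8 = (B2 * B6 - B4 ^ 2) / 4" using assms by simp
  show ?thesis unfolding b8
    by (simp add: field_simps power2_eq_square power3_eq_cube power4_eq_xxxx)
qed

text \<open>For 2-integral \<open>x\<close> the odd \<open>g\<close> is at least 1, and the Bezout
  identity makes the numerator a unit: the quotient has valuation \<open>- g\<close>. For a pole of
  order \<open>n\<close> it has valuation \<open>- (4 * n + g)\<close> with
  \<open>g \<ge> - 3 * n\<close>.\<close>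

lemma doubling_val_start:
  fixes x :: rat
  assumes b8: "4 * B8 = B2 * B6 - B4 ^ 2"
    and disc: "odd (- (B2 ^ 2 * B8) - 8 * B4 ^ 3 - 27 * B6 ^ 2 + 9 * B2 * B4 * B6)"
    and G: "val_eq (dbl_den B2 B4 B6 x) g" "odd g"
  obtains m where "m \<ge> 1" "odd m" "val_eq (dbl_num B4 B6 B8 x / dbl_den B2 B4 B6 x) (- m)"
proof (cases "x \<in> odd_denom")
  case True
  let ?D = "- (B2 ^ 2 * B8) - 8 * B4 ^ 3 - 27 * B6 ^ 2 + 9 * B2 * B4 * B6"
  have x: "val_ge x 0" using True by (simp add: val_ge_0_iff)
  have int: "val_ge (of_int i * y) 0" if "val_ge y 0" for i y
    using val_ge_mult[OF val_ge_int that] by simp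
  have pow: "val_ge (x ^ n) 0" for n using val_ge_power[OF x, of n] by simp
  have "val_ge (of_int 4 * x ^ 3 + of_int B2 * x ^ 2 + of_int 2 * (of_int B4 * x) + of_int B6) 0"
    by (intro val_ge_add int pow x val_ge_int)
  hence "val_ge (dbl_den B2 B4 B6 x) 0" by (simp add: dbl_den_def algebra_simps)
  hence "g \<ge> 0" by (rule val_eq_ge_le[OF G(1)])
  hence g: "g \<ge> 1" using G(2) by presburger
  have "val_ge (x ^ 4 - of_int B4 * x ^ 2 - of_int 2 * (of_int B6 * x) - of_int B8) 0"
    by (intro val_ge_diff int pow x val_ge_int)
  hence num: "val_ge (dbl_num B4 B6 B8 x) 0" by (simp add: dbl_num_def algebra_simps)
  define U where "U = 12 * x ^ 3 - of_int B2 * x ^ 2 - 10 * of_int B4 * x + (of_int B2 * of_int B4 - 27 * of_int B6)"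
  define V where "V = 48 * x ^ 2 + 8 * of_int B2 * x + (32 * of_int B4 - of_int B2 ^ 2)"
  have "val_ge (of_int 12 * x ^ 3 - of_int B2 * x ^ 2 - of_int 10 * (of_int B4 * x) + of_int (B2 * B4 - 27 * B6)) 0"
    by (intro val_ge_add val_ge_diff int pow x val_ge_int)
  hence U: "val_ge U 0" by (simp add: U_def algebra_simps)
  have "val_ge (of_int 48 * x ^ 2 + of_int 8 * (of_int B2 * x) + of_int (32 * B4 - B2 ^ 2)) 0"
    by (intro val_ge_add int pow x val_ge_int)
  hence V: "val_ge V 0" by (simp add: V_def algebra_simps)
  have res: "U * dbl_den B2 B4 B6 x - V * dbl_num B4 B6 B8 x = of_int ?D"
  proof -
    have "4 * of_int B8 = (of_int B2 * of_int B6 - of_int B4 ^ 2 :: rat)"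
      using arg_cong[OF b8, of "of_int :: int \<Rightarrow> rat"] by simp
    from doubling_resultant[OF this, of x] show ?thesis
      unfolding U_def V_def dbl_den_def dbl_num_def by simp
  qed
  have "\<not> val_ge (dbl_num B4 B6 B8 x) 1"
  proof
    assume "val_ge (dbl_num B4 B6 B8 x) 1"
    hence "val_ge (V * dbl_num B4 B6 B8 x) (0 + 1)" by (intro val_ge_mult V)
    moreover have "val_ge (U * dbl_den B2 B4 B6 x) (0 + 1)"
      by (intro val_ge_mult U val_ge_mono[OF val_eq_imp_ge[OF G(1)] g])
    ultimately have "val_ge (of_int ?D) 1" unfolding res[symmetric] using val_ge_diff by simp
    thus False using not_val_ge[OF val_eq_odd[OF disc], of 1] by simp
  qed
  moreover from this have "dbl_num B4 B6 B8 x \<noteq> 0" by auto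
  then obtain k where k: "val_eq (dbl_num B4 B6 B8 x) k" by (rule val_eq_exists)
  ultimately have "k < 1" using val_ge_mono[OF val_eq_imp_ge[OF k], of 1] by linarith
  moreover have "k \<ge> 0" using val_eq_ge_le[OF k num] .
  ultimately have "k = 0" by simp
  with val_eq_divide[OF k G(1)] show ?thesis using that[of g] g G(2) by simp
next
  case False
  hence "x \<noteq> 0" using odd_denom_int[of 0] by auto
  then obtain k where k: "val_eq x k" by (rule val_eq_exists)
  have "\<not> k \<ge> 0" using False val_ge_mono[OF val_eq_imp_ge[OF k], of 0] by (auto simp: val_ge_0_iff)
  define n where "n = - k"
  have n: "n \<ge> 1" "val_eq x (- n)" using k \<open>\<not> k \<ge> 0\<close> by (auto simp: n_def)
  have "val_ge (4 * x ^ 3 + (of_int B2 * x ^ 2 + 2 * of_int B4 * x + of_int B6)) (- 3 * n)"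
    using n(1) by (intro val_ge_add val_ge_mono[OF val_eq_imp_ge[OF dbl_den_cube[OF n(2)]]]
        val_ge_mono[OF dbl_den_ge[OF n(2,1)]]) auto
  hence "val_ge (dbl_den B2 B4 B6 x) (- 3 * n)" unfolding dbl_den_def by (simp add: add.assoc)
  hence "g \<ge> - 3 * n" by (rule val_eq_ge_le[OF G(1)])
  hence "4 * n + g \<ge> 1" using n(1) by simp
  moreover have "val_eq (dbl_num B4 B6 B8 x / dbl_den B2 B4 B6 x) (- (4 * n + g))"
  proof -
    have "- 4 * n - g = - (4 * n + g)" by simp
    thus ?thesis using val_eq_divide[OF dbl_num_val[OF n(2,1), of B4 B6 B8] G(1)] by metis
  qed
  ultimately show ?thesis using that[of "4 * n + g"] G(2) by simp
qed

section \<open>Torsion points over a ramified quadratic field\<close>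

locale quad_ext =
  fixes s :: complex and d :: int
  assumes s_sq: "s ^ 2 = of_int d" and d: "val_eq (of_int d) 1"
begin

lemma s_sq': "s * s = of_int d"
  using s_sq by (simp add: power2_eq_square)

text \<open>Squares have even valuation. This makes 1 and \<open>s\<close> independent over the
  rationals.\<close>

lemma not_square: "(q :: rat) ^ 2 \<noteq> of_int d"
proof
  assume q: "q ^ 2 = of_int d"
  hence "q \<noteq> 0" using val_eq_nonzero[OF d] by auto
  then obtain k where "val_eq q k" by (rule val_eq_exists)
  hence "val_eq (q ^ 2) (int 2 * k)" by (rule val_eq_power)
  from val_eq_unique[OF this] d q have "int 2 * k = 1" by simp
  thus False by presburger
qed

lemma rep_zero:
  assumes "of_rat a + of_rat b * s = 0"
  shows "a = 0 \<and> b = 0"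
proof (cases "b = 0")
  case False
  have "of_rat b * s = - of_rat a" using assms by (simp add: eq_neg_iff_add_eq_0 add.commute)
  hence "(of_rat b * s) ^ 2 = (of_rat a) ^ 2" by simp
  hence "of_rat (b ^ 2 * of_int d) = (of_rat (a ^ 2) :: complex)"
    by (simp add: power_mult_distrib s_sq of_rat_mult of_rat_power)
  hence "b ^ 2 * of_int d = a ^ 2" by (simp only: of_rat_eq_iff)
  hence "(a / b) ^ 2 = of_int d" using False by (simp add: power_divide field_simps)
  thus ?thesis using not_square by blast
qed (use assms in simp)

lemma rep_unique:
  assumes "of_rat a + of_rat b * s = of_rat a' + of_rat b' * s"
  shows "a = a' \<and> b = b'"
proof -
  have "of_rat (a - a') + of_rat (b - b') * s = 0"
    using assms by (simp add: of_rat_diff algebra_simps)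
  from rep_zero[OF this] show ?thesis by simp
qed

definition K :: "complex set" where "K = {of_rat a + of_rat b * s | a b. True}"

text \<open>Coordinates are unique on \<open>K\<close>; elsewhere the description denotes nothing in
  particular, so all rules assume membership in \<open>K\<close>.\<close>

definition cj :: "complex \<Rightarrow> complex" where
  "cj z = (THE w. \<exists>a b. z = of_rat a + of_rat b * s \<and> w = of_rat a - of_rat b * s)"

lemma cj_rep: "cj (of_rat a + of_rat b * s) = of_rat a - of_rat b * s"
  unfolding cj_def
proof (rule the_equality)
  fix w assume "\<exists>a' b'. of_rat a + of_rat b * s = of_rat a' + of_rat b' * s \<and> w = of_rat a' - of_rat b' * s"
  then obtain a' b' where r: "of_rat a + of_rat b * s = of_rat a' + of_rat b' * s"
    "w = of_rat a' - of_rat b' * s" by blast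
  from rep_unique[OF r(1)] r(2) show "w = of_rat a - of_rat b * s" by simp
qed blast

lemma KE:
  assumes "z \<in> K"
  obtains a b where "z = of_rat a + of_rat b * s"
  using assms unfolding K_def by blast

lemma KI: "of_rat a + of_rat b * s \<in> K"
  unfolding K_def by blast

lemma K_add: "z \<in> K \<Longrightarrow> w \<in> K \<Longrightarrow> z + w \<in> K \<and> cj (z + w) = cj z + cj w"
proof (elim KE)
  fix a b a' b' assume z: "z = of_rat a + of_rat b * s" "w = of_rat a' + of_rat b' * s"
  have zw: "z + w = of_rat (a + a') + of_rat (b + b') * s"
    unfolding z by (simp add: of_rat_add algebra_simps)
  have "cj (z + w) = of_rat (a + a') - of_rat (b + b') * s"
    unfolding zw by (rule cj_rep)
  also have "\<dots> = cj z + cj w"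
    unfolding z cj_rep by (simp add: of_rat_add algebra_simps)
  finally show ?thesis using zw KI by metis
qed

lemma K_mult: "z \<in> K \<Longrightarrow> w \<in> K \<Longrightarrow> z * w \<in> K \<and> cj (z * w) = cj z * cj w"
proof (elim KE)
  fix a b a' b' assume z: "z = of_rat a + of_rat b * s" "w = of_rat a' + of_rat b' * s"
  have zw: "z * w = of_rat (a * a' + b * b' * of_int d) + of_rat (a * b' + b * a') * s"
    unfolding z by (simp add: of_rat_add of_rat_mult algebra_simps s_sq')
  have "cj (z * w) = of_rat (a * a' + b * b' * of_int d) - of_rat (a * b' + b * a') * s"
    unfolding zw by (rule cj_rep)
  also have "\<dots> = cj z * cj w"
    unfolding z cj_rep by (simp add: of_rat_add of_rat_mult algebra_simps s_sq')
  finally show ?thesis using zw KI by metis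
qed

lemma K_rat [simp]: "of_rat a \<in> K" "cj (of_rat a) = of_rat a"
  using KI[of a 0] cj_rep[of a 0] by simp_all

lemma K_minus: "z \<in> K \<Longrightarrow> - z \<in> K \<and> cj (- z) = - cj z"
  using K_mult[of "of_rat (- 1)" z] by (simp only: K_rat) (simp add: of_rat_minus)

lemma K_diff: "z \<in> K \<Longrightarrow> w \<in> K \<Longrightarrow> z - w \<in> K \<and> cj (z - w) = cj z - cj w"
  using K_add[of z "- w"] K_minus[of w] by simp

lemma K_power: "z \<in> K \<Longrightarrow> z ^ n \<in> K \<and> cj (z ^ n) = cj z ^ n"
proof (induction n)
  case 0
  show ?case using K_rat[of 1] by simp
next
  case (Suc n)
  thus ?case using K_mult[of z "z ^ n"] by simp
qed

lemma cj_K: "z \<in> K \<Longrightarrow> cj z \<in> K"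
proof (elim KE)
  fix a b assume z: "z = of_rat a + of_rat b * s"
  show "cj z \<in> K" using KI[of a "- b"] unfolding z cj_rep by (simp add: of_rat_minus)
qed

lemma cj_inj: "z \<in> K \<Longrightarrow> w \<in> K \<Longrightarrow> cj z = cj w \<longleftrightarrow> z = w"
proof (elim KE)
  fix a b a' b' assume z: "z = of_rat a + of_rat b * s" "w = of_rat a' + of_rat b' * s"
  have "a = a' \<and> b = b'" if "cj z = cj w"
    using rep_unique[of a "- b" a' "- b'"] that unfolding z cj_rep by (simp add: of_rat_minus)
  thus "cj z = cj w \<longleftrightarrow> z = w" using z by auto
qed

lemma K_inverse:
  assumes "z \<in> K"
  shows "inverse z \<in> K \<and> cj (inverse z) = inverse (cj z)"
proof (cases "z = 0")
  case True
  thus ?thesis using K_rat[of 0] by simp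
next
  case False
  obtain a b where z: "z = of_rat a + of_rat b * s" using assms by (rule KE)
  have cz: "cj z \<noteq> 0" using False cj_inj[of z 0] assms K_rat[of 0] by simp
  define n where "n = a ^ 2 - b ^ 2 * of_int d"
  have n: "z * cj z = of_rat n" unfolding z cj_rep n_def
    by (simp add: of_rat_diff of_rat_mult of_rat_power power2_eq_square algebra_simps s_sq')
  hence n0: "n \<noteq> 0" using False cz by auto
  have "z * (cj z * of_rat (inverse n)) = of_rat (n * inverse n)"
    unfolding of_rat_mult n[symmetric] by (simp only: mult.assoc)
  hence iz: "inverse z = cj z * of_rat (inverse n)"
    using n0 by (intro inverse_unique) simp
  have K: "inverse z \<in> K" unfolding iz using K_mult cj_K[OF assms] K_rat by blast
  have "cj z * cj (inverse z) = cj (z * inverse z)" using K_mult[OF assms K] by simp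
  also have "\<dots> = 1" using False K_rat[of 1] by simp
  finally have "cj (inverse z) = inverse (cj z)" by (metis inverse_unique)
  thus ?thesis using K by blast
qed

lemma K_divide: "z \<in> K \<Longrightarrow> w \<in> K \<Longrightarrow> z / w \<in> K \<and> cj (z / w) = cj z / cj w"
  using K_mult[of z "inverse w"] K_inverse[of w] by (simp add: divide_inverse)

lemma cj_fixed:
  assumes "z \<in> K" "cj z = z"
  obtains a where "z = of_rat a"
proof -
  obtain a b where z: "z = of_rat a + of_rat b * s" using assms(1) by (rule KE)
  have "b = 0" using assms(2) rep_unique[of a "- b" a b] unfolding z cj_rep
    by (simp add: of_rat_minus)
  thus ?thesis using that[of a] z by simp
qed

lemma cj_negated:
  assumes "z \<in> K" "cj z = - z"
  obtains b where "z = of_rat b * s"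
proof -
  obtain a b where z: "z = of_rat a + of_rat b * s" using assms(1) by (rule KE)
  have "a = 0" using assms(2) rep_unique[of a "- b" "- a" "- b"] unfolding z cj_rep
    by (simp add: of_rat_minus)
  thus ?thesis using that[of b] z by simp
qed

end

text \<open>The integers are the \<open>b2\<close>, \<open>b4\<close>, \<open>b6\<close>,
  \<open>b8\<close> of an integral equation; the last assumption comes from
  \<open>b2 = a1^2 + 4 a2\<close>.\<close>

locale good_quad = quad_ext s d for s :: complex and d :: int +
  fixes B2 B4 B6 B8 :: int
  assumes B8: "4 * B8 = B2 * B6 - B4 ^ 2"
    and disc: "odd (- (B2 ^ 2 * B8) - 8 * B4 ^ 3 - 27 * B6 ^ 2 + 9 * B2 * B4 * B6)"
    and B2: "B2 mod 4 = 0 \<or> B2 mod 4 = 1"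

text \<open>At a double root \<open>x\<close> both \<open>b4\<close> and \<open>b6\<close> are
  polynomials in \<open>b2\<close> and \<open>x\<close>, and with them the discriminant vanishes
  identically.\<close>

lemma separable_of_disc:
  fixes b2 b4 b6 b8 x :: "'a::field_char_0"
  assumes b8: "4 * b8 = b2 * b6 - b4 ^ 2"
    and D: "- (b2 ^ 2 * b8) - 8 * b4 ^ 3 - 27 * b6 ^ 2 + 9 * b2 * b4 * b6 \<noteq> 0"
    and f: "x ^ 3 + b2 / 4 * x ^ 2 + b4 / 2 * x + b6 / 4 = 0"
  shows "3 * x ^ 2 + 2 * (b2 / 4) * x + b4 / 2 \<noteq> 0"
proof
  assume f': "3 * x ^ 2 + 2 * (b2 / 4) * x + b4 / 2 = 0"
  have b4: "b4 = - 6 * x ^ 2 - b2 * x"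
  proof -
    have "b4 = 2 * (3 * x ^ 2 + 2 * (b2 / 4) * x + b4 / 2) - 6 * x ^ 2 - b2 * x"
      by (simp add: field_simps)
    thus ?thesis unfolding f' by simp
  qed
  have b6: "b6 = 8 * x ^ 3 + b2 * x ^ 2"
  proof -
    have "b6 = 4 * (x ^ 3 + b2 / 4 * x ^ 2 + b4 / 2 * x + b6 / 4) - 4 * x ^ 3 - b2 * x ^ 2 - 2 * b4 * x"
      by (simp add: field_simps)
    thus ?thesis unfolding f unfolding b4
      by (simp add: algebra_simps power2_eq_square power3_eq_cube)
  qed
  have "4 * (- (b2 ^ 2 * b8) - 8 * b4 ^ 3 - 27 * b6 ^ 2 + 9 * b2 * b4 * b6) =
    - (b2 ^ 2 * (4 * b8)) - 32 * b4 ^ 3 - 108 * b6 ^ 2 + 36 * b2 * b4 * b6"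
    by (simp add: algebra_simps)
  also have "\<dots> = 0" unfolding b8 b6 b4 by (simp add: algebra_simps power2_eq_square power3_eq_cube)
  finally show False using D by (simp only: mult_eq_0_iff) simp
qed

sublocale good_quad \<subseteq> cubic_curve "of_int B2 / 4 :: complex" "of_int B4 / 2" "of_int B6 / 4"
proof
  fix x :: complex
  assume f: "x ^ 3 + of_int B2 / 4 * x ^ 2 + of_int B4 / 2 * x + of_int B6 / 4 = 0"
  have b8: "4 * of_int B8 = (of_int B2 * of_int B6 - of_int B4 ^ 2 :: complex)"
    using arg_cong[OF B8, of "of_int :: int \<Rightarrow> complex"] by simp
  have "- (B2 ^ 2 * B8) - 8 * B4 ^ 3 - 27 * B6 ^ 2 + 9 * B2 * B4 * B6 \<noteq> 0"
    using disc by (metis even_zero)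
  hence "of_int (- (B2 ^ 2 * B8) - 8 * B4 ^ 3 - 27 * B6 ^ 2 + 9 * B2 * B4 * B6) \<noteq> (0 :: complex)"
    by (simp only: of_int_eq_0_iff) simp
  hence "- (of_int B2 ^ 2 * of_int B8) - 8 * of_int B4 ^ 3 - 27 * of_int B6 ^ 2
      + 9 * of_int B2 * of_int B4 * of_int B6 \<noteq> (0 :: complex)" by simp
  from separable_of_disc[OF b8 this f]
  show "3 * x ^ 2 + 2 * (of_int B2 / 4) * x + of_int B4 / 2 \<noteq> 0" .
qed

context good_quad
begin

lemma curve_rat:
  fixes x y :: rat
  assumes "on_curve E (Point (of_rat x) w)" "w ^ 2 = of_rat y"
  shows "4 * y = dbl_den B2 B4 B6 x"
proof -
  have "of_rat (4 * y) = 4 * w ^ 2" unfolding assms(2) by (simp add: of_rat_mult)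
  also have "\<dots> = of_rat (dbl_den B2 B4 B6 x)"
    using assms(1) by (simp add: dbl_den_def of_rat_add of_rat_mult of_rat_power)
  finally show ?thesis by (simp only: of_rat_eq_iff)
qed

text \<open>The tangent slope is rational divided by \<open>s\<close>, hence a rational multiple
  \<open>M * s\<close>, and its square is rational. Doubling therefore stays among the points that
  conjugation negates.\<close>

lemma double_anti:
  fixes x t :: rat
  assumes P: "on_curve E (Point (of_rat x) (of_rat t * s))" and t: "t \<noteq> 0"
  obtains t' where "ec_add E (Point (of_rat x) (of_rat t * s)) (Point (of_rat x) (of_rat t * s)) =
    Point (of_rat (dbl_num B4 B6 B8 x / dbl_den B2 B4 B6 x)) (of_rat t' * s)"
proof -
  have d0: "of_int d \<noteq> (0 :: rat)" using val_eq_nonzero[OF d] .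
  hence d0': "of_int d \<noteq> (0 :: complex)" by simp
  hence s0: "s \<noteq> 0" using s_sq by auto
  define N where "N = 3 * x ^ 2 + of_int B2 / 2 * x + of_int B4 / 2"
  define M where "M = N / (2 * t * of_int d)"
  define m where "m = of_rat M * s"
  define x3 where "x3 = M ^ 2 * of_int d - of_int B2 / 4 - 2 * x"
  have "(of_rat t * s) ^ 2 = of_rat (t ^ 2 * of_int d)"
    by (simp add: power_mult_distrib s_sq of_rat_mult of_rat_power)
  from curve_rat[OF P this] have den: "dbl_den B2 B4 B6 x = 4 * t ^ 2 * of_int d" by simp
  have m: "m = (if of_rat x = (of_rat x :: complex)
    then (3 * of_rat x ^ 2 + 2 * (of_int B2 / 4) * of_rat x + of_int B4 / 2) / (2 * (of_rat t * s))
    else (of_rat t * s - of_rat t * s) / (of_rat x - of_rat x))"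
  proof -
    have "of_rat N = 3 * of_rat x ^ 2 + 2 * (of_int B2 / 4) * of_rat x + (of_int B4 / 2 :: complex)"
      unfolding N_def by (simp add: of_rat_add of_rat_mult of_rat_power of_rat_divide)
    moreover have "m * (2 * (of_rat t * s)) = of_rat N"
    proof -
      have "m * (2 * (of_rat t * s)) = 2 * of_rat M * of_rat t * (s * s)"
        unfolding m_def by (simp add: mult_ac)
      also have "\<dots> = of_rat (2 * M * t * of_int d)" unfolding s_sq' by (simp add: of_rat_mult)
      also have "2 * M * t * of_int d = N" using d0 t by (simp add: M_def)
      finally show ?thesis .
    qed
    ultimately show ?thesis using s0 t by (simp add: eq_divide_eq)
  qed
  have m2: "m ^ 2 - of_int B2 / 4 - of_rat x - of_rat x = of_rat x3"
    unfolding m_def x3_def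
    by (simp add: power_mult_distrib s_sq of_rat_diff of_rat_mult of_rat_power of_rat_divide)
  have x3: "x3 = dbl_num B4 B6 B8 x / dbl_den B2 B4 B6 x"
  proof -
    have den0: "dbl_den B2 B4 B6 x \<noteq> 0" unfolding den using t d0 by simp
    have "M ^ 2 * of_int d * dbl_den B2 B4 B6 x = N ^ 2"
      unfolding den M_def using t d0 by (simp add: power_divide power2_eq_square)
    hence "x3 * dbl_den B2 B4 B6 x = N ^ 2 - (of_int B2 / 4 + 2 * x) * dbl_den B2 B4 B6 x"
      unfolding x3_def by (simp add: algebra_simps)
    also have "\<dots> = dbl_num B4 B6 B8 x"
    proof -
      have b8: "of_int B8 = ((of_int B2 * of_int B6 - of_int B4 ^ 2) / 4 :: rat)"
        using arg_cong[OF B8, of "of_int :: int \<Rightarrow> rat"] by simp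
      show ?thesis unfolding dbl_num_def dbl_den_def N_def b8
        by (simp add: field_simps power2_eq_square power3_eq_cube power4_eq_xxxx)
    qed
    finally show ?thesis using den0 by (simp add: eq_divide_eq)
  qed
  have nopp: "\<not> (of_rat x = (of_rat x :: complex) \<and> of_rat t * s + of_rat t * s = 0)"
    using s0 t by simp
  have "- m * of_rat x3 - (of_rat t * s - m * of_rat x) = of_rat (- M * x3 - t + M * x) * s"
    unfolding m_def by (simp add: of_rat_add of_rat_diff of_rat_mult of_rat_minus algebra_simps)
  with ec_add_slope[OF nopp m] that[of "- M * x3 - t + M * x"] show ?thesis
    unfolding m2 x3 by simp
qed

text \<open>\<open>dbl_den\<close> is four times the square of the ordinate, here
  \<open>4 t^2 d\<close>.\<close>

lemma anti_val:
  fixes x t :: rat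
  assumes P: "on_curve E (Point (of_rat x) (of_rat t * s))" and g: "val_eq (dbl_den B2 B4 B6 x) g"
  shows "odd g \<and> t \<noteq> 0"
proof -
  have "(of_rat t * s) ^ 2 = of_rat (t ^ 2 * of_int d)"
    by (simp add: power_mult_distrib s_sq of_rat_mult of_rat_power)
  from curve_rat[OF P this] have den: "dbl_den B2 B4 B6 x = 4 * (t ^ 2 * of_int d)" by simp
  have t: "t \<noteq> 0" using val_eq_nonzero[OF g] unfolding den by auto
  then obtain k where "val_eq t k" by (rule val_eq_exists)
  hence "val_eq (dbl_den B2 B4 B6 x) (2 + (int 2 * k + 1))"
    unfolding den by (intro val_eq_mult val_eq_4 val_eq_power d)
  from val_eq_unique[OF g this] t show ?thesis by simp
qed

lemma anti_orbit:
  fixes x t :: rat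
  assumes P: "on_curve E (Point (of_rat x) (of_rat t * s))" and n: "n \<ge> 1" "odd n" "val_eq x (- n)"
  shows "\<exists>x' t'. ec_mult E (2 ^ k) (Point (of_rat x) (of_rat t * s)) = Point (of_rat x') (of_rat t' * s)
    \<and> val_eq x' (- (n + 2 * int k))"
proof (induction k)
  case 0
  show ?case using n(3) by (auto simp: ec_mult_Suc simp del: ec_add.simps(3))
next
  case (Suc k)
  let ?P = "Point (of_rat x) (of_rat t * s)"
  obtain x' t' where k: "ec_mult E (2 ^ k) ?P = Point (of_rat x') (of_rat t' * s)"
    "val_eq x' (- (n + 2 * int k))" using Suc by blast
  have P': "on_curve E (Point (of_rat x') (of_rat t' * s))"
    using ec_mult_closed[OF P, of "2 ^ k"] unfolding k(1) .
  have n': "n + 2 * int k \<ge> 1" "odd (n + 2 * int k)" using n by auto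
  have G: "odd g" if "val_eq (dbl_den B2 B4 B6 x') g" for g using anti_val[OF P' that] by blast
  have st: "dbl_den B2 B4 B6 x' \<noteq> 0"
    "val_eq (dbl_num B4 B6 B8 x' / dbl_den B2 B4 B6 x') (- (n + 2 * int k + 2))"
    by (rule doubling_val_step[OF k(2) n' B2 G], assumption)+
  from st(1) obtain g where "val_eq (dbl_den B2 B4 B6 x') g" by (rule val_eq_exists)
  hence t': "t' \<noteq> 0" using anti_val[OF P'] by blast
  have "ec_mult E (2 ^ Suc k) ?P = ec_add E (ec_mult E (2 ^ k) ?P) (ec_mult E (2 ^ k) ?P)"
    using ec_mult_add[OF P, of "2 ^ k" "2 ^ k"] by (simp only: power_Suc mult_2)
  with k(1) double_anti[OF P' t'] obtain t'' where
    "ec_mult E (2 ^ Suc k) ?P = Point (of_rat (dbl_num B4 B6 B8 x' / dbl_den B2 B4 B6 x')) (of_rat t'' * s)"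
    by metis
  moreover have "n + 2 * int k + 2 = n + 2 * int (Suc k)" by simp
  ultimately show ?case using st(2) by metis
qed

lemma no_anti_torsion:
  fixes x t :: rat
  assumes P: "on_curve E (Point (of_rat x) (of_rat t * s))" and t: "t \<noteq> 0"
    and tors: "n > 0" "ec_mult E n (Point (of_rat x) (of_rat t * s)) = Infinity"
  shows False
proof -
  let ?P = "Point (of_rat x) (of_rat t * s)"
  have "(of_rat t * s) ^ 2 = of_rat (t ^ 2 * of_int d)"
    by (simp add: power_mult_distrib s_sq of_rat_mult of_rat_power)
  from curve_rat[OF P this] have den: "dbl_den B2 B4 B6 x = 4 * (t ^ 2 * of_int d)" by simp
  have "dbl_den B2 B4 B6 x \<noteq> 0" unfolding den using t val_eq_nonzero[OF d] by simp
  then obtain g where g: "val_eq (dbl_den B2 B4 B6 x) g" by (rule val_eq_exists)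
  hence "odd g" using anti_val[OF P] by blast
  from doubling_val_start[OF B8 disc g this] obtain m where
    m: "m \<ge> 1" "odd m" "val_eq (dbl_num B4 B6 B8 x / dbl_den B2 B4 B6 x) (- m)" .
  \<comment> \<open>The abscissa of the given point may be integral; its double is the first one
    known to have a pole of odd order, and each further doubling adds 2 to that order.\<close>
  define x2 where "x2 = dbl_num B4 B6 B8 x / dbl_den B2 B4 B6 x"
  obtain t2 where t2: "ec_add E ?P ?P = Point (of_rat x2) (of_rat t2 * s)"
    using double_anti[OF P t] unfolding x2_def by blast
  let ?Q = "Point (of_rat x2) (of_rat t2 * s)"
  have Q: "on_curve E ?Q" using ec_add_closed[OF P P] unfolding t2 .
  have "ec_mult E n ?Q = Infinity" using ec_mult_sum[OF P P, of n] tors(2) unfolding t2 by simp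
  from finite_multiples[OF Q tors(1) this] have fin: "finite (range (\<lambda>k. ec_mult E k ?Q))" .
  have "inj (\<lambda>k. ec_mult E (2 ^ k) ?Q)"
  proof (rule injI)
    fix i j assume ij: "ec_mult E (2 ^ i) ?Q = ec_mult E (2 ^ j) ?Q"
    obtain xi ti where i: "ec_mult E (2 ^ i) ?Q = Point (of_rat xi) (of_rat ti * s)"
      "val_eq xi (- (m + 2 * int i))"
      using anti_orbit[OF Q m(1,2) m(3)[folded x2_def], of i] by blast
    obtain xj tj where j: "ec_mult E (2 ^ j) ?Q = Point (of_rat xj) (of_rat tj * s)"
      "val_eq xj (- (m + 2 * int j))"
      using anti_orbit[OF Q m(1,2) m(3)[folded x2_def], of j] by blast
    have "xi = xj" using ij unfolding i(1) j(1) by simp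
    with i(2) have "val_eq xj (- (m + 2 * int i))" by simp
    from val_eq_unique[OF this j(2)] show "i = j" by simp
  qed
  hence "infinite (range (\<lambda>k. ec_mult E (2 ^ k) ?Q))" by (rule range_inj_infinite)
  moreover have "range (\<lambda>k. ec_mult E (2 ^ k) ?Q) \<subseteq> range (\<lambda>k. ec_mult E k ?Q)" by blast
  ultimately show False using fin finite_subset by blast
qed

lemma K_int: "of_int i \<in> K" "cj (of_int i) = of_int i"
  using K_rat[of "of_int i"] by simp_all

lemma K_num: "numeral i \<in> K" "cj (numeral i) = numeral i"
  using K_rat[of "numeral i"] by simp_all

lemmas K_simps = K_int K_num K_add[THEN conjunct1] K_add[THEN conjunct2]
  K_mult[THEN conjunct1] K_mult[THEN conjunct2] K_diff[THEN conjunct1] K_diff[THEN conjunct2]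
  K_minus[THEN conjunct1] K_minus[THEN conjunct2] K_power[THEN conjunct1] K_power[THEN conjunct2]
  K_divide[THEN conjunct1] K_divide[THEN conjunct2]

lemma ec_add_cj:
  assumes P: "set_ecpoint P \<subseteq> K" and Q: "set_ecpoint Q \<subseteq> K"
  shows "set_ecpoint (ec_add E P Q) \<subseteq> K \<and>
    map_ecpoint cj (ec_add E P Q) = ec_add E (map_ecpoint cj P) (map_ecpoint cj Q)"
proof (cases P; cases Q)
  fix x1 y1 x2 y2 assume pts: "P = Point x1 y1" "Q = Point x2 y2"
  hence k: "x1 \<in> K" "y1 \<in> K" "x2 \<in> K" "y2 \<in> K" using P Q by auto
  have zero: "0 \<in> K" "cj 0 = 0" using K_int[of 0] by simp_all
  have sum: "cj y1 + cj y2 = 0 \<longleftrightarrow> y1 + y2 = 0"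
    using cj_inj[of "y1 + y2" 0] k zero by (simp add: K_simps)
  show ?thesis
  proof (cases "x1 = x2 \<and> y1 + y2 = 0")
    case True
    thus ?thesis using sum unfolding pts by simp
  next
    case False
    define m where "m = (if x1 = x2
      then (3 * x1 ^ 2 + 2 * (of_int B2 / 4) * x1 + of_int B4 / 2) / (2 * y1)
      else (y2 - y1) / (x2 - x1))"
    have mK: "m \<in> K" unfolding m_def using k by (simp add: K_simps)
    have False': "\<not> (cj x1 = cj x2 \<and> cj y1 + cj y2 = 0)" using False sum cj_inj k by simp
    have cm: "cj m = (if cj x1 = cj x2
      then (3 * cj x1 ^ 2 + 2 * (of_int B2 / 4) * cj x1 + of_int B4 / 2) / (2 * cj y1)
      else (cj y2 - cj y1) / (cj x2 - cj x1))"
      unfolding m_def using k cj_inj[of x1 x2] by (simp add: K_simps)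
    show ?thesis unfolding pts ecpoint.map ec_add_slope[OF False m_def] ec_add_slope[OF False' cm]
      using k mK by (simp add: K_simps)
  qed
qed (use P Q in auto)

lemma ec_mult_cj:
  assumes P: "set_ecpoint P \<subseteq> K"
  shows "set_ecpoint (ec_mult E n P) \<subseteq> K \<and>
    map_ecpoint cj (ec_mult E n P) = ec_mult E n (map_ecpoint cj P)"
proof (induction n)
  case (Suc n)
  thus ?case unfolding ec_mult_Suc using ec_add_cj[OF P, of "ec_mult E n P"] by metis
qed simp

lemma on_curve_cj:
  assumes "set_ecpoint P \<subseteq> K" "on_curve E P"
  shows "on_curve E (map_ecpoint cj P)"
proof (cases P)
  case (Point x y)
  hence k: "x \<in> K" "y \<in> K" using assms by auto
  have "cj (y ^ 2) = cj (x ^ 3 + of_int B2 / 4 * x ^ 2 + of_int B4 / 2 * x + of_int B6 / 4)"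
    using assms(2) Point by simp
  thus ?thesis using k Point by (simp add: K_simps)
qed simp

lemma cj_cj: "z \<in> K \<Longrightarrow> cj (cj z) = z"
proof (elim KE)
  fix a b assume z: "z = of_rat a + of_rat b * s"
  show "cj (cj z) = z" unfolding z cj_rep using cj_rep[of a "- b"] by (simp add: of_rat_minus)
qed

text \<open>The line through \<open>P\<close> and the point of order 2 meets the curve again at the
  negative of the conjugate of \<open>P\<close>. So \<open>x\<close> and \<open>cj x\<close> are the
  roots of one rational quadratic equation, whose discriminant is \<open>4 d v^2\<close>; that is
  the equation refuted by \<open>no_half_point\<close>.\<close>

lemma no_translation:
  assumes P: "on_curve E (Point x y)" "x \<in> K" "y \<in> K"
    and Q: "on_curve E (Point (of_rat q) 0)"
    and trans: "Point (cj x) (cj y) = ec_add E (Point x y) (Point (of_rat q) 0)"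
  shows False
proof -
  define m where "m = y / (x - of_rat q)"
  have Q0: "of_rat q ^ 3 + of_int B2 / 4 * of_rat q ^ 2 + of_int B4 / 2 * of_rat q + of_int B6 / 4
      = (0 :: complex)" using Q by simp
  have xq: "x \<noteq> of_rat q"
  proof
    assume "x = of_rat q"
    \<comment> \<open>Otherwise the two points coincide and their sum is
      \<open>Infinity\<close>.\<close>
    hence "y ^ 2 = 0" using P(1) Q0 by simp
    thus False using trans \<open>x = of_rat q\<close> by simp
  qed
  have y: "y = m * (x - of_rat q)" using xq by (simp add: m_def)
  have m: "m = (if x = of_rat q
    then (3 * x ^ 2 + 2 * (of_int B2 / 4) * x + of_int B4 / 2) / (2 * y)
    else (0 - y) / (of_rat q - x))"
    using xq unfolding m_def by (simp add: divide_simps algebra_simps)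
  have nopp: "\<not> (x = of_rat q \<and> y + 0 = 0)" using xq by simp
  from trans[unfolded ec_add_slope[OF nopp m]]
  have cx: "cj x = m ^ 2 - of_int B2 / 4 - x - of_rat q"
    and cy: "cj y = - m * cj x - (y - m * x)" by auto
  have mK: "m \<in> K" unfolding m_def using P by (simp add: K_simps)
  \<comment> \<open>Two slopes for the line from \<open>(q, 0)\<close> to the conjugate point:
    \<open>cj m\<close> by conjugating the line, \<open>- m\<close> by reflecting the third
    intersection point.\<close>
  have "cj y = cj m * (cj x - of_rat q)" unfolding y using mK P by (simp add: K_simps)
  moreover have "cj y = - m * (cj x - of_rat q)" unfolding cy unfolding y by (simp add: algebra_simps)
  moreover have "cj x \<noteq> of_rat q" using xq cj_inj[of x "of_rat q"] P by simp
  ultimately have "cj m = - m" using mult_right_cancel[of "cj x - of_rat q" "cj m" "- m"] by simp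
  then obtain r where r: "m = of_rat r * s" using mK cj_negated by blast
  define X where "X = of_int d * r ^ 2"
  have m2: "m ^ 2 = of_rat X"
    by (simp add: r X_def power_mult_distrib s_sq of_rat_mult of_rat_power mult.commute)
  obtain a v where x: "x = of_rat a + of_rat v * s" using P(2) by (rule KE)
  have "of_rat (2 * a) = x + cj x" unfolding x cj_rep by (simp add: of_rat_mult)
  also have "\<dots> = of_rat (X - of_int B2 / 4 - q)"
    unfolding cx m2 by (simp add: of_rat_diff of_rat_divide)
  finally have a: "2 * a = X - of_int B2 / 4 - q" by (simp only: of_rat_eq_iff)
  have factor: "(x ^ 3 + A * x ^ 2 + B * x + C) - (z ^ 3 + A * z ^ 2 + B * z + C) =
    (x - z) * (x ^ 2 + x * z + z ^ 2 + A * (x + z) + B)" for A B C x z :: complex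
    by (simp add: algebra_simps power2_eq_square power3_eq_cube)
  have "(x - of_rat q) * (m ^ 2 * (x - of_rat q)) = y ^ 2"
    unfolding y by (simp add: power2_eq_square)
  also have "\<dots> = (x ^ 3 + of_int B2 / 4 * x ^ 2 + of_int B4 / 2 * x + of_int B6 / 4) -
    (of_rat q ^ 3 + of_int B2 / 4 * of_rat q ^ 2 + of_int B4 / 2 * of_rat q + of_int B6 / 4)"
    using P(1) unfolding Q0 by simp
  also have "\<dots> = (x - of_rat q) *
    (x ^ 2 + x * of_rat q + of_rat q ^ 2 + of_int B2 / 4 * (x + of_rat q) + of_int B4 / 2)"
    by (rule factor)
  \<comment> \<open>The root \<open>q\<close> is divided out of the intersection cubic, leaving the
    quadratic equation for \<open>x\<close>.\<close>
  finally have quot: "m ^ 2 * (x - of_rat q) =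
      x ^ 2 + x * of_rat q + of_rat q ^ 2 + of_int B2 / 4 * (x + of_rat q) + of_int B4 / 2"
    using xq by simp
  have "of_rat (a ^ 2 - of_int d * v ^ 2) = x * cj x"
    unfolding x cj_rep
    by (simp add: of_rat_diff of_rat_mult of_rat_power power2_eq_square algebra_simps s_sq')
  also have "\<dots> = m ^ 2 * (x - of_rat q) + m ^ 2 * of_rat q - of_int B2 / 4 * x - x ^ 2 - of_rat q * x"
    unfolding cx by (simp add: algebra_simps power2_eq_square)
  also have "\<dots> = of_rat (q ^ 2 + of_int B2 / 4 * q + of_int B4 / 2 + X * q)"
    unfolding quot unfolding m2
    by (simp add: of_rat_add of_rat_mult of_rat_power of_rat_divide algebra_simps)
  finally have prod: "a ^ 2 - of_int d * v ^ 2 = q ^ 2 + of_int B2 / 4 * q + of_int B4 / 2 + X * q"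
    by (simp only: of_rat_eq_iff)
  have root: "(4 * q) ^ 3 + of_int B2 * (4 * q) ^ 2 + 8 * of_int B4 * (4 * q) + 16 * of_int B6 = 0"
  proof -
    have "of_rat ((4 * q) ^ 3 + of_int B2 * (4 * q) ^ 2 + 8 * of_int B4 * (4 * q) + 16 * of_int B6) =
      64 * (of_rat q ^ 3 + of_int B2 / 4 * of_rat q ^ 2 + of_int B4 / 2 * of_rat q + of_int B6 / 4 :: complex)"
      by (simp add: of_rat_add of_rat_mult of_rat_power power_mult_distrib)
    also have "\<dots> = of_rat 0" unfolding Q0 by simp
    finally show ?thesis by (simp only: of_rat_eq_iff)
  qed
  \<comment> \<open>The equation \<open>root\<close>, 64 times the cubic at \<open>q\<close>, is
    monic and integral in \<open>4 * q\<close>.\<close>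
  obtain c where c: "4 * q = of_int c"
  proof -
    define p :: "rat poly" where "p = [:16 * of_int B6, 8 * of_int B4, of_int B2, 1:]"
    have "poly p (4 * q) = 0" using root
      by (simp add: p_def algebra_simps power2_eq_square power3_eq_cube)
    moreover have "Polynomial.coeff p i \<in> \<int>" for i
      unfolding p_def by (auto simp: coeff_pCons split: nat.splits)
    moreover have "lead_coeff p = 1" by (simp add: p_def)
    ultimately have "algebraic_int (4 * q)" by (intro algebraic_int.intros[of p]) auto
    moreover have "4 * q \<in> \<rat>" by (simp add: Rats_def of_rat_eq_id)
    ultimately have "4 * q \<in> \<int>" by (rule rational_algebraic_int_is_int)
    thus ?thesis using that by (auto elim!: Ints_cases)
  qed
  have croot: "c ^ 3 + B2 * c ^ 2 + 8 * B4 * c + 16 * B6 = 0"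
  proof -
    have "of_int (c ^ 3 + B2 * c ^ 2 + 8 * B4 * c + 16 * B6) = (of_int 0 :: rat)"
      using root unfolding c by simp
    thus ?thesis by (simp only: of_int_eq_iff)
  qed
  have q: "q = of_int c / 4" using c by simp
  \<comment> \<open>Sixteen times the discriminant, sum squared minus four times the product of the
    roots; the factor clears the quarters in \<open>q\<close> and in the curve.\<close>
  have "64 * of_int d * v ^ 2 = 16 * (2 * a) ^ 2 - 64 * (a ^ 2 - of_int d * v ^ 2)"
    by (simp add: power2_eq_square)
  also have "\<dots> = (of_int (B2 + 3 * c) - 4 * X) ^ 2 - 4 * of_int (3 * c ^ 2 + 2 * B2 * c + 8 * B4)"
    unfolding prod unfolding a unfolding q by (simp add: field_simps power2_eq_square)
  finally show False
    using no_half_point[OF B8 disc B2 croot d, of r v] unfolding X_def by simp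
qed

theorem torsion_conj_fixed:
  assumes P: "on_curve E P" "set_ecpoint P \<subseteq> K" and n: "n > 0" "ec_mult E n P = Infinity"
  shows "map_ecpoint cj P = P"
proof (rule ccontr)
  assume ne: "map_ecpoint cj P \<noteq> P"
  define P' where "P' = map_ecpoint cj P"
  define Q where "Q = ec_add E P' (ec_neg E P)"
  have neg_cj: "map_ecpoint cj (ec_neg E S) = ec_neg E (map_ecpoint cj S)" "set_ecpoint (ec_neg E S) \<subseteq> K"
    if "set_ecpoint S \<subseteq> K" for S
    using that by (cases S; simp add: K_simps)+
  have P': "on_curve E P'" "set_ecpoint P' \<subseteq> K" "map_ecpoint cj P' = P"
    unfolding P'_def using on_curve_cj[OF P(2,1)] P(2) cj_K cj_cj by (cases P; auto)+
  have Q: "on_curve E Q" unfolding Q_def using P P' by (intro ec_add_closed) auto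
  have QK: "set_ecpoint Q \<subseteq> K \<and> map_ecpoint cj Q = ec_add E P (ec_neg E P')"
    unfolding Q_def using ec_add_cj[OF P'(2) neg_cj(2)[OF P(2)]] neg_cj(1)[OF P(2)] P'(3)
    unfolding P'_def by simp
  have "ec_neg E Q = ec_add E (ec_neg E P') P"
    unfolding Q_def using neg_ec_add[of P' "ec_neg E P"] P P' by simp
  also have "\<dots> = ec_add E P (ec_neg E P')" using P P' by (intro ec_add_comm) auto
  finally have Qneg: "map_ecpoint cj Q = ec_neg E Q" using QK by simp
  have "ec_mult E n P' = Infinity"
    using ec_mult_cj[OF P(2), of n] n(2) unfolding P'_def by simp
  hence Qtors: "ec_mult E n Q = Infinity"
    unfolding Q_def using ec_mult_sum[OF P'(1), of "ec_neg E P" n] ec_mult_neg[OF P(1), of n] n(2) P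
    by simp
  have trans: "ec_add E P Q = P'" unfolding Q_def by (rule ec_add_cancel[OF P'(1) P(1)])
  show False
  proof (cases Q)
    case Infinity
    thus False using trans ne unfolding P'_def by simp
  next
    case (Point q y)
    have k: "q \<in> K" "y \<in> K" "cj q = q" "cj y = - y" using QK Qneg unfolding Point by auto
    obtain q0 where q0: "q = of_rat q0" using k(1,3) by (rule cj_fixed)
    obtain t where t: "y = of_rat t * s" using k(2,4) by (rule cj_negated)
    have "t = 0"
      using no_anti_torsion[of q0 t n] Q Qtors n(1) unfolding Point q0 t by blast
    hence Q0: "Q = Point (of_rat q0) 0" using Point q0 t by simp
    show False
    proof (cases P)
      case Infinity
      thus False using ne by simp
    next
      case P0: (Point x z)
      have "x \<in> K" "z \<in> K" using P(2) P0 by auto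
      moreover have "Point (cj x) (cj z) = ec_add E (Point x z) (Point (of_rat q0) 0)"
        using trans unfolding P'_def P0 Q0 by simp
      ultimately show False using no_translation P(1) Q unfolding P0 Q0 by blast
    qed
  qed
qed

end

section \<open>Conductors and quadratic fields\<close>

lemma field_complex: "field (complex_subring UNIV)"
proof (rule cring.cring_fieldI)
  show c: "cring (complex_subring UNIV)"
  proof (rule cringI)
    show "abelian_group (complex_subring UNIV)"
      by (rule abelian_groupI) (auto simp: complex_subring_def algebra_simps intro: exI[of _ "- x" for x])
    show "Group.comm_monoid (complex_subring UNIV)"
      by (rule comm_monoidI) (auto simp: complex_subring_def)
  qed (auto simp: complex_subring_def algebra_simps)
  have "x * inverse x = 1" if "x \<noteq> 0" for x :: complex using that by simp
  thus "Units (complex_subring UNIV) = carrier (complex_subring UNIV) - {\<zero>\<^bsub>complex_subring UNIV\<^esub>}"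
    by (auto simp: Units_def complex_subring_def) (metis mult.commute right_inverse)
qed

text \<open>Identifies the operations of the ring record with those of the type. At 0 only
  \<open>inverse\<close> has a prescribed value, hence the separate case in
  \<open>adjoin_closed\<close>.\<close>

lemma complex_subring_inv:
  shows "\<ominus>\<^bsub>complex_subring UNIV\<^esub> z = - z"
    and "z \<noteq> 0 \<Longrightarrow> inv\<^bsub>complex_subring UNIV\<^esub> z = inverse z"
proof -
  interpret field "complex_subring UNIV" by (rule field_complex)
  show "\<ominus>\<^bsub>complex_subring UNIV\<^esub> z = - z"
    by (rule minus_equality) (auto simp: complex_subring_def)
  show "z \<noteq> 0 \<Longrightarrow> inv\<^bsub>complex_subring UNIV\<^esub> z = inverse z"
    by (rule comm_inv_char) (auto simp: complex_subring_def)
qed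

lemma adjoin_closed:
  shows "1 \<in> adjoin S" and "z \<in> adjoin S \<Longrightarrow> - z \<in> adjoin S"
    and "z \<in> adjoin S \<Longrightarrow> inverse z \<in> adjoin S"
    and "z \<in> adjoin S \<Longrightarrow> w \<in> adjoin S \<Longrightarrow> z + w \<in> adjoin S"
    and "z \<in> adjoin S \<Longrightarrow> w \<in> adjoin S \<Longrightarrow> z * w \<in> adjoin S"
proof -
  let ?R = "complex_subring UNIV"
  have ops: "\<one>\<^bsub>?R\<^esub> = 1" "\<zero>\<^bsub>?R\<^esub> = 0" "x \<oplus>\<^bsub>?R\<^esub> y = x + y" "x \<otimes>\<^bsub>?R\<^esub> y = x * y" for x y
    by (simp_all add: complex_subring_def)
  show "1 \<in> adjoin S" using generate_field.one[of ?R S] by (simp add: adjoin_def ops)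
  show "z \<in> adjoin S \<Longrightarrow> - z \<in> adjoin S"
    using generate_field.a_inv[of z ?R S] by (simp add: adjoin_def complex_subring_inv)
  show "z \<in> adjoin S \<Longrightarrow> inverse z \<in> adjoin S"
    using generate_field.m_inv[of z ?R S] complex_subring_inv(2)[of z]
    by (cases "z = 0") (simp_all add: adjoin_def ops)
  show "z \<in> adjoin S \<Longrightarrow> w \<in> adjoin S \<Longrightarrow> z + w \<in> adjoin S"
    using generate_field.eng_add[of z ?R S w] by (simp add: adjoin_def ops)
  show "z \<in> adjoin S \<Longrightarrow> w \<in> adjoin S \<Longrightarrow> z * w \<in> adjoin S"
    using generate_field.eng_mult[of z ?R S w] by (simp add: adjoin_def ops)
qed

lemma adjoin_minimal:
  assumes "S \<subseteq> L" "1 \<in> L" "\<And>z. z \<in> L \<Longrightarrow> - z \<in> L" "\<And>z. z \<in> L \<Longrightarrow> inverse z \<in> L"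
    "\<And>z w. z \<in> L \<Longrightarrow> w \<in> L \<Longrightarrow> z + w \<in> L" "\<And>z w. z \<in> L \<Longrightarrow> w \<in> L \<Longrightarrow> z * w \<in> L"
  shows "adjoin S \<subseteq> L"
proof
  let ?R = "complex_subring UNIV"
  have ops: "\<one>\<^bsub>?R\<^esub> = 1" "\<zero>\<^bsub>?R\<^esub> = 0" "x \<oplus>\<^bsub>?R\<^esub> y = x + y" "x \<otimes>\<^bsub>?R\<^esub> y = x * y" for x y
    by (simp_all add: complex_subring_def)
  fix z assume "z \<in> adjoin S"
  thus "z \<in> L" unfolding adjoin_def
    by (induction rule: generate_field.induct) (use assms in \<open>auto simp: ops complex_subring_inv\<close>)
qed

lemma Rats_subset_adjoin: "\<rat> \<subseteq> adjoin S"
proof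
  fix z :: complex assume "z \<in> \<rat>"
  then obtain a b :: int where z: "z = of_int a / of_int b" by (auto elim!: Rats_cases')
  have zero: "0 \<in> adjoin S" using adjoin_closed(4)[OF adjoin_closed(1) adjoin_closed(2)[OF adjoin_closed(1)]] by simp
  have nat: "of_nat n \<in> adjoin S" for n
    by (induction n) (auto intro: zero adjoin_closed)
  have "of_int i \<in> adjoin S" for i
    by (cases i rule: int_cases2) (auto intro: nat adjoin_closed)
  thus "z \<in> adjoin S" unfolding z divide_inverse by (intro adjoin_closed)
qed

lemma (in quad_ext) adjoin_subset_K: "adjoin {s} \<subseteq> K"
proof (rule adjoin_minimal)
  show "{s} \<subseteq> K" using KI[of 0 1] by simp
  show "1 \<in> K" using K_rat[of 1] by simp
qed (use K_minus K_inverse K_add K_mult in auto)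

section \<open>Integral models and bad primes\<close>

lemma of_int_disc: "disc (map_wcurve of_int W) = (of_int (disc W) :: 'a::comm_ring_1)"
  by (simp add: disc_def b2_def b4_def b6_def b8_def wcurve.map_sel)

lemma disc_change_scale:
  fixes E :: "'a::field wcurve"
  shows "disc (change_vars u 0 0 0 E) = disc E / u ^ 12"
proof -
  define i where "i = inverse u"
  define E' where "E' = change_vars u 0 0 0 E"
  have E': "a1 E' = a1 E * i" "a2 E' = a2 E * i ^ 2" "a3 E' = a3 E * i ^ 3"
    "a4 E' = a4 E * i ^ 4" "a6 E' = a6 E * i ^ 6"
    unfolding E'_def change_vars_inverse by (simp_all add: Let_def i_def)
  have b: "b2 E' = b2 E * i ^ 2" "b4 E' = b4 E * i ^ 4" "b6 E' = b6 E * i ^ 6" "b8 E' = b8 E * i ^ 8"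
    unfolding b2_def b4_def b6_def b8_def E' by (simp_all add: algebra_simps eval_nat_numeral)
  have "disc E' = disc E * i ^ 12"
    unfolding disc_def b by (simp add: algebra_simps eval_nat_numeral)
  thus ?thesis unfolding E'_def i_def by (simp add: divide_inverse power_inverse)
qed

text \<open>Scaling by \<open>u = 1 / N\<close> multiplies the coefficient of index \<open>i\<close>
  by \<open>N^i\<close>, so any common denominator \<open>N\<close> of the five coefficients
  works.\<close>

lemma integral_model_exists:
  obtains W where "integral_model E W" "disc E \<noteq> 0 \<Longrightarrow> disc W \<noteq> 0"
proof -
  have den: "\<exists>n::int. n \<noteq> 0 \<and> of_int n * q \<in> \<int>" for q :: rat
  proof -
    obtain a b where "b \<noteq> 0" "q = of_int a / of_int b"
      by (metis Fract_of_int_quotient Rat_cases less_irrefl)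
    thus ?thesis by (intro exI[of _ b]) simp
  qed
  obtain n1 n2 n3 n4 n6 :: int where n: "n1 \<noteq> 0" "n2 \<noteq> 0" "n3 \<noteq> 0" "n4 \<noteq> 0" "n6 \<noteq> 0"
    "of_int n1 * a1 E \<in> \<int>" "of_int n2 * a2 E \<in> \<int>" "of_int n3 * a3 E \<in> \<int>"
    "of_int n4 * a4 E \<in> \<int>" "of_int n6 * a6 E \<in> \<int>"
    using den[of "a1 E"] den[of "a2 E"] den[of "a3 E"] den[of "a4 E"] den[of "a6 E"] by blast
  define N where "N = n1 * n2 * n3 * n4 * n6"
  have N0: "N \<noteq> 0" using n by (simp add: N_def)
  have int: "of_int N ^ Suc k * q \<in> \<int>" if "of_int m * q \<in> \<int>" "N = l * m" for q :: rat and m l k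
  proof -
    have "of_int N ^ Suc k * q = of_int (N ^ k * l) * (of_int m * q)"
      using that(2) by simp
    thus ?thesis using that(1) by (metis Ints_mult Ints_of_int)
  qed
  have "of_int N ^ Suc 0 * a1 E \<in> \<int>"
    by (rule int[OF n(6), of "n2 * n3 * n4 * n6"]) (simp add: N_def)
  then obtain w1 where w1: "of_int N ^ 1 * a1 E = of_int w1" by (auto elim!: Ints_cases)
  have "of_int N ^ Suc 1 * a2 E \<in> \<int>"
    by (rule int[OF n(7), of "n1 * n3 * n4 * n6"]) (simp add: N_def)
  then obtain w2 where w2: "of_int N ^ 2 * a2 E = of_int w2"
    unfolding Suc_1 by (auto elim!: Ints_cases)
  have "of_int N ^ Suc 2 * a3 E \<in> \<int>"
    by (rule int[OF n(8), of "n1 * n2 * n4 * n6"]) (simp add: N_def)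
  then obtain w3 where w3: "of_int N ^ 3 * a3 E = of_int w3"
    unfolding Suc_numeral by (auto elim!: Ints_cases)
  have "of_int N ^ Suc 3 * a4 E \<in> \<int>"
    by (rule int[OF n(9), of "n1 * n2 * n3 * n6"]) (simp add: N_def)
  then obtain w4 where w4: "of_int N ^ 4 * a4 E = of_int w4"
    unfolding Suc_numeral by (auto elim!: Ints_cases)
  have "of_int N ^ Suc 5 * a6 E \<in> \<int>"
    by (rule int[OF n(10), of "n1 * n2 * n3 * n4"]) (simp add: N_def)
  then obtain w6 where w6: "of_int N ^ 6 * a6 E = of_int w6"
    unfolding Suc_numeral by (auto elim!: Ints_cases)
  define u :: rat where "u = inverse (of_int N)"
  have u: "u \<noteq> 0" using N0 by (simp add: u_def)
  define W where "W = WCurve w1 w2 w3 w4 w6"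
  have W: "map_wcurve of_int W = change_vars u 0 0 0 E"
    unfolding change_vars_inverse W_def u_def
    using w1 w2 w3 w4 w6 by (simp add: Let_def mult.commute)
  have "integral_model E W" unfolding integral_model_def using u W by blast
  moreover have "disc W \<noteq> 0" if "disc E \<noteq> 0"
  proof -
    have "of_int (disc W) = disc E / u ^ 12"
      using of_int_disc[of W] disc_change_scale[of u E] W by metis
    thus ?thesis using that u by auto
  qed
  ultimately show ?thesis using that by blast
qed

text \<open>A prime not dividing the discriminant of an integral model is good, valuation 0 being
  minimal. Finiteness matters because a product over an infinite set has the default value
  1.\<close>

lemma finite_bad_primes:
  assumes "elliptic_curve E"
  shows "finite {p. Factorial_Ring.prime p \<and> \<not> good_reduction p E}"
proof -
  obtain W where W: "integral_model E W" "disc W \<noteq> 0"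
    using integral_model_exists assms unfolding elliptic_curve_def by metis
  have "p \<le> nat \<bar>disc W\<bar>" if "\<not> good_reduction p E" for p
  proof -
    have "int p dvd disc W"
    proof (rule ccontr)
      assume nd: "\<not> int p dvd disc W"
      hence "minimal_model_at p E W"
        using W(1) unfolding minimal_model_at_def is_arg_min_def
        by (simp add: not_dvd_imp_multiplicity_0)
      thus False using that nd unfolding good_reduction_def by (auto simp: cong_0_iff)
    qed
    hence "int p \<le> \<bar>disc W\<bar>" using W(2) by (metis dvd_abs_iff zdvd_imp_le zero_less_abs_iff)
    thus ?thesis by linarith
  qed
  hence "{p. Factorial_Ring.prime p \<and> \<not> good_reduction p E} \<subseteq> {..nat \<bar>disc W\<bar>}" by auto
  thus ?thesis by (rule finite_subset) simp
qed

text \<open>At a bad prime the exponent is 1 or 2 plus a natural number, hence positive.\<close>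

lemma bad_prime_dvd_conductor:
  assumes "elliptic_curve E" "Factorial_Ring.prime p" "\<not> good_reduction p E"
  shows "p dvd conductor E"
proof -
  have "p ^ conductor_exponent p E dvd conductor E" unfolding conductor_def
    using finite_bad_primes[OF assms(1)] assms(2,3) by (intro dvd_prodI) auto
  moreover have "conductor_exponent p E > 0" using assms(3) by (simp add: conductor_exponent_def)
  ultimately show ?thesis by (meson dvd_power dvd_trans)
qed

text \<open>Closure under addition is known only on \<open>E\<close>; the equivalence
  \<open>on\<close> carries it back to \<open>E'\<close> within the same induction.\<close>

lemma (in cubic_curve) ec_mult_transfer:
  assumes on: "\<And>P. on_curve E (\<phi> P) \<longleftrightarrow> on_curve E' P" and inf: "\<phi> Infinity = Infinity"
    and add: "\<And>P Q. on_curve E' P \<Longrightarrow> on_curve E' Q \<Longrightarrow> ec_add E (\<phi> P) (\<phi> Q) = \<phi> (ec_add E' P Q)"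
    and P: "on_curve E' P"
  shows "on_curve E' (ec_mult E' n P) \<and> ec_mult E n (\<phi> P) = \<phi> (ec_mult E' n P)"
proof (induction n)
  case 0
  show ?case using inf by (simp add: ec_mult_def)
next
  case (Suc n)
  have "ec_mult E' (Suc n) P = ec_add E' P (ec_mult E' n P)" by (simp add: ec_mult_def)
  moreover have "on_curve E (ec_add E (\<phi> P) (\<phi> (ec_mult E' n P)))"
    using Suc P on by (intro ec_add_closed) auto
  ultimately show ?case using add[OF P conjunct1[OF Suc]] on Suc unfolding ec_mult_Suc by metis
qed

text \<open>The model without \<open>xy\<close> and \<open>y\<close> terms is reached by a rational,
  invertible change of variables, which preserves \<open>K\<close>-points, torsion and rationality;
  so conjugation invariance of the image makes \<open>P\<close> rational.\<close>

lemma good_reduction_torsion: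
  fixes E :: "rat wcurve"
  assumes "good_reduction 2 E" "squarefree d" "2 dvd d"
  shows "E_tors E (quadratic_field d) = E_tors E \<rat>"
proof -
  obtain W u r t0 t where W: "\<not> [disc W = 0] (mod 2)" "u \<noteq> 0"
    "map_wcurve of_int W = change_vars u r t0 t E"
    using assms(1) unfolding good_reduction_def minimal_model_at_def is_arg_min_def integral_model_def
    by auto
  define s where "s = csqrt (of_int d)"
  have "odd (d div 2)"
  proof
    assume "even (d div 2)"
    hence "2 ^ 2 dvd d" using assms(3) by (auto elim!: dvdE)
    from squarefreeD[OF assms(2) this] show False by simp
  qed
  interpret good_quad s d "b2 W" "b4 W" "b6 W" "b8 W"
  proof
    show "s ^ 2 = of_int d" by (simp add: s_def)
    show "val_eq (of_int d) 1" by (rule val_eq_half_double) fact+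
    show "4 * b8 W = b2 W * b6 W - b4 W ^ 2"
      unfolding b2_def b4_def b6_def b8_def by (simp add: algebra_simps power2_eq_square)
    show "odd (- (b2 W ^ 2 * b8 W) - 8 * b4 W ^ 3 - 27 * b6 W ^ 2 + 9 * b2 W * b4 W * b6 W)"
      using W(1) unfolding disc_def by (simp add: cong_0_iff)
    show "b2 W mod 4 = 0 \<or> b2 W mod 4 = 1"
    proof (cases "even (a1 W)")
      case True
      then obtain k where "a1 W = 2 * k" by (rule dvdE)
      hence "b2 W = 4 * (k ^ 2 + a2 W)" by (simp add: b2_def power_mult_distrib)
      thus ?thesis by simp
    next
      case False
      then obtain k where "a1 W = 2 * k + 1" by (rule oddE)
      hence "b2 W = 4 * (k ^ 2 + k + a2 W) + 1" by (simp add: b2_def power2_eq_square algebra_simps)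
      then obtain j where "b2 W = 4 * j + 1" by blast
      thus ?thesis by presburger
    qed
  qed
  define EC where "EC = map_wcurve complex_of_rat E"
  define WC where "WC = change_vars (of_rat u) (of_rat r) (of_rat t0) (of_rat t) EC"
  \<comment> \<open>The shifts that complete the square in \<open>y\<close>, making the new
    \<open>a1\<close> and \<open>a3\<close> vanish.\<close>
  define h1 where "h1 = - of_int (a1 W) / (2 :: rat)"
  define h3 where "h3 = - of_int (a3 W) / (2 :: rat)"
  have "WC = map_wcurve of_rat (map_wcurve of_int W)"
    unfolding WC_def EC_def map_change_vars[symmetric] W(3) ..
  also have "\<dots> = map_wcurve of_int W" by (simp add: wcurve.map_comp o_def)
  finally have WC: "WC = map_wcurve of_int W" .
  have C: "change_vars 1 0 (of_rat h1) (of_rat h3) WC =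
    WCurve 0 (of_int (b2 W) / 4) 0 (of_int (b4 W) / 2) (of_int (b6 W) / 4)"
    unfolding change_vars_def WC h1_def h3_def b2_def b4_def b6_def
    by (simp add: wcurve.map_sel of_rat_divide of_rat_minus field_simps power2_eq_square)
  define \<phi> where "\<phi> P = change_point 1 0 (complex_of_rat h1) (of_rat h3)
    (change_point (of_rat u) (of_rat r) (of_rat t0) (of_rat t) P)" for P
  have u: "complex_of_rat u \<noteq> 0" using W(2) by simp
  let ?C = "WCurve 0 (of_int (b2 W) / 4) 0 (of_int (b4 W) / 2) (of_int (b6 W) / 4) :: complex wcurve"
  have on: "on_curve ?C (\<phi> P) \<longleftrightarrow> on_curve EC P" for P
    unfolding \<phi>_def C[symmetric] using on_curve_change[OF u, of _ _ _ EC P]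
    by (simp only: on_curve_change[OF one_neq_zero] WC_def)
  have add: "ec_add ?C (\<phi> P) (\<phi> Q) = \<phi> (ec_add EC P Q)" if "on_curve EC P" "on_curve EC Q" for P Q
  proof -
    have "on_curve WC (change_point (of_rat u) (of_rat r) (of_rat t0) (of_rat t) S)"
      if "on_curve EC S" for S using that unfolding WC_def on_curve_change[OF u] .
    thus ?thesis using that unfolding \<phi>_def C[symmetric]
      by (simp only: ec_add_change[OF one_neq_zero]) (simp only: WC_def ec_add_change[OF u])
  qed
  have inf: "\<phi> Infinity = Infinity" by (simp add: \<phi>_def)
  have "P \<in> E_tors E \<rat>" if P: "P \<in> E_tors E (quadratic_field d)" for P
  proof -
    obtain n where n: "n > 0" "ec_mult EC n P = Infinity" and PC: "on_curve EC P"
      and PK: "set_ecpoint P \<subseteq> K"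
      using P adjoin_subset_K unfolding E_tors_def rational_points_def EC_def quadratic_field_def
        s_def[symmetric] by auto
    have "set_ecpoint P \<subseteq> \<rat>"
    proof (cases P)
      case (Point x y)
      define x1 where "x1 = (x - of_rat r) / of_rat u ^ 2"
      define y1 where "y1 = (y - of_rat t - of_rat t0 * (x - of_rat r)) / of_rat u ^ 3"
      define y2 where "y2 = y1 - of_rat h3 - of_rat h1 * x1"
      have \<phi>P: "\<phi> P = Point x1 y2" unfolding \<phi>_def Point by (simp add: x1_def y1_def y2_def)
      have k: "x \<in> K" "y \<in> K" using PK Point by auto
      have K1: "x1 \<in> K" unfolding x1_def using k by (simp add: K_simps)
      moreover have "y1 \<in> K" unfolding y1_def using k by (simp add: K_simps)
      ultimately have K2: "y2 \<in> K" unfolding y2_def by (simp add: K_simps)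
      have "map_ecpoint cj (\<phi> P) = \<phi> P"
      proof (rule torsion_conj_fixed)
        show "on_curve ?C (\<phi> P)" using on PC by blast
        show "set_ecpoint (\<phi> P) \<subseteq> K" unfolding \<phi>P using K1 K2 by simp
        show "ec_mult ?C n (\<phi> P) = Infinity"
          using ec_mult_transfer[OF on inf add PC, of n] n(2) inf by simp
      qed fact
      hence "cj x1 = x1" "cj y2 = y2" unfolding \<phi>P by auto
      hence r1: "x1 \<in> \<rat>" "y2 \<in> \<rat>" using K1 K2 cj_fixed by (metis Rats_of_rat)+
      have "y1 = y2 + of_rat h3 + of_rat h1 * x1" by (simp add: y2_def)
      hence r2: "y1 \<in> \<rat>" using r1 by simp
      have x: "x = x1 * of_rat u ^ 2 + of_rat r" using u by (simp add: x1_def)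
      hence r3: "x \<in> \<rat>" using r1 by simp
      have "y = y1 * of_rat u ^ 3 + of_rat t + of_rat t0 * (x - of_rat r)" using u by (simp add: y1_def)
      hence "y \<in> \<rat>" using r2 r3 by simp
      thus ?thesis using r3 Point by simp
    qed simp
    thus ?thesis using P unfolding E_tors_def rational_points_def by auto
  qed
  moreover have "E_tors E \<rat> \<subseteq> E_tors E (quadratic_field d)"
    using Rats_subset_adjoin unfolding E_tors_def rational_points_def quadratic_field_def by blast
  ultimately show ?thesis by blast
qed

theorem theorem1p5:
  fixes E :: "rat wcurve" and d :: int
  assumes "elliptic_curve E"
    and "squarefree d" and "d \<noteq> 1"
    and "E_tors E \<rat> \<noteq> E_tors E (quadratic_field d)"
    and "2 dvd d"
  shows "2 dvd conductor E"
proof (rule bad_prime_dvd_conductor)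
  show "\<not> good_reduction 2 E" using good_reduction_torsion[of E d] assms by auto
qed (use assms(1) in simp_all)

end
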